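(* Let $TM\simeq S^k(E)$ be a $GL(2)$-structure on a smooth manifold $M$ of dimension $k+1>3$. There is a unique $GL(2)$-connection $\phi=(\phi^i_j)_{i,j=1,2}$ with values in $\mathfrak{gl}(2)$ whose torsion $\Theta$ satisfies $\Theta_\chi(X,\cdot)\in\mathfrak{g}_k^\perp$ for every $\chi\in B(E)$ and every $X\in T_\chi B(E)$.
   Context: $\mathcal{H}_k$ is the real vector space of homogeneous polynomials of degree $k$ in $x,y$, with basis of monomials $(x^k,x^{k-1}y,\ldots,y^k)$ and right action of $GL(2)=GL(2,\mathbb{R})$ given by $(V\cdot g)(x,y)=V((x,y)g)$; $\rho_k(g)$ denotes the matrix of $V\mapsto V\cdot g$ in the monomial basis. The Lie algebra $\mathfrak{g}_k\subset\mathcal{H}_k^*\otimes\mathcal{H}_k$ is the image of $\mathfrak{gl}(2)$ under the corresponding representation $d\rho_k$, i.e. the set of matrices (in the monomial basis) $$\Phi=\begin{pmatrix}k\phi^1_1&\phi^2_1&0&\cdots&0\\k\phi^1_2&(k-1)\phi^1_1+\phi^2_2&2\phi^2_1&\cdots&0\\0&(k-1)\phi^1_2&(k-2)\phi^1_1+2\phi^2_2&\cdots&0\\\vdots&\vdots&\vdots&\ddots&\vdots\\0&0&0&\cdots&k\phi^2_2\end{pmatrix},\qquad\begin{pmatrix}\phi^1_1&\phi^2_1\\\phi^1_2&\phi^2_2\end{pmatrix}\in\mathfrak{gl}(2).$$ Put $$\mathfrak{g}_k^\perp=\{\psi\in\mathcal{H}_k^*\otimes\mathcal{H}_k\ |\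 \mathrm{tr}(\eta\circ\psi)=0\ \ \forall\,\eta\in\mathfrak{g}_k\}.$$ A $GL(2)$-structure on a manifold $M$ of dimension $k+1$ is an isomorphism of vector bundles $TM\simeq S^k(E)$, where $E\to M$ is a real rank-2 vector bundle and $S^k(E)$ is its $k$-th symmetric tensor power. $\pi:B(E)\to M$ is the bundle of frames of $TM$ of the form $\chi=(x^k,x^{k-1}y,\ldots,y^k)$, where $(x,y)$ is a basis of $E_p$; $GL(2)$ acts on it on the right via $(x,y)\mapsto(x,y)g$, i.e. $\chi\mapsto\chi\rho_k(g)$. $\omega=(\omega^0,\ldots,\omega^k)^t$ is the canonical $\mathcal{H}_k$-valued soldering form: $\pi_*v=\sum_i x^{k-i}y^i\,\omega^i(v)$ at $\chi$. A $GL(2)$-connection is given by a $\mathfrak{gl}(2)$-valued $1$-form $\phi=(\phi^i_j)$ on $B(E)$ such that the corresponding $\mathfrak{g}_k$-valued form $\Phi$ (displayed above) is a principal connection form on $B(E)$. Its torsion $\Theta$ is the horizontal $\mathcal{H}_k$-valued $2$-form defined by $d\omega=-\Phi\wedge\omega+\Theta$. Since $\Theta$ is horizontal, via $\omega$ we regard $\Theta_\chi\in(\mathcal{H}_k^*\wedge\mathcal{H}_k^* )\otimes\mathcal{H}_k$, and $\Theta_\chi(X,\cdot)\in\mathcal{H}_k^*\otimes\mathcal{H}_k$ is the endomorphism $\omega(Y)\mapsto\Theta_\chi(X,Y)$. *)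

theory Defs
  imports
    "HOL-Analysis.Analysis"
    "HOL-Library.Function_Algebras"
    "HOL-Computational_Algebra.Polynomial"
begin

section \<open>Pointwise vector space structure on functions\<close>

instantiation "fun" :: (type, real_vector) real_vector
begin

definition scaleR_fun :: "real \<Rightarrow> ('a \<Rightarrow> 'b) \<Rightarrow> 'a \<Rightarrow> 'b" where
  "scaleR_fun r f = (\<lambda>x. r *\<^sub>R f x)"

instance
  by standard (simp_all add: scaleR_fun_def plus_fun_def scaleR_add_right scaleR_add_left)

end

definition linear_on_space :: "'b::real_vector set \<Rightarrow> ('b \<Rightarrow> 'c::real_vector) \<Rightarrow> bool" where
  "linear_on_space T f \<longleftrightarrow>
     (\<forall>u\<in>T. \<forall>v\<in>T. f (u + v) = f u + f v) \<and> (\<forall>r. \<forall>u\<in>T. f (r *\<^sub>R u) = r *\<^sub>R f u)"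


section \<open>Smooth manifolds\<close>

text \<open>The two notions of differentiability below are only meant for open \<open>S\<close>.\<close>

primrec Cn_on :: "nat \<Rightarrow> 'a::real_normed_vector set \<Rightarrow> ('a \<Rightarrow> 'b::real_normed_vector) \<Rightarrow> bool" where
  "Cn_on 0 S f \<longleftrightarrow> continuous_on S f"
| "Cn_on (Suc n) S f \<longleftrightarrow>
     (\<forall>x\<in>S. f differentiable (at x)) \<and> (\<forall>v. Cn_on n S (\<lambda>x. frechet_derivative f (at x) v))"

definition smooth_on :: "'a::real_normed_vector set \<Rightarrow> ('a \<Rightarrow> 'b::real_normed_vector) \<Rightarrow> bool" where
  "smooth_on S f \<longleftrightarrow> (\<forall>n. Cn_on n S f)"

text \<open>A chart is given by its domain and its coordinate map; the values of the coordinate map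
  outside the domain are irrelevant.\<close>

type_synonym ('a, 'e) chart = "'a set \<times> ('a \<Rightarrow> 'e)"

definition chart_inv :: "('a, 'e) chart \<Rightarrow> 'e \<Rightarrow> 'a" where
  "chart_inv c = inv_into (fst c) (snd c)"

definition charts_at :: "('a, 'e) chart set \<Rightarrow> 'a \<Rightarrow> ('a, 'e) chart set" where
  "charts_at A p = {c\<in>A. p \<in> fst c}"

definition smooth_atlas :: "'a set \<Rightarrow> ('a, 'e::euclidean_space) chart set \<Rightarrow> bool" where
  "smooth_atlas S A \<longleftrightarrow>
     (\<Union>c\<in>A. fst c) = S \<and>
     (\<forall>c\<in>A. inj_on (snd c) (fst c) \<and> open (snd c ` fst c)) \<and>
     (\<forall>c\<in>A. \<forall>d\<in>A. open (snd c ` (fst c \<inter> fst d)) \<and>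
        smooth_on (snd c ` (fst c \<inter> fst d)) (snd d \<circ> chart_inv c))"

definition smooth_manifold :: "'a topology \<Rightarrow> ('a, 'e::euclidean_space) chart set \<Rightarrow> bool" where
  "smooth_manifold X A \<longleftrightarrow>
     Hausdorff_space X \<and> second_countable X \<and> smooth_atlas (topspace X) A \<and>
     (\<forall>c\<in>A. openin X (fst c) \<and>
        homeomorphic_map (subtopology X (fst c)) (top_of_set (snd c ` fst c)) (snd c))"

definition smooth_fun ::
  "('a, 'e::euclidean_space) chart set \<Rightarrow> 'a set \<Rightarrow> ('a \<Rightarrow> 'b::real_normed_vector) \<Rightarrow> bool" where
  "smooth_fun A U f \<longleftrightarrow> (\<forall>c\<in>A. smooth_on (snd c ` (U \<inter> fst c)) (f \<circ> chart_inv c))"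

text \<open>A tangent vector at \<open>p\<close> is the family of its coordinate vectors in the charts around \<open>p\<close>,
  extended by 0 to all other charts.\<close>

type_synonym ('a, 'e) tangent = "('a, 'e) chart \<Rightarrow> 'e"

definition tangent_space ::
  "('a, 'e::euclidean_space) chart set \<Rightarrow> 'a \<Rightarrow> ('a, 'e) tangent set" where
  "tangent_space A p =
     {v. (\<forall>c. c \<notin> charts_at A p \<longrightarrow> v c = 0) \<and>
         (\<forall>c\<in>charts_at A p. \<forall>d\<in>charts_at A p.
            v d = frechet_derivative (snd d \<circ> chart_inv c) (at (snd c p)) (v c))}"

definition coord_vec ::
  "('a, 'e::euclidean_space) chart set \<Rightarrow> ('a, 'e) chart \<Rightarrow> 'a \<Rightarrow> 'e \<Rightarrow> ('a, 'e) tangent" where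
  "coord_vec A c p u =
     (\<lambda>d. if d \<in> charts_at A p
          then frechet_derivative (snd d \<circ> chart_inv c) (at (snd c p)) u else 0)"

text \<open>In the next definition and in \<open>ext_deriv\<close> the result does not depend on the choice of the chart.\<close>

definition tangent_map ::
  "('a, 'e::euclidean_space) chart set \<Rightarrow> ('b, 'f::euclidean_space) chart set \<Rightarrow> ('a \<Rightarrow> 'b) \<Rightarrow>
     'a \<Rightarrow> ('a, 'e) tangent \<Rightarrow> ('b, 'f) tangent" where
  "tangent_map A A' F p v =
     (let c = (SOME c. c \<in> charts_at A p) in
      (\<lambda>d. if d \<in> charts_at A' (F p)
           then frechet_derivative (snd d \<circ> F \<circ> chart_inv c) (at (snd c p)) (v c) else 0))"


section \<open>Differential forms\<close>

type_synonym ('a, 'e, 'b) form1 = "'a \<Rightarrow> ('a, 'e) tangent \<Rightarrow> 'b"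

definition form_coeff ::
  "('a, 'e::euclidean_space) chart set \<Rightarrow> ('a, 'e, 'b) form1 \<Rightarrow> ('a, 'e) chart \<Rightarrow> 'e \<Rightarrow> 'e \<Rightarrow> 'b" where
  "form_coeff A \<alpha> c u = (\<lambda>x. \<alpha> (chart_inv c x) (coord_vec A c (chart_inv c x) u))"

text \<open>Forms are required to vanish off the tangent bundle, so that equality of forms is equality of
  functions.\<close>

definition smooth_form1 ::
  "'a set \<Rightarrow> ('a, 'e::euclidean_space) chart set \<Rightarrow> ('a, 'e, 'b::real_normed_vector) form1 \<Rightarrow> bool" where
  "smooth_form1 S A \<alpha> \<longleftrightarrow>
     (\<forall>p\<in>S. linear_on_space (tangent_space A p) (\<alpha> p)) \<and>
     (\<forall>p v. p \<notin> S \<or> v \<notin> tangent_space A p \<longrightarrow> \<alpha> p v = 0) \<and>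
     (\<forall>c\<in>A. \<forall>u. smooth_on (snd c ` fst c) (form_coeff A \<alpha> c u))"

text \<open>The exterior derivative, with the normalisation
  \<open>d\<alpha>(V, W) = V(\<alpha>(W)) - W(\<alpha>(V)) - \<alpha>([V, W])\<close>.\<close>

definition ext_deriv ::
  "('a, 'e::euclidean_space) chart set \<Rightarrow> ('a, 'e, 'b::real_normed_vector) form1 \<Rightarrow>
     'a \<Rightarrow> ('a, 'e) tangent \<Rightarrow> ('a, 'e) tangent \<Rightarrow> 'b" where
  "ext_deriv A \<alpha> p v w =
     (let c = (SOME c. c \<in> charts_at A p) in
      frechet_derivative (form_coeff A \<alpha> c (w c)) (at (snd c p)) (v c) -
      frechet_derivative (form_coeff A \<alpha> c (v c)) (at (snd c p)) (w c))"


section \<open>Vector bundles\<close>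

text \<open>The fibres are subspaces of an arbitrary ambient real vector space, which is no loss of
  generality, since the ambient space plays no role in the smooth structure. The latter is given by
  an open cover with local frames \<open>(U, e)\<close>, indexed by \<open>vb_index\<close>, whose transition functions
  are smooth.\<close>

record ('a, 'i, 'v) vbundle =
  vb_index :: "'i set"
  vb_fibre :: "'a \<Rightarrow> 'v set"
  vb_frames :: "('a set \<times> ('i \<Rightarrow> 'a \<Rightarrow> 'v)) set"

definition vector_bundle ::
  "'a topology \<Rightarrow> ('a, 'e::euclidean_space) chart set \<Rightarrow> ('a, 'i, 'v::real_vector) vbundle \<Rightarrow> bool" where
  "vector_bundle X A E \<longleftrightarrow>
     finite (vb_index E) \<and>
     (\<forall>p\<in>topspace X. subspace (vb_fibre E p)) \<and>
     (\<Union>(U, e)\<in>vb_frames E. U) = topspace X \<and>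
     (\<forall>(U, e)\<in>vb_frames E. openin X U \<and>
        (\<forall>p\<in>U. inj_on (\<lambda>i. e i p) (vb_index E) \<and>
           independent ((\<lambda>i. e i p) ` vb_index E) \<and>
           span ((\<lambda>i. e i p) ` vb_index E) = vb_fibre E p)) \<and>
     (\<forall>(U, e)\<in>vb_frames E. \<forall>(V, f)\<in>vb_frames E. \<exists>G.
        (\<forall>i\<in>vb_index E. \<forall>j\<in>vb_index E. smooth_fun A (U \<inter> V) (G i j)) \<and>
        (\<forall>p\<in>U \<inter> V. \<forall>j\<in>vb_index E. f j p = (\<Sum>i\<in>vb_index E. G i j p *\<^sub>R e i p)))"

definition vbundle_iso ::
  "'a topology \<Rightarrow> ('a, 'e::euclidean_space) chart set \<Rightarrow>
     ('a, 'i, 'v::real_vector) vbundle \<Rightarrow> ('a, 'j, 'w::real_vector) vbundle \<Rightarrow>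
     ('a \<Rightarrow> 'v \<Rightarrow> 'w) \<Rightarrow> bool" where
  "vbundle_iso X A E F s \<longleftrightarrow>
     (\<forall>p\<in>topspace X. linear_on_space (vb_fibre E p) (s p) \<and>
        bij_betw (s p) (vb_fibre E p) (vb_fibre F p)) \<and>
     (\<forall>(U, e)\<in>vb_frames E. \<forall>(V, f)\<in>vb_frames F. \<exists>G.
        (\<forall>i\<in>vb_index F. \<forall>j\<in>vb_index E. smooth_fun A (U \<inter> V) (G i j)) \<and>
        (\<forall>p\<in>U \<inter> V. \<forall>j\<in>vb_index E. s p (e j p) = (\<Sum>i\<in>vb_index F. G i j p *\<^sub>R f i p)))"

definition tangent_bundle ::
  "('a, 'e::euclidean_space) chart set \<Rightarrow> ('a, 'e, ('a, 'e) tangent) vbundle" where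
  "tangent_bundle A =
     \<lparr>vb_index = Basis, vb_fibre = tangent_space A,
      vb_frames = (\<lambda>c. (fst c, \<lambda>b p. coord_vec A c p b)) ` A\<rparr>"

text \<open>The symmetric product \<open>v\<^sub>1 \<cdots> v\<^sub>k\<close> of vectors is realised as the polynomial function
  \<open>\<xi> \<mapsto> \<xi>(v\<^sub>1) \<cdots> \<xi>(v\<^sub>k)\<close> on the dual space (extended by 0 to nonlinear functions), so that the
  symmetric power \<open>S\<^sup>k(V)\<close> becomes the space of homogeneous polynomial functions of degree \<open>k\<close> on
  the dual of \<open>V\<close>. Linear functionals on a subspace extend to the ambient space.\<close>

definition sym_prod :: "'v::real_vector list \<Rightarrow> ('v \<Rightarrow> real) \<Rightarrow> real" where
  "sym_prod vs = (\<lambda>\<xi>. if linear \<xi> then prod_list (map \<xi> vs) else 0)"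

definition sym_monom :: "nat \<Rightarrow> 'v::real_vector \<Rightarrow> 'v \<Rightarrow> nat \<Rightarrow> ('v \<Rightarrow> real) \<Rightarrow> real" where
  "sym_monom k x y i = sym_prod (replicate (k - i) x @ replicate i y)"

definition sym_space :: "nat \<Rightarrow> 'v::real_vector set \<Rightarrow> (('v \<Rightarrow> real) \<Rightarrow> real) set" where
  "sym_space k V = span {sym_prod vs | vs. length vs = k \<and> set vs \<subseteq> V}"

text \<open>The symmetric power of a bundle of rank 2 with \<open>vb_index E = {0, 1}\<close>.\<close>

definition sym_power ::
  "nat \<Rightarrow> ('a, nat, 'v::real_vector) vbundle \<Rightarrow> ('a, nat, ('v \<Rightarrow> real) \<Rightarrow> real) vbundle" where
  "sym_power k E =
     \<lparr>vb_index = {..k}, vb_fibre = (\<lambda>p. sym_space k (vb_fibre E p)),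
      vb_frames = (\<lambda>(U, e). (U, \<lambda>i p. sym_monom k (e 0 p) (e 1 p) i)) ` vb_frames E\<rparr>"


section \<open>The representation of GL(2) on binary forms\<close>

text \<open>Elements of \<open>gl(2)\<close> have type \<open>real^2^2\<close>, where \<open>a $ r $ s\<close> is the entry in row \<open>r\<close> and
  column \<open>s\<close>; thus \<open>\<phi>\<^sup>s\<^sub>r\<close> (upper index \<open>s\<close>, lower index \<open>r\<close>) is \<open>\<phi> $ r $ s\<close>. Matrices of
  endomorphisms of \<open>H\<^sub>k\<close> in the monomial basis are functions \<open>M\<close> with \<open>M i j\<close> the entry in row \<open>i\<close>
  and column \<open>j\<close> for \<open>i, j \<le> k\<close>, and 0 for all other indices.\<close>

type_synonym kmatrix = "nat \<Rightarrow> nat \<Rightarrow> real"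

definition kmult :: "nat \<Rightarrow> kmatrix \<Rightarrow> kmatrix \<Rightarrow> kmatrix" where
  "kmult k M N = (\<lambda>i j. \<Sum>l\<le>k. M i l * N l j)"

definition ktrace :: "nat \<Rightarrow> kmatrix \<Rightarrow> real" where
  "ktrace k M = (\<Sum>i\<le>k. M i i)"

definition hmonom :: "nat \<Rightarrow> nat \<Rightarrow> real \<times> real \<Rightarrow> real" where
  "hmonom k i = (\<lambda>(x, y). x ^ (k - i) * y ^ i)"

definition frame_act :: "'v::real_vector \<times> 'v \<Rightarrow> real^2^2 \<Rightarrow> 'v \<times> 'v" where
  "frame_act xy g =
     (g $ 1 $ 1 *\<^sub>R fst xy + g $ 2 $ 1 *\<^sub>R snd xy, g $ 1 $ 2 *\<^sub>R fst xy + g $ 2 $ 2 *\<^sub>R snd xy)"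

definition hact :: "(real \<times> real \<Rightarrow> real) \<Rightarrow> real^2^2 \<Rightarrow> real \<times> real \<Rightarrow> real" where
  "hact V g = (\<lambda>xy. V (frame_act xy g))"

text \<open>The entries are the coefficients of \<open>(x g\<^sub>1\<^sub>1 + y g\<^sub>2\<^sub>1)\<^sup>k\<^sup>-\<^sup>j (x g\<^sub>1\<^sub>2 + y g\<^sub>2\<^sub>2)\<^sup>j\<close>, read off after setting
  \<open>x = 1\<close>; see \<open>hact_hmonom\<close>.\<close>

definition rho :: "nat \<Rightarrow> real^2^2 \<Rightarrow> kmatrix" where
  "rho k g = (\<lambda>i j. if i \<le> k \<and> j \<le> k
     then coeff ([:g $ 1 $ 1, g $ 2 $ 1:] ^ (k - j) * [:g $ 1 $ 2, g $ 2 $ 2:] ^ j) i else 0)"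

lemma homogenize_linear_mult:
  fixes p :: "real poly"
  assumes "degree p \<le> n"
  shows "(\<Sum>i\<le>Suc n. coeff ([:a, b:] * p) i * (x ^ (Suc n - i) * y ^ i)) =
         (a * x + b * y) * (\<Sum>i\<le>n. coeff p i * (x ^ (n - i) * y ^ i))"
proof -
  have z: "coeff p (Suc n) = 0"
    using assms by (simp add: coeff_eq_0)
  have c: "coeff ([:a, b:] * p) i = a * coeff p i + (if i = 0 then 0 else b * coeff p (i - 1))" for i
    by (cases i) (simp_all add: coeff_pCons)
  have "(\<Sum>i\<le>Suc n. coeff ([:a, b:] * p) i * (x ^ (Suc n - i) * y ^ i)) =
        (\<Sum>i\<le>Suc n. a * coeff p i * (x ^ (Suc n - i) * y ^ i)) +
        (\<Sum>i\<le>Suc n. (if i = 0 then 0 else b * coeff p (i - 1)) * (x ^ (Suc n - i) * y ^ i))"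
    by (simp only: c distrib_right sum.distrib)
  also have "(\<Sum>i\<le>Suc n. a * coeff p i * (x ^ (Suc n - i) * y ^ i)) =
             (\<Sum>i\<le>n. a * coeff p i * (x ^ (Suc n - i) * y ^ i))"
    by (simp add: z)
  also have "\<dots> = a * x * (\<Sum>i\<le>n. coeff p i * (x ^ (n - i) * y ^ i))"
    unfolding sum_distrib_left by (intro sum.cong) (auto simp: Suc_diff_le)
  also have "(\<Sum>i\<le>Suc n. (if i = 0 then 0 else b * coeff p (i - 1)) * (x ^ (Suc n - i) * y ^ i)) =
             (\<Sum>i\<le>n. b * coeff p i * (x ^ (n - i) * y ^ Suc i))"
    by (subst sum.atMost_Suc_shift) simp
  also have "\<dots> = b * y * (\<Sum>i\<le>n. coeff p i * (x ^ (n - i) * y ^ i))"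
    unfolding sum_distrib_left by (intro sum.cong) auto
  finally show ?thesis
    by (simp add: distrib_right)
qed

lemma degree_linear_powers:
  "degree ([:a, b:] ^ m * [:c, d:] ^ j :: real poly) \<le> m + j"
proof -
  have "degree ([:a, b:] ^ n) \<le> n" for a b :: real and n
    using degree_power_le[of "[:a, b:]" n] by (auto split: if_splits)
  then show ?thesis
    by (meson add_mono degree_mult_le order_trans)
qed

lemma homogenize_linear_powers:
  fixes a b c d x y :: real
  shows "(\<Sum>i\<le>m + j. coeff ([:a, b:] ^ m * [:c, d:] ^ j) i * (x ^ (m + j - i) * y ^ i)) =
         (a * x + b * y) ^ m * (c * x + d * y) ^ j"
proof (induction m)
  case 0
  show ?case
  proof (induction j)
    case (Suc j)
    then show ?case
      using homogenize_linear_mult[OF degree_linear_powers[of a b 0 c d j], of c d x y] by simp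
  qed simp
next
  case (Suc m)
  then show ?case
    using homogenize_linear_mult[OF degree_linear_powers[of a b m c d j], of a b x y]
    by (simp only: power_Suc add_Suc mult.assoc)
qed

lemma hact_hmonom:
  assumes "j \<le> k"
  shows "hact (hmonom k j) g = (\<lambda>xy. \<Sum>i\<le>k. rho k g i j * hmonom k i xy)"
proof
  fix xy :: "real \<times> real"
  show "hact (hmonom k j) g xy = (\<Sum>i\<le>k. rho k g i j * hmonom k i xy)"
    using homogenize_linear_powers[of "g $ 1 $ 1" "g $ 2 $ 1" "k - j" "g $ 1 $ 2" "g $ 2 $ 2" j
        "fst xy" "snd xy"] assms
    by (simp add: hact_def hmonom_def frame_act_def rho_def case_prod_beta)
qed

definition drho :: "nat \<Rightarrow> real^2^2 \<Rightarrow> kmatrix" where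
  "drho k a = (\<lambda>i j. if k < i \<or> k < j then 0
     else if i = j then real (k - i) * a $ 1 $ 1 + real i * a $ 2 $ 2
     else if i = Suc j then real (k - j) * a $ 2 $ 1
     else if j = Suc i then real j * a $ 1 $ 2
     else 0)"

definition gk :: "nat \<Rightarrow> kmatrix set" where
  "gk k = range (drho k)"

definition gk_perp :: "nat \<Rightarrow> kmatrix set" where
  "gk_perp k = {\<psi>. (\<forall>i j. k < i \<or> k < j \<longrightarrow> \<psi> i j = 0) \<and> (\<forall>\<eta>\<in>gk k. ktrace k (kmult k \<eta> \<psi>) = 0)}"


section \<open>GL(2)-structures\<close>

definition GL2_structure ::
  "nat \<Rightarrow> 'a topology \<Rightarrow> ('a, 'm::euclidean_space) chart set \<Rightarrow> ('a, nat, 'v::real_vector) vbundle \<Rightarrow>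
     ('a \<Rightarrow> ('a, 'm) tangent \<Rightarrow> ('v \<Rightarrow> real) \<Rightarrow> real) \<Rightarrow> bool" where
  "GL2_structure k X A E s \<longleftrightarrow>
     smooth_manifold X A \<and> DIM('m) = k + 1 \<and>
     vector_bundle X A E \<and> vb_index E = {0, 1} \<and>
     vbundle_iso X A (tangent_bundle A) (sym_power k E) s"

definition basis_of :: "'v::real_vector set \<Rightarrow> 'v \<times> 'v \<Rightarrow> bool" where
  "basis_of V xy \<longleftrightarrow>
     fst xy \<noteq> snd xy \<and> independent {fst xy, snd xy} \<and> span {fst xy, snd xy} = V"

text \<open>Points \<open>q\<close> of \<open>B(E)\<close> are pairs of a base point \<open>fst q\<close> and a frame \<open>snd q 0, \<dots>, snd q k\<close> of the
  tangent space there, where \<open>snd q i = 0\<close> for \<open>i > k\<close>.\<close>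

type_synonym ('a, 'm) frame_pt = "'a \<times> (nat \<Rightarrow> ('a, 'm) tangent)"

definition frame_of ::
  "nat \<Rightarrow> ('a, 'm::euclidean_space) chart set \<Rightarrow>
     ('a \<Rightarrow> ('a, 'm) tangent \<Rightarrow> ('v::real_vector \<Rightarrow> real) \<Rightarrow> real) \<Rightarrow>
     'a \<Rightarrow> 'v \<times> 'v \<Rightarrow> ('a, 'm) frame_pt" where
  "frame_of k A s p xy =
     (p, \<lambda>i. if i \<le> k then inv_into (tangent_space A p) (s p) (sym_monom k (fst xy) (snd xy) i) else 0)"

definition BE ::
  "nat \<Rightarrow> 'a topology \<Rightarrow> ('a, 'm::euclidean_space) chart set \<Rightarrow> ('a, nat, 'v::real_vector) vbundle \<Rightarrow>
     ('a \<Rightarrow> ('a, 'm) tangent \<Rightarrow> ('v \<Rightarrow> real) \<Rightarrow> real) \<Rightarrow> ('a, 'm) frame_pt set" where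
  "BE k X A E s = {frame_of k A s p xy | p xy. p \<in> topspace X \<and> basis_of (vb_fibre E p) xy}"

definition BE_act :: "nat \<Rightarrow> real^2^2 \<Rightarrow> ('a, 'm::euclidean_space) frame_pt \<Rightarrow> ('a, 'm) frame_pt" where
  "BE_act k g q = (fst q, \<lambda>j. if j \<le> k then (\<Sum>i\<le>k. rho k g i j *\<^sub>R snd q i) else 0)"

text \<open>A chart \<open>c\<close> of \<open>M\<close> and a local frame \<open>e\<close> of \<open>E\<close> parametrise \<open>B(E)\<close> by pairs of a coordinate
  vector and an invertible matrix. For even \<open>k\<close> the matrices \<open>g\<close> and \<open>-g\<close> give the same frame,
  so charts are obtained by restriction to open sets on which the parametrisation is injective.\<close>

definition BE_param ::
  "nat \<Rightarrow> ('a, 'm::euclidean_space) chart set \<Rightarrow>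
     ('a \<Rightarrow> ('a, 'm) tangent \<Rightarrow> ('v::real_vector \<Rightarrow> real) \<Rightarrow> real) \<Rightarrow>
     ('a, 'm) chart \<Rightarrow> (nat \<Rightarrow> 'a \<Rightarrow> 'v) \<Rightarrow> 'm \<times> (real^2^2) \<Rightarrow> ('a, 'm) frame_pt" where
  "BE_param k A s c e = (\<lambda>(x, g). let p = chart_inv c x in
     frame_of k A s p (frame_act (e 0 p, e 1 p) g))"

definition BE_atlas ::
  "nat \<Rightarrow> ('a, 'm::euclidean_space) chart set \<Rightarrow> ('a, nat, 'v::real_vector) vbundle \<Rightarrow>
     ('a \<Rightarrow> ('a, 'm) tangent \<Rightarrow> ('v \<Rightarrow> real) \<Rightarrow> real) \<Rightarrow> (('a, 'm) frame_pt, 'm \<times> (real^2^2)) chart set" where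
  "BE_atlas k A E s =
     {(BE_param k A s c e ` W, inv_into W (BE_param k A s c e)) | c U e W.
        c \<in> A \<and> (U, e) \<in> vb_frames E \<and> open W \<and>
        W \<subseteq> snd c ` (fst c \<inter> U) \<times> {g. invertible g} \<and> inj_on (BE_param k A s c e) W}"

type_synonym ('a, 'm) BE_tangent = "(('a, 'm) frame_pt, 'm \<times> (real^2^2)) tangent"

definition soldering ::
  "nat \<Rightarrow> ('a, 'm::euclidean_space) chart set \<Rightarrow> ('a, nat, 'v::real_vector) vbundle \<Rightarrow>
     ('a \<Rightarrow> ('a, 'm) tangent \<Rightarrow> ('v \<Rightarrow> real) \<Rightarrow> real) \<Rightarrow>
     nat \<Rightarrow> ('a, 'm) frame_pt \<Rightarrow> ('a, 'm) BE_tangent \<Rightarrow> real" where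
  "soldering k A E s i q v =
     (THE w. (\<forall>l>k. w l = 0) \<and>
        tangent_map (BE_atlas k A E s) A fst q v = (\<Sum>l\<le>k. w l *\<^sub>R snd q l)) i"

text \<open>The value at \<open>q\<close> of the fundamental vector field of \<open>a\<close>, that is, the differential at the
  identity of the orbit map \<open>g \<mapsto> BE_act k g q\<close>, applied to \<open>a\<close>.\<close>

definition fundamental_vec ::
  "nat \<Rightarrow> (('a, 'm::euclidean_space) frame_pt, 'm \<times> (real^2^2)) chart set \<Rightarrow> real^2^2 \<Rightarrow>
     ('a, 'm) frame_pt \<Rightarrow> ('a, 'm) BE_tangent" where
  "fundamental_vec k AB a q =
     (\<lambda>d. if d \<in> charts_at AB q
          then frechet_derivative (\<lambda>g. snd d (BE_act k g q)) (at (mat 1)) a else 0)"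

text \<open>The last two conditions say that \<open>\<Phi> = drho k \<phi>\<close> is a principal connection form:
  \<open>R\<^sub>g\<^sup>* \<Phi> = Ad(\<rho>\<^sub>k(g)\<^sup>-\<^sup>1) \<Phi>\<close>, and \<open>\<Phi>\<close> reproduces the generators of fundamental vector fields.
  Smoothness of \<open>\<phi>\<close> and of \<open>\<Phi>\<close> are the same.\<close>

definition GL2_connection ::
  "nat \<Rightarrow> 'a topology \<Rightarrow> ('a, 'm::euclidean_space) chart set \<Rightarrow> ('a, nat, 'v::real_vector) vbundle \<Rightarrow>
     ('a \<Rightarrow> ('a, 'm) tangent \<Rightarrow> ('v \<Rightarrow> real) \<Rightarrow> real) \<Rightarrow>
     (('a, 'm) frame_pt \<Rightarrow> ('a, 'm) BE_tangent \<Rightarrow> real^2^2) \<Rightarrow> bool" where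
  "GL2_connection k X A E s \<phi> \<longleftrightarrow>
     (let B = BE k X A E s; AB = BE_atlas k A E s in
      smooth_form1 B AB \<phi> \<and>
      (\<forall>g. invertible g \<longrightarrow> (\<forall>q\<in>B. \<forall>v\<in>tangent_space AB q.
         drho k (\<phi> (BE_act k g q) (tangent_map AB AB (BE_act k g) q v)) =
         kmult k (rho k (matrix_inv g)) (kmult k (drho k (\<phi> q v)) (rho k g)))) \<and>
      (\<forall>a. \<forall>q\<in>B. drho k (\<phi> q (fundamental_vec k AB a q)) = drho k a))"

text \<open>The components of \<open>\<Theta> = d\<omega> + \<Phi> \<and> \<omega>\<close>.\<close>

definition torsion ::
  "nat \<Rightarrow> ('a, 'm::euclidean_space) chart set \<Rightarrow> ('a, nat, 'v::real_vector) vbundle \<Rightarrow>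
     ('a \<Rightarrow> ('a, 'm) tangent \<Rightarrow> ('v \<Rightarrow> real) \<Rightarrow> real) \<Rightarrow>
     (('a, 'm) frame_pt \<Rightarrow> ('a, 'm) BE_tangent \<Rightarrow> real^2^2) \<Rightarrow>
     nat \<Rightarrow> ('a, 'm) frame_pt \<Rightarrow> ('a, 'm) BE_tangent \<Rightarrow> ('a, 'm) BE_tangent \<Rightarrow> real" where
  "torsion k A E s \<phi> i q v w =
     ext_deriv (BE_atlas k A E s) (soldering k A E s i) q v w +
     (\<Sum>j\<le>k. drho k (\<phi> q v) i j * soldering k A E s j q w -
             drho k (\<phi> q w) i j * soldering k A E s j q v)"

text \<open>\<open>\<psi>\<close> is the matrix of the endomorphism \<open>\<omega>(Y) \<mapsto> \<Theta>(v, Y)\<close> (and it is determined by this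
  condition, as \<open>\<omega>\<close> is onto at each point).\<close>

definition torsion_endo ::
  "nat \<Rightarrow> ('a, 'm::euclidean_space) chart set \<Rightarrow> ('a, nat, 'v::real_vector) vbundle \<Rightarrow>
     ('a \<Rightarrow> ('a, 'm) tangent \<Rightarrow> ('v \<Rightarrow> real) \<Rightarrow> real) \<Rightarrow>
     (('a, 'm) frame_pt \<Rightarrow> ('a, 'm) BE_tangent \<Rightarrow> real^2^2) \<Rightarrow>
     ('a, 'm) frame_pt \<Rightarrow> ('a, 'm) BE_tangent \<Rightarrow> kmatrix \<Rightarrow> bool" where
  "torsion_endo k A E s \<phi> q v \<psi> \<longleftrightarrow>
     (\<forall>i j. k < i \<or> k < j \<longrightarrow> \<psi> i j = 0) \<and>
     (\<forall>w\<in>tangent_space (BE_atlas k A E s) q. \<forall>i\<le>k.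
        torsion k A E s \<phi> i q v w = (\<Sum>j\<le>k. \<psi> i j * soldering k A E s j q w))"

end

theory Submission
  imports Defs
begin

text \<open>Two \<open>GL(2)\<close>-connections differ by a horizontal form \<open>\<alpha>\<close> with values in \<open>gl(2)\<close>, that is, at each point
of \<open>B(E)\<close> by a linear map \<open>\<alpha> : H\<^sub>k \<rightarrow> gl(2)\<close>, and their torsions differ by
\<open>\<alpha>(X) Y - \<alpha>(Y) X\<close>, where \<open>gl(2)\<close> acts on \<open>H\<^sub>k\<close> through \<open>drho k\<close>. The torsion condition is therefore, point by
point, an inhomogeneous linear system for \<open>\<alpha>\<close>, whose linear part sends \<open>\<alpha>\<close> to the form
\<open>(X, \<eta>) \<mapsto> tr (\<eta> \<circ> (Y \<mapsto> \<alpha>(X) Y - \<alpha>(Y) X))\<close> on \<open>H\<^sub>k \<times> gl(2)\<close>. It has \<open>4 (k + 1)\<close> unknowns and as many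
equations, so everything rests on its injectivity (\<open>spencer_injective\<close>).

For injectivity, decompose \<open>Hom(H\<^sub>k, gl(2))\<close> under the diagonal torus. The system splits into blocks with
at most four unknowns. The unknowns are regrouped according to the irreducible summands \<open>H\<^sub>k\<^sub>+\<^sub>2\<close>, \<open>H\<^sub>k\<^sub>-\<^sub>2\<close> and
twice \<open>H\<^sub>k\<close> of \<open>H\<^sub>k \<otimes> gl(2)\<close>; by Schur's lemma the system acts there by constants, which depend on \<open>k\<close>
alone. On \<open>H\<^sub>k\<^sub>+\<^sub>2\<close> and \<open>H\<^sub>k\<^sub>-\<^sub>2\<close> the constants are positive, and on the two copies of \<open>H\<^sub>k\<close> the determinant is a
nonzero multiple of \<open>(k - 1) (k - 2) (k + 3)\<close>. The factor \<open>k - 2\<close> is where dimension greater than three enters: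
for \<open>k = 2\<close> a \<open>GL(2)\<close>-structure is essentially a Lorentzian conformal structure of dimension three, which has many
torsion-free connections.

The uniqueness of the connection follows at once, as the exterior derivative of the soldering form drops out
of the difference of two torsions (\<open>adapted_unique\<close>). For existence, parametrise \<open>B(E)\<close> over a chart of \<open>M\<close>
and a local frame of \<open>E\<close> by pairs \<open>(x, g)\<close>. There the soldering form is \<open>\<rho>\<^sub>k(g)\<^sup>-\<^sup>1 \<theta>\<^sub>x(dx)\<close> for a smooth
coframe \<open>\<theta>\<close>, and every \<open>GL(2)\<close>-connection has the form \<open>g\<^sup>-\<^sup>1 dg + g\<^sup>-\<^sup>1 \<Gamma>\<^sub>x(dx) g\<close>. As the orthogonal complement of the
Lie algebra is invariant under conjugation by \<open>\<rho>\<^sub>k(g)\<close>, the torsion condition holds at \<open>(x, g)\<close> as soon as it holds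
at \<open>(x, 1)\<close>. There it is solved by a unique \<open>\<Gamma>\<close>, which is smooth because a fixed linear map produces it from
the torsion of the flat connection in the frame dual to \<open>\<theta>\<close> (\<open>gamma_exists\<close>). The local solutions agree on overlaps
by the pointwise uniqueness, once the exterior derivative is known to be independent of the chart
(\<open>ext_deriv_eq\<close>), which in turn is the symmetry of second derivatives.\<close>

section \<open>Functions of class \<open>C\<^sup>n\<close>\<close>

lemma Cn_on_cong_open:
  assumes "open S" "\<And>x. x \<in> S \<Longrightarrow> f x = g x" "Cn_on n S f"
  shows "Cn_on n S g"
  using assms
proof (induction n arbitrary: f g)
  case 0
  then show ?case by (simp cong: continuous_on_cong)
next
  case (Suc n)
  have d: "(g has_derivative frechet_derivative f (at x)) (at x)" if "x \<in> S" for x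
    using Suc.prems that
    by (auto intro: has_derivative_transform_within_open simp: frechet_derivative_works)
  then have e: "frechet_derivative f (at x) = frechet_derivative g (at x)" if "x \<in> S" for x
    using frechet_derivative_at[OF d[OF that]] by simp
  have "Cn_on n S (\<lambda>x. frechet_derivative g (at x) v)" for v
    by (rule Suc.IH[of "\<lambda>x. frechet_derivative f (at x) v"]) (use Suc.prems e in auto)
  then show ?case
    using d by (auto simp: differentiable_def)
qed

lemma Cn_on_SucI:
  assumes "open S" "\<And>x. x \<in> S \<Longrightarrow> (f has_derivative f' x) (at x)" "\<And>v. Cn_on n S (\<lambda>x. f' x v)"
  shows "Cn_on (Suc n) S f"
proof -
  have "f' x = frechet_derivative f (at x)" if "x \<in> S" for x
    using assms(2)[OF that] by (rule frechet_derivative_at)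
  then have "Cn_on n S (\<lambda>x. frechet_derivative f (at x) v)" for v
    using Cn_on_cong_open[OF assms(1) _ assms(3)[of v]] by simp
  then show ?thesis
    using assms(2) by (auto simp: differentiable_def)
qed

lemma Cn_on_has_derivative:
  assumes "Cn_on (Suc n) S f" "x \<in> S"
  shows "(f has_derivative frechet_derivative f (at x)) (at x)"
  using assms by (auto simp: frechet_derivative_works)

lemma Cn_on_SucD: "Cn_on (Suc n) S f \<Longrightarrow> Cn_on n S f"
proof (induction n arbitrary: f)
  case 0
  then show ?case
    by (simp add: continuous_at_imp_continuous_on differentiable_imp_continuous_within)
qed auto

lemma Cn_on_le: "Cn_on n S f \<Longrightarrow> m \<le> n \<Longrightarrow> Cn_on m S f"
  using lift_Suc_antimono_le[of "\<lambda>n. Cn_on n S f" m n] Cn_on_SucD by (metis le_boolE le_boolI)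

lemma Cn_on_imp_continuous_on: "Cn_on n S f \<Longrightarrow> continuous_on S f"
  using Cn_on_le[of n S f 0] by simp

lemma Cn_on_subset: "Cn_on n S f \<Longrightarrow> T \<subseteq> S \<Longrightarrow> Cn_on n T f"
  by (induction n arbitrary: f) (auto intro: continuous_on_subset)

lemma Cn_on_local:
  assumes "\<And>x. x \<in> S \<Longrightarrow> \<exists>T. open T \<and> x \<in> T \<and> Cn_on n T f"
  shows "Cn_on n S f"
  using assms
proof (induction n arbitrary: f)
  case 0
  then show ?case
    by (auto simp: continuous_on_eq_continuous_within)
       (metis at_within_open continuous_on_eq_continuous_within continuous_within_subset subset_UNIV)
next
  case (Suc n)
  have "Cn_on n S (\<lambda>x. frechet_derivative f (at x) v)" for v
    by (rule Suc.IH) (use Suc.prems in fastforce)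
  moreover have "f differentiable (at x)" if "x \<in> S" for x
    using Suc.prems[OF that] by auto
  ultimately show ?case by simp
qed

lemma Cn_on_const [simp]: "Cn_on n S (\<lambda>x. c)"
  by (induction n arbitrary: c) auto

lemma Cn_on_linear:
  assumes "bounded_linear L"
  shows "Cn_on n S L"
proof (cases n)
  case (Suc m)
  have "frechet_derivative L (at x) = L" for x
    using bounded_linear_imp_has_derivative[OF assms] frechet_derivative_at by metis
  then show ?thesis
    using Suc bounded_linear_imp_differentiable[OF assms] by simp
qed (simp add: assms linear_continuous_on)

lemma Cn_on_add:
  "open S \<Longrightarrow> Cn_on n S f \<Longrightarrow> Cn_on n S g \<Longrightarrow> Cn_on n S (\<lambda>x. f x + g x)"
proof (induction n arbitrary: f g)
  case (Suc n)
  show ?case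
    by (rule Cn_on_SucI[OF Suc.prems(1) has_derivative_add[OF Cn_on_has_derivative[OF Suc.prems(2)]
            Cn_on_has_derivative[OF Suc.prems(3)]]]) (use Suc in auto)
qed (simp add: continuous_on_add)

lemma Cn_on_bounded_linear:
  assumes "bounded_linear L"
  shows "open S \<Longrightarrow> Cn_on n S f \<Longrightarrow> Cn_on n S (\<lambda>x. L (f x))"
proof (induction n arbitrary: f)
  case 0
  then show ?case using assms by (simp add: bounded_linear.continuous_on)
next
  case (Suc n)
  show ?case
    by (rule Cn_on_SucI[OF Suc.prems(1) bounded_linear.has_derivative[OF assms
            Cn_on_has_derivative[OF Suc.prems(2)]]]) (use Suc in auto)
qed

lemma Cn_on_bounded_bilinear:
  assumes "bounded_bilinear B"
  shows "open S \<Longrightarrow> Cn_on n S f \<Longrightarrow> Cn_on n S g \<Longrightarrow> Cn_on n S (\<lambda>x. B (f x) (g x))"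
proof (induction n arbitrary: f g)
  case 0
  then show ?case using assms by (simp add: bounded_bilinear.continuous_on)
next
  case (Suc n)
  show ?case
    by (rule Cn_on_SucI[OF Suc.prems(1) bounded_bilinear.FDERIV[OF assms
            Cn_on_has_derivative[OF Suc.prems(2)] Cn_on_has_derivative[OF Suc.prems(3)]]])
       (use Suc Cn_on_SucD[OF Suc.prems(2)] Cn_on_SucD[OF Suc.prems(3)] in
         \<open>auto intro!: Suc.IH Cn_on_add\<close>)
qed

lemmas Cn_on_scaleR = Cn_on_bounded_bilinear[OF bounded_bilinear_scaleR]
  and Cn_on_mult = Cn_on_bounded_bilinear[OF bounded_bilinear_mult]
  and Cn_on_inner_left = Cn_on_bounded_linear[OF bounded_linear_inner_left]
  and Cn_on_scaleR_left = Cn_on_bounded_linear[OF bounded_linear_scaleR_left]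
  and Cn_on_minus = Cn_on_bounded_linear[OF bounded_linear_minus[OF bounded_linear_ident]]

lemma Cn_on_diff:
  assumes "open S" "Cn_on n S f" "Cn_on n S g"
  shows "Cn_on n S (\<lambda>x. f x - g x)"
  using Cn_on_add[OF assms(1,2) Cn_on_minus[OF assms(1,3)]] by simp

lemma Cn_on_sum:
  "open S \<Longrightarrow> (\<And>i. i \<in> I \<Longrightarrow> Cn_on n S (f i)) \<Longrightarrow> Cn_on n S (\<lambda>x. \<Sum>i\<in>I. f i x)"
  by (induction I rule: infinite_finite_induct) (auto intro: Cn_on_add)

lemma Cn_on_componentwise:
  fixes f :: "'x::real_normed_vector \<Rightarrow> 'b::euclidean_space"
  assumes "open S" "\<And>b. b \<in> Basis \<Longrightarrow> Cn_on n S (\<lambda>x. f x \<bullet> b)"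
  shows "Cn_on n S f"
proof -
  have "Cn_on n S (\<lambda>x. \<Sum>b\<in>Basis. (f x \<bullet> b) *\<^sub>R b)"
    using assms by (intro Cn_on_sum Cn_on_scaleR_left)
  then show ?thesis by (simp add: euclidean_representation)
qed

lemma Cn_on_Pair:
  assumes "open S" "Cn_on n S f" "Cn_on n S g"
  shows "Cn_on n S (\<lambda>x. (f x, g x))"
proof -
  have "Cn_on n S (\<lambda>x. (f x, 0) + (0, g x))"
    using assms by (intro Cn_on_add Cn_on_bounded_linear[of "\<lambda>u. (u, 0)" S n f]
        Cn_on_bounded_linear[of "\<lambda>u. (0, u)" S n g]) (auto intro!: bounded_linear_Pair bounded_linear_zero bounded_linear_ident)
  then show ?thesis by simp
qed

lemma Cn_on_compose_linear:
  assumes "bounded_linear L" "open S" "open T" "L ` T \<subseteq> S"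
  shows "Cn_on n S f \<Longrightarrow> Cn_on n T (\<lambda>x. f (L x))"
proof (induction n arbitrary: f)
  case 0
  then show ?case
    using continuous_on_compose2[of S f T L] assms by (simp add: linear_continuous_on)
next
  case (Suc n)
  show ?case
  proof (rule Cn_on_SucI[OF assms(3), where f' = "\<lambda>x v. frechet_derivative f (at (L x)) (L v)"])
    show "((\<lambda>x. f (L x)) has_derivative (\<lambda>v. frechet_derivative f (at (L x)) (L v))) (at x)"
      if "x \<in> T" for x
      using diff_chain_at[OF bounded_linear_imp_has_derivative[OF assms(1)]
          Cn_on_has_derivative[OF Suc.prems, of "L x"]] that assms(4)
      by (auto simp: o_def)
    show "Cn_on n T (\<lambda>x. frechet_derivative f (at (L x)) (L v))" for v
      using Suc by auto
  qed
qed


section \<open>Linear systems with differentiable coefficients\<close>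

text \<open>If \<open>L\<close> is a left inverse of \<open>F x0\<close>, then \<open>u = L (F x u) - L ((F x - F x0) u)\<close>, and the second term is small
compared with \<open>u\<close> when \<open>x\<close> is near \<open>x0\<close>. It is expanded in the basis because \<open>F\<close> is only assumed to be continuous or
differentiable for each fixed second argument.\<close>

lemma linear_solution_local_inverse:
  fixes F :: "'x::real_normed_vector \<Rightarrow> 'a::euclidean_space \<Rightarrow> 'b::euclidean_space"
  assumes "linear (F x0)" "inj (F x0)"
  obtains L where "bounded_linear L" "\<And>x u. linear (F x) \<Longrightarrow> u = L (F x u) - (\<Sum>b\<in>Basis. (u \<bullet> b) *\<^sub>R L (F x b - F x0 b))"
proof -
  obtain L where L: "linear L" "L \<circ> F x0 = id"
    using linear_injective_left_inverse[OF assms] by auto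
  have "u = L (F x u) - (\<Sum>b\<in>Basis. (u \<bullet> b) *\<^sub>R L (F x b - F x0 b))" if "linear (F x)" for x u
  proof -
    have rep: "f u = (\<Sum>b\<in>Basis. (u \<bullet> b) *\<^sub>R f b)" if "linear f" for f :: "'a \<Rightarrow> 'b"
      by (metis (no_types, lifting) euclidean_representation linear_scale linear_sum sum.cong that)
    have "(\<Sum>b\<in>Basis. (u \<bullet> b) *\<^sub>R L (F x b - F x0 b)) = L (\<Sum>b\<in>Basis. (u \<bullet> b) *\<^sub>R (F x b - F x0 b))"
      by (simp add: L(1) linear_sum linear_scale)
    also have "(\<Sum>b\<in>Basis. (u \<bullet> b) *\<^sub>R (F x b - F x0 b)) = F x u - F x0 u"
      by (simp add: rep[OF that] rep[OF assms(1)] scaleR_diff_right sum_subtractf)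
    finally show ?thesis
      using L by (simp add: linear_diff fun_eq_iff)
  qed
  then show thesis
    using that[of L] L(1) by (simp add: linear_conv_bounded_linear)
qed


text \<open>A product of two functions vanishing at a point has derivative 0 there even if one of them is
merely continuous. This disposes of the error terms in \<open>linear_solution_has_derivative\<close>.\<close>

lemma has_derivative_scaleR_vanishing:
  fixes g :: "'x::real_normed_vector \<Rightarrow> real"
  assumes f: "(f has_derivative D) (at x)" "f x = 0" and g: "isCont g x" "g x = 0"
  shows "((\<lambda>y. g y *\<^sub>R f y) has_derivative (\<lambda>v. 0)) (at x)"
  unfolding has_derivative_at_alt
proof (intro conjI allI impI)
  fix e :: real assume e: "e > 0"
  interpret D: bounded_linear D using f(1) by (rule has_derivative_bounded_linear)
  obtain K where K: "K > 0" "\<And>v. norm (D v) \<le> norm v * K" using D.pos_bounded by blast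
  obtain d1 where d1: "d1 > 0" "\<And>y. norm (y - x) < d1 \<Longrightarrow> norm (f y - f x - D (y - x)) \<le> 1 * norm (y - x)"
    using f(1) unfolding has_derivative_at_alt by (metis zero_less_one)
  obtain d2 where d2: "d2 > 0" "\<And>y. norm (y - x) < d2 \<Longrightarrow> \<bar>g y\<bar> < e / (K + 1)"
    using g e K(1) unfolding continuous_at_eps_delta
    by (metis add_pos_pos diff_zero dist_norm divide_pos_pos real_norm_def zero_less_one)
  have "norm (g y *\<^sub>R f y - g x *\<^sub>R f x - 0) \<le> e * norm (y - x)" if y: "norm (y - x) < min d1 d2" for y
  proof -
    have "norm (f y) \<le> norm (f y - f x - D (y - x)) + norm (D (y - x))"
      using norm_triangle_ineq[of "f y - f x - D (y - x)" "D (y - x)"] f(2) by simp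
    also have "\<dots> \<le> (K + 1) * norm (y - x)"
      using d1(2)[of y] K(2)[of "y - x"] y by (simp add: algebra_simps)
    finally have "\<bar>g y\<bar> * norm (f y) \<le> e / (K + 1) * ((K + 1) * norm (y - x))"
      using d2(2)[of y] y K(1) e by (intro mult_mono) auto
    then show ?thesis using K(1) g(2) by simp
  qed
  then show "\<exists>d>0. \<forall>y. norm (y - x) < d \<longrightarrow> norm (g y *\<^sub>R f y - g x *\<^sub>R f x - 0) \<le> e * norm (y - x)"
    using d1(1) d2(1) by (metis min_less_iff_conj)
qed (simp add: bounded_linear_zero)

lemma continuous_on_linear_solution:
  fixes F :: "'x::real_normed_vector \<Rightarrow> 'a::euclidean_space \<Rightarrow> 'b::euclidean_space"
  assumes S: "open S" and lin: "\<And>x. x \<in> S \<Longrightarrow> linear (F x)" and inj: "\<And>x. x \<in> S \<Longrightarrow> inj (F x)"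
    and F: "\<And>u. continuous_on S (\<lambda>x. F x u)" and b: "continuous_on S b"
    and y: "\<And>x. x \<in> S \<Longrightarrow> F x (y x) = b x"
  shows "continuous_on S y"
proof -
  have "(y \<longlongrightarrow> y x0) (at x0)" if x0: "x0 \<in> S" for x0
  proof -
    obtain L where L: "bounded_linear L"
      "\<And>x u. linear (F x) \<Longrightarrow> u = L (F x u) - (\<Sum>b\<in>Basis. (u \<bullet> b) *\<^sub>R L (F x b - F x0 b))"
      using linear_solution_local_inverse[of F, OF lin[OF x0] inj[OF x0]] by metis
    interpret L: bounded_linear L by (rule L(1))
    have lim: "(f \<longlongrightarrow> f x0) (at x0)" if "continuous_on S f" for f :: "'x \<Rightarrow> 'b"
      using that S x0 by (metis continuous_on_def at_within_open)
    define r where "r x = L (b x - F x (y x0))" for x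
    define m where "m x = (\<Sum>b\<in>Basis. norm (L (F x b - F x0 b)))" for x
    have "(r \<longlongrightarrow> L (b x0 - F x0 (y x0))) (at x0)"
      unfolding r_def by (intro L.tendsto tendsto_diff lim F b)
    then have r: "(r \<longlongrightarrow> 0) (at x0)"
      using y[OF x0] by simp
    have "(m \<longlongrightarrow> (\<Sum>b\<in>(Basis::'a set). norm (L (F x0 b - F x0 b)))) (at x0)"
      unfolding m_def by (intro tendsto_intros L.tendsto lim F)
    then have "(m \<longlongrightarrow> 0) (at x0)" by simp
    then have ev: "\<forall>\<^sub>F x in at x0. m x < 1/2"
      by (rule order_tendstoD) simp
    have S': "\<forall>\<^sub>F x in at x0. x \<in> S"
      using S x0 by (rule eventually_at_in_open')
    have "\<forall>\<^sub>F x in at x0. norm (y x - y x0) \<le> norm (r x) * 2"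
      using ev S'
    proof eventually_elim
      case (elim x)
      let ?u = "y x - y x0"
      have "F x ?u = b x - F x (y x0)"
        using lin[OF elim(2)] y[OF elim(2)] by (simp add: linear_diff)
      then have "?u = r x - (\<Sum>b\<in>Basis. (?u \<bullet> b) *\<^sub>R L (F x b - F x0 b))"
        using L(2)[OF lin[OF elim(2)], of ?u] by (simp add: r_def)
      then have "norm ?u \<le> norm (r x) + norm (\<Sum>b\<in>Basis. (?u \<bullet> b) *\<^sub>R L (F x b - F x0 b))"
        by (metis norm_triangle_ineq4)
      also have "norm (\<Sum>b\<in>Basis. (?u \<bullet> b) *\<^sub>R L (F x b - F x0 b)) \<le> norm ?u * m x"
        unfolding m_def sum_distrib_left
        by (intro sum_norm_le) (auto intro!: mult_right_mono Basis_le_norm)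
      also have "norm ?u * m x \<le> norm ?u * (1/2)"
        using elim(1) by (intro mult_left_mono) auto
      finally show ?case by simp
    qed
    then have "((\<lambda>x. y x - y x0) \<longlongrightarrow> 0) (at x0)"
      by (rule tendsto_0_le[OF r])
    then show ?thesis
      using LIM_zero_cancel by blast
  qed
  then show ?thesis
    using S by (simp add: continuous_on_eq_continuous_at isCont_def)
qed

lemma linear_solution_has_derivative:
  fixes F :: "'x::real_normed_vector \<Rightarrow> 'a::euclidean_space \<Rightarrow> 'b::euclidean_space"
  assumes S: "open S" and lin: "\<And>x. x \<in> S \<Longrightarrow> linear (F x)" and inj: "\<And>x. x \<in> S \<Longrightarrow> inj (F x)"
    and F: "\<And>u x. x \<in> S \<Longrightarrow> (\<lambda>x. F x u) differentiable (at x)"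
    and b: "\<And>x. x \<in> S \<Longrightarrow> b differentiable (at x)"
    and y: "\<And>x. x \<in> S \<Longrightarrow> F x (y x) = b x" and x0: "x0 \<in> S"
  shows "y differentiable (at x0)"
proof -
  have "continuous_on S y"
    by (rule continuous_on_linear_solution[OF S lin inj _ _ y])
       (auto intro!: continuous_at_imp_continuous_on differentiable_imp_continuous_within F b)
  then have cont: "isCont y x0"
    using S x0 by (simp add: continuous_on_eq_continuous_at)
  obtain L where L: "bounded_linear L"
    "\<And>x u. linear (F x) \<Longrightarrow> u = L (F x u) - (\<Sum>b\<in>Basis. (u \<bullet> b) *\<^sub>R L (F x b - F x0 b))"
    using linear_solution_local_inverse[of F, OF lin[OF x0] inj[OF x0]] by metis
  have eq: "y x = y x0 + L (b x - F x (y x0)) -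
      (\<Sum>b\<in>Basis. ((y x - y x0) \<bullet> b) *\<^sub>R L (F x b - F x0 b))" if "x \<in> S" for x
  proof -
    have "F x (y x - y x0) = b x - F x (y x0)"
      using lin[OF that] y[OF that] by (simp add: linear_diff)
    moreover have "u = v + r - t" if "u - v = r - t" for u v r t :: 'a
      using that by (simp add: algebra_simps)
    ultimately show ?thesis
      using L(2)[OF lin[OF that], of "y x - y x0"] by metis
  qed
  have "(\<lambda>x. ((y x - y x0) \<bullet> c) *\<^sub>R L (F x c - F x0 c)) differentiable (at x0)" for c
  proof -
    obtain D where "((\<lambda>x. F x c) has_derivative D) (at x0)"
      using F[OF x0, of c] by (auto simp: differentiable_def)
    then have "((\<lambda>x. L (F x c - F x0 c)) has_derivative (\<lambda>v. L (D v - 0))) (at x0)"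
      by (intro bounded_linear.has_derivative[OF L(1)] has_derivative_diff has_derivative_const)
    then have "((\<lambda>x. ((y x - y x0) \<bullet> c) *\<^sub>R L (F x c - F x0 c)) has_derivative (\<lambda>v. 0)) (at x0)"
      by (rule has_derivative_scaleR_vanishing)
         (use cont in \<open>auto simp: linear_0[OF bounded_linear.linear[OF L(1)]] intro!: continuous_intros\<close>)
    then show ?thesis
      by (auto simp: differentiable_def)
  qed
  moreover have "(\<lambda>x. L (b x - F x (y x0))) differentiable (at x0)"
  proof -
    obtain D D' where "((\<lambda>x. F x (y x0)) has_derivative D) (at x0)" "(b has_derivative D') (at x0)"
      using F[OF x0, of "y x0"] b[OF x0] by (auto simp: differentiable_def)
    then have "((\<lambda>x. L (b x - F x (y x0))) has_derivative (\<lambda>v. L (D' v - D v))) (at x0)"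
      by (intro bounded_linear.has_derivative[OF L(1)] has_derivative_diff)
    then show ?thesis
      by (auto simp: differentiable_def)
  qed
  ultimately have "(\<lambda>x. y x0 + L (b x - F x (y x0)) -
      (\<Sum>b\<in>Basis. ((y x - y x0) \<bullet> b) *\<^sub>R L (F x b - F x0 b))) differentiable (at x0)"
    by (intro differentiable_add differentiable_diff differentiable_sum differentiable_const) auto
  then obtain D where "((\<lambda>x. y x0 + L (b x - F x (y x0)) -
      (\<Sum>b\<in>Basis. ((y x - y x0) \<bullet> b) *\<^sub>R L (F x b - F x0 b))) has_derivative D) (at x0)"
    by (auto simp: differentiable_def)
  then have "(y has_derivative D) (at x0)"
    by (rule has_derivative_transform_within_open[OF _ S x0]) (simp only: eq[symmetric])
  then show ?thesis
    by (auto simp: differentiable_def)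
qed

text \<open>The implicit function theorem in the linear case. The derivative of the solution solves a
system with the same matrix, which makes the induction on the order of differentiability work. It
yields the smoothness of matrix inversion and of the frame dual to a smooth coframe.\<close>

lemma Cn_on_linear_solution:
  fixes F :: "'x::real_normed_vector \<Rightarrow> 'a::euclidean_space \<Rightarrow> 'b::euclidean_space"
    and b :: "'x \<Rightarrow> 'b" and y :: "'x \<Rightarrow> 'a"
  assumes S: "open S" and lin: "\<And>x. x \<in> S \<Longrightarrow> linear (F x)" and inj: "\<And>x. x \<in> S \<Longrightarrow> inj (F x)"
  shows "(\<And>u. Cn_on n S (\<lambda>x. F x u)) \<Longrightarrow> Cn_on n S b \<Longrightarrow> (\<And>x. x \<in> S \<Longrightarrow> F x (y x) = b x) \<Longrightarrow>
    Cn_on n S y"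
proof (induction n arbitrary: b y)
  case 0
  then show ?case
    using continuous_on_linear_solution[OF S lin inj, where b = b and y = y] by simp
next
  case (Suc n)
  have dy: "y differentiable (at x)" if "x \<in> S" for x
    by (rule linear_solution_has_derivative[OF S lin inj _ _ Suc.prems(3)])
       (use Suc.prems that in auto)
  have n: "Cn_on n S y"
    by (rule Suc.IH[OF Cn_on_SucD Cn_on_SucD Suc.prems(3)]) (use Suc.prems in auto)
  \<comment> \<open>the right-hand side of the system obtained by differentiating \<open>F x (y x) = b x\<close>\<close>
  define b' where "b' v x = frechet_derivative b (at x) v -
      (\<Sum>c\<in>Basis. (y x \<bullet> c) *\<^sub>R frechet_derivative (\<lambda>x. F x c) (at x) v)" for v x
  have rep: "F x u = (\<Sum>c\<in>Basis. (u \<bullet> c) *\<^sub>R F x c)" if "x \<in> S" for x u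
    by (metis (no_types, lifting) euclidean_representation linear_scale linear_sum sum.cong lin[OF that])
  have sol: "F x (frechet_derivative y (at x) v) = b' v x" if x: "x \<in> S" for x v
  proof -
    have "((\<lambda>x. \<Sum>c\<in>Basis. (y x \<bullet> c) *\<^sub>R F x c) has_derivative
       (\<lambda>v. \<Sum>c\<in>Basis. (y x \<bullet> c) *\<^sub>R frechet_derivative (\<lambda>x. F x c) (at x) v +
          (frechet_derivative y (at x) v \<bullet> c) *\<^sub>R F x c)) (at x)"
      using dy[OF x] Cn_on_has_derivative[OF Suc.prems(1) x]
      by (intro has_derivative_sum has_derivative_scaleR has_derivative_inner_left)
         (auto simp: frechet_derivative_works)
    then have "(b has_derivative
       (\<lambda>v. \<Sum>c\<in>Basis. (y x \<bullet> c) *\<^sub>R frechet_derivative (\<lambda>x. F x c) (at x) v +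
          (frechet_derivative y (at x) v \<bullet> c) *\<^sub>R F x c)) (at x)"
      by (rule has_derivative_transform_within_open[OF _ S x]) (use Suc.prems(3) rep in simp)
    from fun_cong[OF frechet_derivative_at[OF this], of v] show ?thesis
      unfolding b'_def by (simp add: rep[OF x, of "frechet_derivative y (at x) v"] sum.distrib eq_diff_eq add.commute)
  qed
  have "Cn_on n S (b' v)" for v
    unfolding b'_def
    by (intro Cn_on_diff Cn_on_sum Cn_on_scaleR Cn_on_inner_left S n) (use Suc.prems in auto)
  then have "Cn_on n S (\<lambda>x. frechet_derivative y (at x) v)" for v
    using Suc.IH[OF Cn_on_SucD[OF Suc.prems(1)], of "b' v" "\<lambda>x. frechet_derivative y (at x) v" for v] sol
    by blast
  then show ?case
    using dy by simp
qed

section \<open>Symmetry of second derivatives\<close>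

text \<open>The mean value theorem, applied first along \<open>v\<close> and then along \<open>w\<close>. The left-hand side is symmetric in
\<open>v\<close> and \<open>w\<close>, and so the mixed derivatives in either order agree at two points near \<open>x\<close>.\<close>

lemma second_difference_mean_value:
  fixes f :: "'x::real_normed_vector \<Rightarrow> real"
  assumes f: "\<And>y. y \<in> ball x r \<Longrightarrow> (f has_derivative f' y) (at y)"
    and f': "\<And>y. y \<in> ball x r \<Longrightarrow> ((\<lambda>y. f' y v) has_derivative f'' y) (at y)"
    and h: "h > 0" "h * (norm v + norm w) < r"
  obtains t u where "0 < t" "t < h" "0 < u" "u < h"
    "f (x + h *\<^sub>R v + h *\<^sub>R w) - f (x + h *\<^sub>R v) - f (x + h *\<^sub>R w) + f x
       = h * h * f'' (x + t *\<^sub>R v + u *\<^sub>R w) w"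
proof -
  have inb: "x + t *\<^sub>R v + u *\<^sub>R w \<in> ball x r" if "0 \<le> t" "t \<le> h" "0 \<le> u" "u \<le> h" for t u
  proof -
    have "norm (t *\<^sub>R v + u *\<^sub>R w) \<le> t * norm v + u * norm w"
      using norm_triangle_ineq[of "t *\<^sub>R v" "u *\<^sub>R w"] that by simp
    also have "\<dots> \<le> h * norm v + h * norm w"
      using that by (intro add_mono mult_right_mono) auto
    also have "\<dots> < r"
      using h by (simp add: algebra_simps)
    finally have "dist (x + (t *\<^sub>R v + u *\<^sub>R w)) x < r"
      by (simp only: dist_norm add_diff_cancel_left')
    then show ?thesis
      by (simp add: dist_commute add.assoc)
  qed
  define p where "p t = f (x + t *\<^sub>R v + h *\<^sub>R w) - f (x + t *\<^sub>R v + 0 *\<^sub>R w)" for t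
  have c: "((\<lambda>t. f (x + t *\<^sub>R v + u *\<^sub>R w)) has_real_derivative f' (x + t *\<^sub>R v + u *\<^sub>R w) v) (at t)"
    if "0 \<le> t" "t \<le> h" "0 \<le> u" "u \<le> h" for t u
  proof -
    have "((\<lambda>t. x + t *\<^sub>R v + u *\<^sub>R w) has_derivative (\<lambda>s. s *\<^sub>R v)) (at t)"
      by (auto intro!: derivative_eq_intros)
    from diff_chain_at[OF this f[OF inb[OF that]]]
    show ?thesis
      using has_derivative_bounded_linear[OF f[OF inb[OF that]]]
      by (auto simp: has_field_derivative_def o_def linear_simps mult_commute_abs)
  qed
  have "(p has_real_derivative f' (x + t *\<^sub>R v + h *\<^sub>R w) v - f' (x + t *\<^sub>R v + 0 *\<^sub>R w) v) (at t)"
    if "0 \<le> t" "t \<le> h" for t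
    unfolding p_def by (intro DERIV_diff c) (use that h in auto)
  from MVT2[OF h(1) this] obtain t where t: "0 < t" "t < h"
    "p h - p 0 = h * (f' (x + t *\<^sub>R v + h *\<^sub>R w) v - f' (x + t *\<^sub>R v + 0 *\<^sub>R w) v)"
    by auto
  have "((\<lambda>u. f' (x + t *\<^sub>R v + u *\<^sub>R w) v) has_real_derivative f'' (x + t *\<^sub>R v + u *\<^sub>R w) w) (at u)"
    if "0 \<le> u" "u \<le> h" for u
  proof -
    have b: "x + t *\<^sub>R v + u *\<^sub>R w \<in> ball x r" using t that by (intro inb) auto
    have "((\<lambda>u. x + t *\<^sub>R v + u *\<^sub>R w) has_derivative (\<lambda>s. s *\<^sub>R w)) (at u)"
      by (auto intro!: derivative_eq_intros)
    from diff_chain_at[OF this f'[OF b]]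
    show ?thesis
      using has_derivative_bounded_linear[OF f'[OF b]]
      by (auto simp: has_field_derivative_def o_def linear_simps mult_commute_abs)
  qed
  from MVT2[OF h(1) this] obtain u where u: "0 < u" "u < h"
    "f' (x + t *\<^sub>R v + h *\<^sub>R w) v - f' (x + t *\<^sub>R v + 0 *\<^sub>R w) v = h * f'' (x + t *\<^sub>R v + u *\<^sub>R w) w"
    by auto
  show thesis
    using that[OF t(1,2) u(1,2)] t(3) u(3) by (simp add: p_def algebra_simps)
qed

lemma second_derivative_symmetric_real:
  fixes f :: "'x::real_normed_vector \<Rightarrow> real"
  assumes S: "open S" "x \<in> S" and f: "Cn_on (Suc (Suc 0)) S f"
  shows "frechet_derivative (\<lambda>y. frechet_derivative f (at y) v) (at x) w =
    frechet_derivative (\<lambda>y. frechet_derivative f (at y) w) (at x) v"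
proof -
  define D where "D v w y = frechet_derivative (\<lambda>y. frechet_derivative f (at y) v) (at y) w" for v w y
  have cont: "continuous_on S (D v w)" for v w
    using f by (simp add: D_def[abs_def])
  obtain r where r: "r > 0" "ball x r \<subseteq> S"
    using S open_contains_ball by blast
  have d1: "(f has_derivative frechet_derivative f (at y)) (at y)" if "y \<in> ball x r" for y
    using f r that by (intro Cn_on_has_derivative[of "Suc 0" S]) auto
  have d2: "((\<lambda>y. frechet_derivative f (at y) v) has_derivative (\<lambda>w. D v w y)) (at y)"
    if "y \<in> ball x r" for y v
    unfolding D_def using f r that by (intro Cn_on_has_derivative[of 0 S]) auto
  have "\<bar>D v w x - D w v x\<bar> \<le> 0 + e" if e: "e > 0" for e
  proof -
    obtain d1 where d1': "d1 > 0" "\<And>y. dist y x < d1 \<Longrightarrow> y \<in> S \<Longrightarrow> \<bar>D v w y - D v w x\<bar> < e/2"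
      using cont[of v w] S e unfolding continuous_on_iff
      by (metis half_gt_zero dist_real_def)
    obtain d2 where d2': "d2 > 0" "\<And>y. dist y x < d2 \<Longrightarrow> y \<in> S \<Longrightarrow> \<bar>D w v y - D w v x\<bar> < e/2"
      using cont[of w v] S e unfolding continuous_on_iff
      by (metis half_gt_zero dist_real_def)
    define h where "h = min r (min d1 d2) / (norm v + norm w + 1)"
    have pos: "norm v + norm w + 1 > 0" by (simp add: add_nonneg_pos)
    have h: "h > 0" using r d1' d2' pos by (simp add: h_def)
    have "h * (norm v + norm w + 1) = min r (min d1 d2)" using pos by (simp add: h_def)
    then have h2: "h * (norm v + norm w) < min r (min d1 d2)"
      using h unfolding distrib_left mult_1_right by linarith
    have near: "dist (x + t *\<^sub>R v + u *\<^sub>R w) x < min r (min d1 d2)" if "0 < t" "t < h" "0 < u" "u < h" for t u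
    proof -
      have "norm (t *\<^sub>R v + u *\<^sub>R w) \<le> t * norm v + u * norm w"
        using norm_triangle_ineq[of "t *\<^sub>R v" "u *\<^sub>R w"] that by simp
      also have "\<dots> \<le> h * norm v + h * norm w"
        using that by (intro add_mono mult_right_mono) auto
      also have "\<dots> < min r (min d1 d2)"
        using h2 by (simp add: algebra_simps)
      finally have "dist (x + (t *\<^sub>R v + u *\<^sub>R w)) x < min r (min d1 d2)"
        by (simp only: dist_norm add_diff_cancel_left')
      then show ?thesis by (simp only: add.assoc)
    qed
    obtain t u where tu: "0 < t" "t < h" "0 < u" "u < h"
      "f (x + h *\<^sub>R v + h *\<^sub>R w) - f (x + h *\<^sub>R v) - f (x + h *\<^sub>R w) + f x
         = h * h * D v w (x + t *\<^sub>R v + u *\<^sub>R w)"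
      using second_difference_mean_value[of x r f _ v "\<lambda>y w. D v w y" h w, OF d1 d2 h] h2 by auto
    obtain t' u' where tu': "0 < t'" "t' < h" "0 < u'" "u' < h"
      "f (x + h *\<^sub>R w + h *\<^sub>R v) - f (x + h *\<^sub>R w) - f (x + h *\<^sub>R v) + f x
         = h * h * D w v (x + t' *\<^sub>R w + u' *\<^sub>R v)"
      using second_difference_mean_value[of x r f _ w "\<lambda>y v. D w v y" h v, OF d1 d2 h] h2
      by (auto simp: add.commute)
    have "h * h * D v w (x + t *\<^sub>R v + u *\<^sub>R w) = h * h * D w v (x + u' *\<^sub>R v + t' *\<^sub>R w)"
      using tu(5) tu'(5) by (simp add: algebra_simps)
    then have "D v w (x + t *\<^sub>R v + u *\<^sub>R w) = D w v (x + u' *\<^sub>R v + t' *\<^sub>R w)"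
      using h by simp
    moreover have "x + t *\<^sub>R v + u *\<^sub>R w \<in> S" "x + u' *\<^sub>R v + t' *\<^sub>R w \<in> S"
      using near[OF tu(1-4)] near[OF tu'(3,4,1,2)] r by (auto simp: dist_commute)
    ultimately show ?thesis
      using d1'(2)[of "x + t *\<^sub>R v + u *\<^sub>R w"] d2'(2)[of "x + u' *\<^sub>R v + t' *\<^sub>R w"]
        near[OF tu(1-4)] near[OF tu'(3,4,1,2)] by linarith
  qed
  then have "\<bar>D v w x - D w v x\<bar> \<le> 0" by (rule field_le_epsilon)
  then show ?thesis by (simp add: D_def)
qed

lemma second_derivative_symmetric:
  fixes f :: "'x::real_normed_vector \<Rightarrow> 'b::euclidean_space"
  assumes S: "open S" "x \<in> S" and f: "Cn_on (Suc (Suc 0)) S f"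
  shows "frechet_derivative (\<lambda>y. frechet_derivative f (at y) v) (at x) w =
    frechet_derivative (\<lambda>y. frechet_derivative f (at y) w) (at x) v"
proof (rule euclidean_eqI)
  fix b :: 'b
  have 1: "frechet_derivative (\<lambda>z. f z \<bullet> b) (at y) = (\<lambda>v. frechet_derivative f (at y) v \<bullet> b)" if "y \<in> S" for y
    using has_derivative_inner_left[OF Cn_on_has_derivative[OF f that], of b] frechet_derivative_at by metis
  have 2: "frechet_derivative (\<lambda>y. frechet_derivative f (at y) v) (at x) w \<bullet> b =
      frechet_derivative (\<lambda>y. frechet_derivative (\<lambda>z. f z \<bullet> b) (at y) v) (at x) w" for v w
  proof -
    have "((\<lambda>y. frechet_derivative f (at y) v) has_derivative
        frechet_derivative (\<lambda>y. frechet_derivative f (at y) v) (at x)) (at x)"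
      using f S by (intro Cn_on_has_derivative[of 0 S]) auto
    then have "((\<lambda>y. frechet_derivative f (at y) v \<bullet> b) has_derivative
        (\<lambda>w. frechet_derivative (\<lambda>y. frechet_derivative f (at y) v) (at x) w \<bullet> b)) (at x)"
      by (rule has_derivative_inner_left)
    then have "((\<lambda>y. frechet_derivative (\<lambda>z. f z \<bullet> b) (at y) v) has_derivative
        (\<lambda>w. frechet_derivative (\<lambda>y. frechet_derivative f (at y) v) (at x) w \<bullet> b)) (at x)"
      by (rule has_derivative_transform_within_open[OF _ S]) (simp add: 1)
    from fun_cong[OF frechet_derivative_at[OF this], of w] show ?thesis .
  qed
  show "frechet_derivative (\<lambda>y. frechet_derivative f (at y) v) (at x) w \<bullet> b =
    frechet_derivative (\<lambda>y. frechet_derivative f (at y) w) (at x) v \<bullet> b"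
    unfolding 2 by (rule second_derivative_symmetric_real[OF S Cn_on_inner_left[OF S(1) f]])
qed

section \<open>The representation of GL(2) and its Lie algebra on binary forms\<close>

lemma hmonom_independent:
  assumes "\<And>xy. (\<Sum>i\<le>k. c i * hmonom k i xy) = 0" "i \<le> k"
  shows "c i = 0"
proof -
  have "(\<Sum>i\<le>k. c i * y ^ i) = 0" for y :: real
    using assms(1)[of "(1, y)"] by (simp add: hmonom_def)
  then show ?thesis
    using polyfun_eq_0[of c k] assms(2) by blast
qed

lemma frame_act_frame_act: "frame_act (frame_act xy g) h = frame_act xy (g ** h)"
  by (simp add: frame_act_def matrix_matrix_mult_def sum_2 algebra_simps)

lemma frame_act_mat_1: "frame_act xy (mat 1) = xy"
  by (simp add: frame_act_def mat_def)

lemma kmult_assoc: "kmult k (kmult k M N) L = kmult k M (kmult k N L)"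
proof -
  have "(\<Sum>l\<le>k. (\<Sum>m\<le>k. M i m * N m l) * L l j) = (\<Sum>m\<le>k. M i m * (\<Sum>l\<le>k. N m l * L l j))" for i j
    unfolding sum_distrib_left sum_distrib_right by (subst sum.swap) (simp add: mult.assoc)
  then show ?thesis by (simp add: kmult_def fun_eq_iff)
qed

lemma rho_mult: "rho k (g ** h) = kmult k (rho k g) (rho k h)"
proof (intro ext)
  fix i j
  show "rho k (g ** h) i j = kmult k (rho k g) (rho k h) i j"
  proof (cases "i \<le> k \<and> j \<le> k")
    case True
    have eq: "hmonom k j (frame_act xy g) = (\<Sum>i\<le>k. rho k g i j * hmonom k i xy)" if "j \<le> k" for j g xy
      using fun_cong[OF hact_hmonom[OF that]] by (simp add: hact_def)
    have "(\<Sum>i\<le>k. (rho k (g ** h) i j - kmult k (rho k g) (rho k h) i j) * hmonom k i xy) = 0" for xy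
    proof -
      have "(\<Sum>i\<le>k. rho k (g ** h) i j * hmonom k i xy) = hmonom k j (frame_act (frame_act xy g) h)"
        using True by (simp add: eq frame_act_frame_act)
      also have "\<dots> = (\<Sum>l\<le>k. rho k h l j * (\<Sum>i\<le>k. rho k g i l * hmonom k i xy))"
        using True by (simp add: eq)
      also have "\<dots> = (\<Sum>i\<le>k. kmult k (rho k g) (rho k h) i j * hmonom k i xy)"
        unfolding kmult_def sum_distrib_left sum_distrib_right
        by (subst sum.swap) (simp add: mult_ac)
      finally show ?thesis by (simp add: left_diff_distrib sum_subtractf)
    qed
    from hmonom_independent[OF this] True show ?thesis by simp
  qed (auto simp: rho_def kmult_def)
qed

definition kone :: "nat \<Rightarrow> kmatrix" where
  "kone k = (\<lambda>i j. if i \<le> k \<and> i = j then 1 else 0)"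

definition ksupp :: "nat \<Rightarrow> kmatrix \<Rightarrow> bool" where
  "ksupp k M \<longleftrightarrow> (\<forall>i j. k < i \<or> k < j \<longrightarrow> M i j = 0)"

lemma rho_mat_1: "rho k (mat 1) = kone k"
proof (intro ext)
  fix i j
  have "[:0, 1:] ^ j = monom (1::real) j"
    by (simp add: monom_altdef)
  then show "rho k (mat 1) i j = kone k i j"
    by (auto simp: rho_def kone_def mat_def one_pCons[symmetric])
qed

lemma kmult_kone: "ksupp k M \<Longrightarrow> kmult k (kone k) M = M" "ksupp k M \<Longrightarrow> kmult k M (kone k) = M"
proof -
  assume s: "ksupp k M"
  have "(\<Sum>l\<le>k. kone k i l * M l j) = (\<Sum>l\<le>k. if l = i then M i j else 0)" for i j
    by (intro sum.cong) (auto simp: kone_def)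
  with s show "kmult k (kone k) M = M"
    by (auto simp: kmult_def fun_eq_iff ksupp_def not_le)
  have "(\<Sum>l\<le>k. M i l * kone k l j) = (\<Sum>l\<le>k. if l = j then M i j else 0)" for i j
    by (intro sum.cong) (auto simp: kone_def)
  with s show "kmult k M (kone k) = M"
    by (auto simp: kmult_def fun_eq_iff ksupp_def not_le)
qed

lemma ksupp_rho: "ksupp k (rho k g)" and ksupp_drho: "ksupp k (drho k a)"
  by (auto simp: ksupp_def rho_def drho_def)

lemma ksupp_kmult: "ksupp k M \<Longrightarrow> ksupp k N \<Longrightarrow> ksupp k (kmult k M N)"
  by (auto simp: ksupp_def kmult_def)

lemma ktrace_kmult_commute: "ktrace k (kmult k M N) = ktrace k (kmult k N M)"
  unfolding ktrace_def kmult_def by (subst sum.swap) (simp add: mult.commute)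

lemma matrix_inv_mult:
  fixes g :: "real^2^2"
  assumes "invertible g"
  shows "g ** matrix_inv g = mat 1" "matrix_inv g ** g = mat 1"
  using someI_ex[of "\<lambda>h. g ** h = mat 1 \<and> h ** g = mat 1"] assms
  unfolding invertible_def matrix_inv_def by auto

lemma rho_matrix_inv:
  assumes "invertible g"
  shows "kmult k (rho k g) (rho k (matrix_inv g)) = kone k"
    "kmult k (rho k (matrix_inv g)) (rho k g) = kone k"
  by (simp_all add: matrix_inv_mult[OF assms] rho_mat_1 flip: rho_mult)

lemma sum_fun_apply: "(\<Sum>i\<in>I. f i) x = (\<Sum>i\<in>I. (f i :: 'a \<Rightarrow> 'b::comm_monoid_add) x)"
  by (induction I rule: infinite_finite_induct) (auto simp: zero_fun_def)

lemma sym_monom_frame_act: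
  assumes "j \<le> k"
  shows "sym_monom k (fst (frame_act xy g)) (snd (frame_act xy g)) j =
    (\<Sum>i\<le>k. rho k g i j *\<^sub>R sym_monom k (fst xy) (snd xy) i)"
proof
  have eq: "sym_monom k x y j \<xi> = (if linear \<xi> then hmonom k j (\<xi> x, \<xi> y) else 0)" for x y j and \<xi> :: "'a \<Rightarrow> real"
    by (simp add: sym_monom_def sym_prod_def hmonom_def)
  fix \<xi> :: "'a \<Rightarrow> real"
  have "hmonom k j (frame_act (\<xi> (fst xy), \<xi> (snd xy)) g) =
      (\<Sum>i\<le>k. rho k g i j * hmonom k i (\<xi> (fst xy), \<xi> (snd xy)))"
    using fun_cong[OF hact_hmonom[OF assms]] by (simp add: hact_def)
  then show "sym_monom k (fst (frame_act xy g)) (snd (frame_act xy g)) j \<xi> =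
    (\<Sum>i\<le>k. rho k g i j *\<^sub>R sym_monom k (fst xy) (snd xy) i) \<xi>"
    unfolding sum_fun_apply scaleR_fun_def eq
    by (auto simp: frame_act_def linear_add linear_scale)
qed

lemma drho_add: "drho k (a + b) i j = drho k a i j + drho k b i j"
  by (simp add: drho_def algebra_simps)

lemma drho_scaleR: "drho k (r *\<^sub>R a) i j = r * drho k a i j"
  by (simp add: drho_def algebra_simps)

lemma linear_drho: "linear (\<lambda>a. drho k a i j)"
  by (rule linearI) (simp_all add: drho_add drho_scaleR)

lemma drho_inject:
  assumes "k \<ge> 1" "drho k a = drho k b"
  shows "a = b"
proof -
  have "drho k a 0 0 = drho k b 0 0" "drho k a 1 0 = drho k b 1 0" "drho k a 0 1 = drho k b 0 1" "drho k a k k = drho k b k k"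
    using assms(2) by simp_all
  then show ?thesis
    using assms(1) by (auto simp: drho_def vec_eq_iff forall_2)
qed

text \<open>The entries of \<open>rho k g\<close> are coefficients of products of powers of linear polynomials. The product rule for
coefficientwise derivatives in the parameter therefore gives the derivative of \<open>rho k\<close>.\<close>

lemma has_derivative_coeff_mult:
  assumes "\<And>i. ((\<lambda>g. coeff (p g) i) has_derivative (\<lambda>a. coeff (p' a) i)) (at g0)"
    and "\<And>i. ((\<lambda>g. coeff (q g) i) has_derivative (\<lambda>a. coeff (q' a) i)) (at g0)"
  shows "((\<lambda>g. coeff (p g * q g) i) has_derivative (\<lambda>a. coeff (p g0 * q' a + p' a * q g0 :: real poly) i)) (at g0)"
proof -
  have "((\<lambda>g. \<Sum>l\<le>i. coeff (p g) l * coeff (q g) (i - l)) has_derivative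
      (\<lambda>a. \<Sum>l\<le>i. coeff (p g0) l * coeff (q' a) (i - l) + coeff (p' a) l * coeff (q g0) (i - l))) (at g0)"
    by (intro has_derivative_sum has_derivative_mult assms)
  then show ?thesis
    by (simp add: coeff_mult sum.distrib)
qed

lemma has_derivative_coeff_power:
  assumes "\<And>i. ((\<lambda>g. coeff (p g) i) has_derivative (\<lambda>a. coeff (p' a :: real poly) i)) (at g0)"
  shows "((\<lambda>g. coeff (p g ^ n) i) has_derivative (\<lambda>a. coeff (of_nat n * p g0 ^ (n - 1) * p' a) i)) (at g0)"
proof (induction n arbitrary: i)
  case (Suc n)
  have "p g0 * (of_nat n * p g0 ^ (n - 1) * p' a) + p' a * p g0 ^ n = of_nat (Suc n) * p g0 ^ n * p' a" for a
    by (cases n) (simp_all add: algebra_simps)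
  then show ?case
    using has_derivative_coeff_mult[OF assms Suc] by simp
qed simp

text \<open>At the identity the powers of linear polynomials degenerate to monomials, so that only the first-order terms
displayed in the definition of \<open>drho\<close> survive.\<close>

lemma has_derivative_rho_1:
  "((\<lambda>g. rho k g i j) has_derivative (\<lambda>a. drho k a i j)) (at (mat 1))"
proof (cases "i \<le> k \<and> j \<le> k")
  case True
  have lin: "((\<lambda>g. coeff [:g $ r $ s, g $ r' $ s:] i) has_derivative
      (\<lambda>a. coeff [:a $ r $ s, a $ r' $ s:] i)) (at g0)" for r r' s i and g0 :: "real^2^2"
  proof -
    have l: "linear (\<lambda>g::real^2^2. coeff [:g $ r $ s, g $ r' $ s:] i)"
      by (rule linearI) (auto simp: coeff_pCons algebra_simps split: nat.splits)
    show ?thesis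
      by (intro bounded_linear_imp_has_derivative) (use l in \<open>simp add: linear_conv_bounded_linear\<close>)
  qed
  have X: "[:0, 1:] ^ n = monom (1::real) n" for n
    by (simp add: monom_altdef)
  let ?I = "mat 1 :: real^2^2"
  have "((\<lambda>g::real^2^2. coeff ([:g $ 1 $ 1, g $ 2 $ 1:] ^ (k - j) * [:g $ 1 $ 2, g $ 2 $ 2:] ^ j) i)
    has_derivative (\<lambda>a. coeff ([:?I $ 1 $ 1, ?I $ 2 $ 1:] ^ (k - j) *
       (of_nat j * [:?I $ 1 $ 2, ?I $ 2 $ 2:] ^ (j - 1) * [:a $ 1 $ 2, a $ 2 $ 2:]) +
       (of_nat (k - j) * [:?I $ 1 $ 1, ?I $ 2 $ 1:] ^ (k - j - 1) * [:a $ 1 $ 1, a $ 2 $ 1:]) *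
         [:?I $ 1 $ 2, ?I $ 2 $ 2:] ^ j) i)) (at ?I)"
    by (rule has_derivative_coeff_mult has_derivative_coeff_power lin)+
  moreover have "coeff ([:?I $ 1 $ 1, ?I $ 2 $ 1:] ^ (k - j) *
       (of_nat j * [:?I $ 1 $ 2, ?I $ 2 $ 2:] ^ (j - 1) * [:a $ 1 $ 2, a $ 2 $ 2:]) +
       (of_nat (k - j) * [:?I $ 1 $ 1, ?I $ 2 $ 1:] ^ (k - j - 1) * [:a $ 1 $ 1, a $ 2 $ 1:]) *
         [:?I $ 1 $ 2, ?I $ 2 $ 2:] ^ j) i = drho k a i j" (is "?L = _") for a :: "real^2^2"
  proof -
    have I: "[:?I $ 1 $ 1, ?I $ 2 $ 1:] = 1" "[:?I $ 1 $ 2, ?I $ 2 $ 2:] = monom 1 1"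
      by (simp_all add: mat_def one_pCons monom_altdef)
    have n: "of_nat n * q = smult (real n) q" for n and q :: "real poly"
      by (simp add: of_nat_poly)
    have pc: "[:r:] * q = smult r q" for r and q :: "real poly"
      by simp
    have "?L = real j * coeff (monom 1 (j - 1) * [:a $ 1 $ 2, a $ 2 $ 2:]) i +
        real (k - j) * coeff ([:a $ 1 $ 1, a $ 2 $ 1:] * monom 1 j) i"
      unfolding I mult.assoc n monom_power
      by (simp add: pc del: mult_pCons_left mult_pCons_right)
    also have "\<dots> = drho k a i j"
      unfolding coeff_monom_mult mult.commute[of _ "monom 1 j"]
      using True by (cases j) (auto simp: drho_def coeff_pCons not_le split: nat.splits)
    finally show ?thesis .
  qed
  ultimately show ?thesis
    using True by (simp add: rho_def)
next
  case False
  then have "(\<lambda>g. rho k g i j) = (\<lambda>g. 0)" "(\<lambda>a. drho k a i j) = (\<lambda>a. 0)"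
    by (auto simp: rho_def drho_def fun_eq_iff)
  then show ?thesis by simp
qed

lemma bounded_linear_matrix_mult_left: "bounded_linear (\<lambda>h::real^2^2. g ** h)"
  and bounded_linear_matrix_mult_right: "bounded_linear (\<lambda>h::real^2^2. h ** g)"
  by (auto simp: linear_conv_bounded_linear[symmetric] matrix_matrix_mult_def vec_eq_iff algebra_simps sum.distrib
      sum_distrib_left intro!: linearI)

lemma bounded_bilinear_matrix_mult: "bounded_bilinear (\<lambda>(a :: real^2^2) (b :: real^2^2). a ** b)"
  unfolding bilinear_conv_bounded_bilinear[symmetric] bilinear_def
  using bounded_linear_matrix_mult_left bounded_linear_matrix_mult_right
  by (auto simp: linear_conv_bounded_linear)

lemmas Cn_on_matrix_mult = Cn_on_bounded_bilinear[OF bounded_bilinear_matrix_mult]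

text \<open>By multiplicativity, \<open>\<rho>\<^sub>k(g') = \<rho>\<^sub>k(g) \<rho>\<^sub>k(g\<^sup>-\<^sup>1 g')\<close>, which reduces the derivative at \<open>g\<close> to the one at the
identity.\<close>

lemma has_derivative_rho:
  assumes "invertible g"
  shows "((\<lambda>g. rho k g i j) has_derivative
    (\<lambda>h. kmult k (rho k g) (drho k (matrix_inv g ** h)) i j)) (at g)"
proof -
  have "((\<lambda>g'. rho k g' l j) has_derivative (\<lambda>a. drho k a l j)) (at (matrix_inv g ** g))" for l
    using has_derivative_rho_1 matrix_inv_mult[OF assms] by simp
  from diff_chain_at[OF bounded_linear_imp_has_derivative[OF bounded_linear_matrix_mult_left] this]
  have "((\<lambda>g'. rho k (matrix_inv g ** g') l j) has_derivative (\<lambda>h. drho k (matrix_inv g ** h) l j)) (at g)" for l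
    by (simp add: o_def)
  then have "((\<lambda>g'. \<Sum>l\<le>k. rho k g i l * rho k (matrix_inv g ** g') l j) has_derivative
      (\<lambda>h. \<Sum>l\<le>k. rho k g i l * drho k (matrix_inv g ** h) l j)) (at g)"
    by (intro has_derivative_sum has_derivative_mult_right)
  moreover have "(\<Sum>l\<le>k. rho k g i l * rho k (matrix_inv g ** g') l j) = rho k g' i j" for g'
    using fun_cong[OF fun_cong[OF rho_mult[of k g "matrix_inv g ** g'"]], of i j] matrix_inv_mult[OF assms]
    by (simp add: kmult_def matrix_mul_assoc)
  ultimately show ?thesis by (simp add: kmult_def)
qed

text \<open>Both sides are the derivative of \<open>h \<mapsto> \<rho>\<^sub>k(h g)\<close> at the identity in direction \<open>a\<close>.\<close>

lemma rho_drho_conj: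
  assumes "invertible g"
  shows "kmult k (rho k g) (drho k (matrix_inv g ** (a ** g))) = kmult k (drho k a) (rho k g)"
proof (intro ext)
  fix i j
  have "((\<lambda>g'. rho k g' i j) has_derivative
    (\<lambda>h. kmult k (rho k g) (drho k (matrix_inv g ** h)) i j)) (at (mat 1 ** g))"
    using has_derivative_rho[OF assms] by simp
  from diff_chain_at[OF bounded_linear_imp_has_derivative[OF bounded_linear_matrix_mult_right] this]
  have 1: "((\<lambda>h. rho k (h ** g) i j) has_derivative
     (\<lambda>a. kmult k (rho k g) (drho k (matrix_inv g ** (a ** g))) i j)) (at (mat 1))"
    by (simp add: o_def)
  have "((\<lambda>h. \<Sum>l\<le>k. rho k h i l * rho k g l j) has_derivative
     (\<lambda>a. \<Sum>l\<le>k. drho k a i l * rho k g l j)) (at (mat 1))"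
    by (intro has_derivative_sum has_derivative_mult_left has_derivative_rho_1)
  then have 2: "((\<lambda>h. rho k (h ** g) i j) has_derivative (\<lambda>a. kmult k (drho k a) (rho k g) i j)) (at (mat 1))"
    by (simp add: rho_mult kmult_def)
  show "kmult k (rho k g) (drho k (matrix_inv g ** (a ** g))) i j = kmult k (drho k a) (rho k g) i j"
    using fun_cong[OF has_derivative_unique[OF 1 2], of a] .
qed

lemma drho_conj:
  assumes "invertible g"
  shows "drho k (matrix_inv g ** (a ** g)) = kmult k (rho k (matrix_inv g)) (kmult k (drho k a) (rho k g))"
  using arg_cong[OF rho_drho_conj[OF assms, of k a], of "kmult k (rho k (matrix_inv g))"]
  by (simp add: rho_matrix_inv[OF assms] kmult_kone ksupp_drho flip: kmult_assoc)

text \<open>The trace is invariant under conjugation, and \<open>\<rho>\<^sub>k(g)\<close> normalises the Lie algebra. This is why the torsion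
condition at one point of a fibre of \<open>B(E)\<close> implies it on the whole fibre.\<close>

lemma gk_perp_conj:
  assumes "invertible g" "\<psi> \<in> gk_perp k"
  shows "kmult k (rho k (matrix_inv g)) (kmult k \<psi> (rho k g)) \<in> gk_perp k"
proof -
  have s: "ksupp k \<psi>" using assms(2) by (auto simp: gk_perp_def ksupp_def)
  let ?c = "kmult k (rho k (matrix_inv g)) (kmult k \<psi> (rho k g))"
  have "ktrace k (kmult k (drho k a) ?c) = 0" for a
  proof -
    have i: "invertible (matrix_inv g)"
      using matrix_inv_mult[OF assms(1)] unfolding invertible_def by blast
    have ii: "matrix_inv (matrix_inv g) = g"
      using matrix_inv_mult[OF assms(1)] by (metis i matrix_inv_mult(2) matrix_mul_assoc matrix_mul_lid matrix_mul_rid)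
    have "ktrace k (kmult k (drho k a) ?c) =
        ktrace k (kmult k (kmult k (kmult k (drho k a) (rho k (matrix_inv g))) \<psi>) (rho k g))"
      by (simp add: kmult_assoc)
    also have "\<dots> = ktrace k (kmult k (kmult k (rho k g) (kmult k (drho k a) (rho k (matrix_inv g)))) \<psi>)"
      by (subst ktrace_kmult_commute) (simp add: kmult_assoc)
    also have "kmult k (rho k g) (kmult k (drho k a) (rho k (matrix_inv g))) = drho k (g ** (a ** matrix_inv g))"
      using drho_conj[OF i, of k a] by (simp add: ii)
    also have "ktrace k (kmult k (drho k (g ** (a ** matrix_inv g))) \<psi>) = 0"
      using assms(2) by (auto simp: gk_perp_def gk_def)
    finally show ?thesis .
  qed
  moreover have "ksupp k ?c"
    by (intro ksupp_kmult ksupp_rho s)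
  ultimately show ?thesis
    by (auto simp: gk_perp_def gk_def ksupp_def)
qed

lemma Cn_on_coeff_mult:
  assumes "open S" "\<And>i. Cn_on n S (\<lambda>x. coeff (p x) i)" "\<And>i. Cn_on n S (\<lambda>x. coeff (q x) i)"
  shows "Cn_on n S (\<lambda>x. coeff (p x * q x :: real poly) i)"
  unfolding coeff_mult by (intro Cn_on_sum Cn_on_mult assms)

lemma Cn_on_coeff_power:
  assumes "open S" "\<And>i. Cn_on n S (\<lambda>x. coeff (p x) i)"
  shows "Cn_on n S (\<lambda>x. coeff (p x ^ m :: real poly) i)"
proof (induction m arbitrary: i)
  case (Suc m)
  then show ?case using Cn_on_coeff_mult[OF assms Suc] by simp
qed simp

lemma Cn_on_entry:
  assumes "open S" "Cn_on n S (G :: _ \<Rightarrow> real^2^2)"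
  shows "Cn_on n S (\<lambda>x. G x $ r $ s)"
  using Cn_on_bounded_linear[OF bounded_linear_compose[OF bounded_linear_vec_nth bounded_linear_vec_nth] assms]
  by simp

lemma Cn_on_rho:
  assumes "open S" "Cn_on n S G"
  shows "Cn_on n S (\<lambda>x. rho k (G x) i j)"
proof -
  have "Cn_on n S (\<lambda>x. coeff [:G x $ r $ s, G x $ r' $ s':] l)" for r s r' s' l
  proof (cases l)
    case (Suc m)
    then show ?thesis using assms by (cases m) (auto intro: Cn_on_entry)
  qed (use assms in \<open>auto intro: Cn_on_entry\<close>)
  then have "Cn_on n S (\<lambda>x. coeff ([:G x $ 1 $ 1, G x $ 2 $ 1:] ^ (k - j) * [:G x $ 1 $ 2, G x $ 2 $ 2:] ^ j) i)"
    by (intro Cn_on_coeff_mult Cn_on_coeff_power assms(1))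
  then show ?thesis
    by (cases "i \<le> k \<and> j \<le> k") (auto simp: rho_def)
qed

section \<open>The linear system satisfied by the difference of two connections\<close>

lemma sum_atMost_real: "(\<Sum>l\<le>k. real l) = real k * (real k + 1) / 2"
  by (induction k) (auto simp: field_simps)

lemma sum_atMost_real_square: "(\<Sum>l\<le>k. real l ^ 2) = real k * (real k + 1) * (2 * real k + 1) / 6"
  by (induction k) (auto simp: field_simps power2_eq_square)

lemma drho_row_sum:
  assumes "l \<le> k"
  shows "(\<Sum>r\<le>k. drho k a l r * f r) = ((real k - real l) * a $ 1 $ 1 + real l * a $ 2 $ 2) * f l
    + (if l = 0 then 0 else (real k - real l + 1) * a $ 2 $ 1 * f (l - 1))
    + (if l = k then 0 else (real l + 1) * a $ 1 $ 2 * f (l + 1))"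
proof -
  have "(\<Sum>r\<le>k. drho k a l r * f r) = (\<Sum>r\<le>k. (if r = l then drho k a l l * f l else 0)
      + (if l \<noteq> 0 \<and> r = l - 1 then drho k a l (l - 1) * f (l - 1) else 0)
      + (if r = l + 1 then drho k a l (l + 1) * f (l + 1) else 0))"
    by (intro sum.cong) (auto simp: drho_def)
  also have "\<dots> = drho k a l l * f l + (if l \<noteq> 0 then drho k a l (l - 1) * f (l - 1) else 0)
      + (if l < k then drho k a l (l + 1) * f (l + 1) else 0)"
    using assms by (simp add: sum.distrib) arith
  finally show ?thesis
    using assms by (cases l) (auto simp: drho_def of_nat_diff algebra_simps)
qed

lemma drho_column_sum:
  assumes "c \<le> k"
  shows "(\<Sum>l\<le>k. f l * drho k a l c) = ((real k - real c) * a $ 1 $ 1 + real c * a $ 2 $ 2) * f c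
    + (if c = 0 then 0 else real c * a $ 1 $ 2 * f (c - 1))
    + (if c = k then 0 else (real k - real c) * a $ 2 $ 1 * f (c + 1))"
proof -
  have "(\<Sum>l\<le>k. f l * drho k a l c) = (\<Sum>l\<le>k. (if l = c then drho k a c c * f c else 0)
      + (if c \<noteq> 0 \<and> l = c - 1 then drho k a (c - 1) c * f (c - 1) else 0)
      + (if l = c + 1 then drho k a (c + 1) c * f (c + 1) else 0))"
    by (intro sum.cong) (auto simp: drho_def)
  also have "\<dots> = drho k a c c * f c + (if c \<noteq> 0 then drho k a (c - 1) c * f (c - 1) else 0)
      + (if c < k then drho k a (c + 1) c * f (c + 1) else 0)"
    using assms by (simp add: sum.distrib) arith
  finally show ?thesis
    using assms by (cases c) (auto simp: drho_def of_nat_diff algebra_simps)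
qed

text \<open>The trace form pairs the diagonal entries with each other, and the two off-diagonal entries with one another. The three
constants are the sums of \<open>(k - l)\<^sup>2\<close> (equally of \<open>l\<^sup>2\<close>), of \<open>l (k - l)\<close> and of \<open>l (k - l + 1)\<close> over \<open>l \<le> k\<close>.\<close>

lemma ktrace_drho_drho:
  "ktrace k (kmult k (drho k a) (drho k b)) =
     real k * (real k + 1) * (2 * real k + 1) / 6 * (a $ 1 $ 1 * b $ 1 $ 1 + a $ 2 $ 2 * b $ 2 $ 2)
   + (real k - 1) * real k * (real k + 1) / 6 * (a $ 1 $ 1 * b $ 2 $ 2 + a $ 2 $ 2 * b $ 1 $ 1)
   + real k * (real k + 1) * (real k + 2) / 6 * (a $ 1 $ 2 * b $ 2 $ 1 + a $ 2 $ 1 * b $ 1 $ 2)"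
proof -
  let ?K = "real k"
  have "ktrace k (kmult k (drho k a) (drho k b)) = (\<Sum>l\<le>k.
     ((?K - real l) * a $ 1 $ 1 + real l * a $ 2 $ 2) * ((?K - real l) * b $ 1 $ 1 + real l * b $ 2 $ 2)
   + real l * (?K - real l + 1) * a $ 2 $ 1 * b $ 1 $ 2
   + (real l + 1) * (?K - real l) * a $ 1 $ 2 * b $ 2 $ 1)"
    unfolding ktrace_def kmult_def
    by (intro sum.cong refl, subst drho_row_sum) (auto simp: drho_def of_nat_diff algebra_simps)
  also have "\<dots> = (\<Sum>l\<le>k. (?K^2 * a $ 1 $ 1 * b $ 1 $ 1 + ?K * a $ 1 $ 2 * b $ 2 $ 1)
     + real l * (?K * (a $ 1 $ 1 * b $ 2 $ 2 + a $ 2 $ 2 * b $ 1 $ 1 - 2 * a $ 1 $ 1 * b $ 1 $ 1)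
        + (?K + 1) * a $ 2 $ 1 * b $ 1 $ 2 + (?K - 1) * a $ 1 $ 2 * b $ 2 $ 1)
     + real l ^ 2 * (a $ 1 $ 1 * b $ 1 $ 1 + a $ 2 $ 2 * b $ 2 $ 2 - a $ 1 $ 1 * b $ 2 $ 2 - a $ 2 $ 2 * b $ 1 $ 1
        - a $ 2 $ 1 * b $ 1 $ 2 - a $ 1 $ 2 * b $ 2 $ 1))"
    by (intro sum.cong refl) algebra
  also have "\<dots> = real k * (real k + 1) * (2 * real k + 1) / 6 * (a $ 1 $ 1 * b $ 1 $ 1 + a $ 2 $ 2 * b $ 2 $ 2)
   + (real k - 1) * real k * (real k + 1) / 6 * (a $ 1 $ 1 * b $ 2 $ 2 + a $ 2 $ 2 * b $ 1 $ 1)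
   + real k * (real k + 1) * (real k + 2) / 6 * (a $ 1 $ 2 * b $ 2 $ 1 + a $ 2 $ 1 * b $ 1 $ 2)"
    unfolding sum.distrib sum_distrib_right[symmetric] sum_atMost_real sum_atMost_real_square
    by (simp add: field_simps power2_eq_square)
  finally show ?thesis .
qed

text \<open>For \<open>\<alpha> : H\<^sub>k \<rightarrow> gl(2)\<close>, given by its values on the monomial basis, this is the matrix of the endomorphism
\<open>Y \<mapsto> \<alpha>(e\<^sub>i) Y - \<alpha>(Y) e\<^sub>i\<close>: the Spencer differential of \<open>\<alpha>\<close>, by which the torsion changes when \<open>\<alpha>\<close> is added
to a connection.\<close>

definition spencer :: "nat \<Rightarrow> (nat \<Rightarrow> real^2^2) \<Rightarrow> nat \<Rightarrow> kmatrix" where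
  "spencer k \<alpha> i = (\<lambda>r c. if r \<le> k \<and> c \<le> k then drho k (\<alpha> i) r c - drho k (\<alpha> c) r i else 0)"

text \<open>The second term of the Spencer differential contributes \<open>\<Sum>\<^sub>l (drho a \<circ> drho (\<alpha> l))\<^sub>l\<^sub>i\<close>. Both factors are
tridiagonal, so only \<open>\<alpha> l\<close> with \<open>l\<close> between \<open>i - 2\<close> and \<open>i + 2\<close> enter.\<close>

lemma ktrace_spencer:
  assumes "i \<le> k"
  shows "ktrace k (kmult k (drho k a) (spencer k \<alpha> i)) = ktrace k (kmult k (drho k a) (drho k (\<alpha> i)))
    - (((real k - real i) * a $ 1 $ 1 + real i * a $ 2 $ 2) * ((real k - real i) * \<alpha> i $ 1 $ 1 + real i * \<alpha> i $ 2 $ 2)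
      + (if i = 0 then 0 else real i * a $ 1 $ 2 *
           ((real k - real i) * \<alpha> (i - 1) $ 1 $ 1 + real i * \<alpha> (i - 1) $ 2 $ 2))
      + (if i = k then 0 else (real k - real i) * a $ 2 $ 1 *
           ((real k - real i) * \<alpha> (i + 1) $ 1 $ 1 + real i * \<alpha> (i + 1) $ 2 $ 2))
      + (if i = 0 then 0 else real i *
          (((real k - real i + 1) * a $ 1 $ 1 + (real i - 1) * a $ 2 $ 2) * \<alpha> (i - 1) $ 1 $ 2
           + (if i = 1 then 0 else (real i - 1) * a $ 1 $ 2 * \<alpha> (i - 2) $ 1 $ 2)
           + (real k - real i + 1) * a $ 2 $ 1 * \<alpha> i $ 1 $ 2))
      + (if i = k then 0 else (real k - real i) *
          (((real k - real i - 1) * a $ 1 $ 1 + (real i + 1) * a $ 2 $ 2) * \<alpha> (i + 1) $ 2 $ 1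
           + (real i + 1) * a $ 1 $ 2 * \<alpha> i $ 2 $ 1
           + (if i + 1 = k then 0 else (real k - real i - 1) * a $ 2 $ 1 * \<alpha> (i + 2) $ 2 $ 1))))"
proof -
  have "ktrace k (kmult k (drho k a) (spencer k \<alpha> i)) =
     (\<Sum>l\<le>k. \<Sum>r\<le>k. drho k a l r * drho k (\<alpha> i) r l - drho k a l r * drho k (\<alpha> l) r i)"
    unfolding ktrace_def kmult_def spencer_def by (intro sum.cong) (auto simp: algebra_simps)
  also have "\<dots> = ktrace k (kmult k (drho k a) (drho k (\<alpha> i))) -
      (\<Sum>l\<le>k. \<Sum>r\<le>k. drho k a l r * drho k (\<alpha> l) r i)"
    unfolding ktrace_def kmult_def by (simp add: sum_subtractf)
  also have "(\<Sum>l\<le>k. \<Sum>r\<le>k. drho k a l r * drho k (\<alpha> l) r i) =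
     (\<Sum>l\<le>k. ((real k - real i) * \<alpha> l $ 1 $ 1 + real i * \<alpha> l $ 2 $ 2) * drho k a l i
       + (if i = 0 then 0 else real i * \<alpha> l $ 1 $ 2 * drho k a l (i - 1))
       + (if i = k then 0 else (real k - real i) * \<alpha> l $ 2 $ 1 * drho k a l (i + 1)))"
    by (intro sum.cong refl drho_column_sum[OF assms])
  also have "\<dots> = (\<Sum>l\<le>k. ((real k - real i) * \<alpha> l $ 1 $ 1 + real i * \<alpha> l $ 2 $ 2) * drho k a l i)
       + (if i = 0 then 0 else real i * (\<Sum>l\<le>k. \<alpha> l $ 1 $ 2 * drho k a l (i - 1)))
       + (if i = k then 0 else (real k - real i) * (\<Sum>l\<le>k. \<alpha> l $ 2 $ 1 * drho k a l (i + 1)))"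
    by (simp add: sum.distrib sum_distrib_left mult.assoc)
  also have "(if i = 0 then 0 else real i * (\<Sum>l\<le>k. \<alpha> l $ 1 $ 2 * drho k a l (i - 1))) =
     (if i = 0 then 0 else real i *
          (((real k - real i + 1) * a $ 1 $ 1 + (real i - 1) * a $ 2 $ 2) * \<alpha> (i - 1) $ 1 $ 2
           + (if i = 1 then 0 else (real i - 1) * a $ 1 $ 2 * \<alpha> (i - 2) $ 1 $ 2)
           + (real k - real i + 1) * a $ 2 $ 1 * \<alpha> i $ 1 $ 2))"
  proof (cases i)
    case (Suc i')
    then have "i' \<le> k" "i' \<noteq> k" using assms by auto
    then show ?thesis
      using drho_column_sum[of i' k "\<lambda>l. \<alpha> l $ 1 $ 2" a] Suc by (simp add: numeral_2_eq_2)
  qed simp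
  also have "(if i = k then 0 else (real k - real i) * (\<Sum>l\<le>k. \<alpha> l $ 2 $ 1 * drho k a l (i + 1))) =
     (if i = k then 0 else (real k - real i) *
          (((real k - real i - 1) * a $ 1 $ 1 + (real i + 1) * a $ 2 $ 2) * \<alpha> (i + 1) $ 2 $ 1
           + (real i + 1) * a $ 1 $ 2 * \<alpha> i $ 2 $ 1
           + (if i + 1 = k then 0 else (real k - real i - 1) * a $ 2 $ 1 * \<alpha> (i + 2) $ 2 $ 1)))"
  proof (cases "i = k")
    case False
    then have "i + 1 \<le> k" using assms by simp
    from drho_column_sum[OF this, of "\<lambda>l. \<alpha> l $ 2 $ 1" a]
    have "(\<Sum>l\<le>k. \<alpha> l $ 2 $ 1 * drho k a l (i + 1)) =
      ((real k - real i - 1) * a $ 1 $ 1 + (real i + 1) * a $ 2 $ 2) * \<alpha> (i + 1) $ 2 $ 1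
           + (real i + 1) * a $ 1 $ 2 * \<alpha> i $ 2 $ 1
           + (if i + 1 = k then 0 else (real k - real i - 1) * a $ 2 $ 1 * \<alpha> (i + 2) $ 2 $ 1)"
      by (cases "i + 1 = k") (simp_all add: algebra_simps)
    then show ?thesis by simp
  qed simp
  finally show ?thesis
    unfolding drho_column_sum[OF assms] by (simp only: add.assoc)
qed

text \<open>The equations for the four matrix units \<open>a\<close>. The formulas cover the ends of the range \<open>i \<le> k\<close> as well, since
terms with an index out of range carry a vanishing factor.\<close>

lemma spencer_equations:
  fixes \<alpha> :: "nat \<Rightarrow> real^2^2"
  assumes i: "i \<le> k" and z: "\<And>a. ktrace k (kmult k (drho k a) (spencer k \<alpha> i)) = 0"
  shows "real k * (real k + 1) * (2 * real k + 1) / 6 * \<alpha> i $ 1 $ 1 + (real k - 1) * real k * (real k + 1) / 6 * \<alpha> i $ 2 $ 2 =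
      (real k - real i) * ((real k - real i) * \<alpha> i $ 1 $ 1 + real i * \<alpha> i $ 2 $ 2)
       + real i * (real k - real i + 1) * \<alpha> (i - 1) $ 1 $ 2
       + (real k - real i) * (real k - real i - 1) * \<alpha> (i + 1) $ 2 $ 1" (is ?A)
    and "(real k - 1) * real k * (real k + 1) / 6 * \<alpha> i $ 1 $ 1 + real k * (real k + 1) * (2 * real k + 1) / 6 * \<alpha> i $ 2 $ 2 =
      real i * ((real k - real i) * \<alpha> i $ 1 $ 1 + real i * \<alpha> i $ 2 $ 2)
       + real i * (real i - 1) * \<alpha> (i - 1) $ 1 $ 2
       + (real k - real i) * (real i + 1) * \<alpha> (i + 1) $ 2 $ 1" (is ?B)
    and "real k * (real k + 1) * (real k + 2) / 6 * \<alpha> i $ 1 $ 2 =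
      (real k - real i) * ((real k - real i) * \<alpha> (i + 1) $ 1 $ 1 + real i * \<alpha> (i + 1) $ 2 $ 2)
       + real i * (real k - real i + 1) * \<alpha> i $ 1 $ 2
       + (real k - real i) * (real k - real i - 1) * \<alpha> (i + 2) $ 2 $ 1" (is ?C)
    and "real k * (real k + 1) * (real k + 2) / 6 * \<alpha> i $ 2 $ 1 =
      real i * ((real k - real i) * \<alpha> (i - 1) $ 1 $ 1 + real i * \<alpha> (i - 1) $ 2 $ 2)
       + real i * (real i - 1) * \<alpha> (i - 2) $ 1 $ 2
       + (real i + 1) * (real k - real i) * \<alpha> i $ 2 $ 1" (is ?D)
proof -
  define E :: "real \<Rightarrow> real \<Rightarrow> real \<Rightarrow> real \<Rightarrow> real^2^2" where
    "E p q r t = vector [vector [p, q], vector [r, t]]" for p q r t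
  have E: "E p q r t $ 1 $ 1 = p" "E p q r t $ 1 $ 2 = q" "E p q r t $ 2 $ 1 = r" "E p q r t $ 2 $ 2 = t" for p q r t
    by (simp_all add: E_def)
  note e = z[unfolded ktrace_spencer[OF i] ktrace_drho_drho]
  show ?A using e[of "E 1 0 0 0", unfolded E]
    by (cases "i = k"; cases "i = 0") (simp_all add: algebra_simps cong: if_cong)
  show ?B using e[of "E 0 0 0 1", unfolded E]
    by (cases "i = k"; cases "i = 0") (simp_all add: algebra_simps cong: if_cong)
  show ?C using e[of "E 0 0 1 0", unfolded E]
    by (cases "i = k"; cases "i = 0"; cases "i + 1 = k") (auto simp add: algebra_simps cong: if_cong)
  show ?D using e[of "E 0 1 0 0", unfolded E]
    by (cases "i = k"; cases "i = 0"; cases "i = 1") (auto simp add: algebra_simps cong: if_cong)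
qed

text \<open>A block of the system under the diagonal torus: \<open>p\<close> and \<open>q\<close> are the diagonal entries of \<open>\<alpha>(e\<^sub>J)\<close>, while
\<open>x\<close> and \<open>y\<close> are the off-diagonal entries of \<open>\<alpha>(e\<^sub>J\<^sub>+\<^sub>1)\<close> and \<open>\<alpha>(e\<^sub>J\<^sub>-\<^sub>1)\<close> of the same weight. At the ends of the range
one of the latter is missing, together with its equation. The linear combinations in the proof are the components
of \<open>\<alpha>\<close> in the irreducible summands of \<open>H\<^sub>k \<otimes> gl(2)\<close>: \<open>p + q\<close> and \<open>S\<close> (which comes from the Casimir element) in the two copies
of \<open>H\<^sub>k\<close>, \<open>h\<close> in \<open>H\<^sub>k\<^sub>+\<^sub>2\<close> and \<open>p - q - y + x\<close> in \<open>H\<^sub>k\<^sub>-\<^sub>2\<close>.\<close>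

lemma weight_block_injective:
  fixes K J p q x y :: real
  assumes K: "K > 2"
    and e1: "K * (K + 1) * (2 * K + 1) / 6 * p + (K - 1) * K * (K + 1) / 6 * q =
      (K - J) * ((K - J) * p + J * q) + J * (K - J + 1) * y + (K - J) * (K - J - 1) * x"
    and e2: "(K - 1) * K * (K + 1) / 6 * p + K * (K + 1) * (2 * K + 1) / 6 * q =
      J * ((K - J) * p + J * q) + J * (J - 1) * y + (K - J) * (J + 1) * x"
    and e3: "J = 0 \<and> y = 0 \<or> K * (K + 1) * (K + 2) / 6 * y =
      (K - J + 1) * ((K - J + 1) * p + (J - 1) * q) + (J - 1) * (K - J + 2) * y + (K - J + 1) * (K - J) * x"
    and e4: "J = K \<and> x = 0 \<or> K * (K + 1) * (K + 2) / 6 * x =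
      (J + 1) * ((K - J - 1) * p + (J + 1) * q) + (J + 1) * J * y + (J + 2) * (K - J - 1) * x"
  shows "p = 0" "q = 0" "x = 0" "y = 0"
proof -
  define R where "R = K * (K + 1) * (K + 2) / 6"
  define S where "S = (K - 2 * J) / 2 * (p - q) + J * y + (K - J) * x"
  define h where "h = (K - J + 1) * ((K - J) * x - (J + 1) * (p - q)) - (J + 1) * J * y"
  have R6: "6 * R = K * (K + 1) * (K + 2)" by (simp add: R_def)
  \<comment> \<open>the sum of the first two equations, that is, the equation for the identity of \<open>gl(2)\<close>\<close>
  have S: "S = K ^ 2 / 2 * (p + q)"
  proof -
    have "K * S = K ^ 3 / 2 * (p + q)"
      using e1 e2 unfolding S_def by (simp add: field_simps power2_eq_square power3_eq_cube)
    then show ?thesis using K by (simp add: power2_eq_square power3_eq_cube)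
  qed
  have J3: "J * (R * y) = J * ((K - J + 1) * ((K - J + 1) * p + (J - 1) * q) + (J - 1) * (K - J + 2) * y + (K - J + 1) * (K - J) * x)"
    using e3 by (auto simp: R_def)
  have J4: "(K - J) * (R * x) = (K - J) * ((J + 1) * ((K - J - 1) * p + (J + 1) * q) + (J + 1) * J * y + (J + 2) * (K - J - 1) * x)"
    using e4 by (auto simp: R_def)
  have e12: "R * (p - q) = (K - 2 * J) * ((K - J) * p + J * q) + J * (K - 2 * J + 2) * y + (K - J) * (K - 2 * J - 2) * x"
    using e1 e2 unfolding R_def by (simp add: field_simps)
  have "- (K ^ 2 * (K + 2) / 4) * (p + q) + (R - (K ^ 2 + 2 * K - 4) / 2) * S = 0"
  proof -
    have "R * S = (K - 2 * J) / 2 * (R * (p - q)) + J * (R * y) + (K - J) * (R * x)"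
      unfolding S_def by (simp add: algebra_simps)
    also have "\<dots> = K ^ 2 * (K + 2) / 4 * (p + q) + (K ^ 2 + 2 * K - 4) / 2 * S"
      unfolding e12 J3 J4 S_def by (simp add: field_simps power2_eq_square)
    finally show ?thesis by (simp add: algebra_simps)
  qed
  then have "K ^ 2 / 2 * (R - (K ^ 2 + 3 * K - 2) / 2) * (p + q) = 0"
    unfolding S by (simp add: field_simps power2_eq_square)
  \<comment> \<open>this is the constant that vanishes for \<open>K = 2\<close>\<close>
  moreover have "R - (K ^ 2 + 3 * K - 2) / 2 = (K - 1) * (K - 2) * (K + 3) / 6"
    unfolding R_def by (simp add: field_simps power2_eq_square)
  ultimately have pq: "p + q = 0" using K by simp
  with S have S0: "S = 0" by simp
  have "(R - K) * h = 0"
  proof -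
    have "R * h = (K - J + 1) * ((K - J) * (R * x)) - (K - J + 1) * (J + 1) * (R * (p - q)) - (J + 1) * (J * (R * y))"
      unfolding h_def by (simp add: algebra_simps)
    also have "\<dots> = K * h"
      unfolding e12 J3 J4 h_def by (simp add: algebra_simps)
    finally show ?thesis by (simp add: algebra_simps)
  qed
  moreover have "R - K = K * (K - 1) * (K + 4) / 6"
    unfolding R_def by (simp add: field_simps)
  ultimately have h: "h = 0" using K by simp
  have q: "q = - p" using pq by simp
  have S': "(K - 2 * J) * p + J * y + (K - J) * x = 0"
    using S0 unfolding S_def q by simp
  \<comment> \<open>the summand \<open>H\<^sub>k\<^sub>-\<^sub>2\<close> does not occur in the extremal weights \<open>J = 0\<close> and \<open>J = K\<close>\<close>
  consider "J = 0" "y = 0" | "J = K" "x = 0" | "x = y - 2 * p"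
  proof -
    have "x = y - 2 * p" if "\<not> (J = 0 \<and> y = 0)" "\<not> (J = K \<and> x = 0)"
    proof -
      have 3: "R * y = (K - J + 1) * ((K - J + 1) * p + (J - 1) * q) + (J - 1) * (K - J + 2) * y + (K - J + 1) * (K - J) * x"
        and 4: "R * x = (J + 1) * ((K - J - 1) * p + (J + 1) * q) + (J + 1) * J * y + (J + 2) * (K - J - 1) * x"
        using e3 e4 that by (auto simp: R_def)
      have "(R + K + 2) * ((p - q) - y + x) = R * (p - q) - R * y + R * x + (K + 2) * ((p - q) - y + x)"
        by (simp add: algebra_simps)
      also have "\<dots> = 0"
        unfolding e12 3 4 by (simp add: algebra_simps)
      finally have "(R + K + 2) * ((p - q) - y + x) = 0" .
      moreover have "R + K + 2 > 0"
        using K by (simp add: R_def add_pos_pos)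
      ultimately have "(p - q) - y + x = 0"
        by simp
      then show ?thesis by (simp add: q)
    qed
    then show thesis using that by blast
  qed
  then have "p = 0 \<and> x = 0 \<and> y = 0"
  proof cases
    case 1
    then have "K * (p + x) = 0" using S' by (simp add: algebra_simps)
    then have x: "x = - p" using K by simp
    have "(K + 1) * ((K + 2) * p) = 0" using h 1 unfolding h_def q x by (simp add: algebra_simps)
    then show ?thesis using K 1 x by simp
  next
    case 2
    then have "K * (y - p) = 0" using S' by (simp add: algebra_simps)
    then have y: "y = p" using K by simp
    have "(K + 1) * ((K + 2) * p) = 0" using h 2 unfolding h_def q y by (simp add: algebra_simps)
    then show ?thesis using K 2 y by simp
  next
    case 3
    have "K * (y - p) = (K - 2 * J) * p + J * y + (K - J) * (y - 2 * p)"
      by (simp add: algebra_simps)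
    then have "K * (y - p) = 0" using S' 3 by simp
    then have y: "y = p" using K by simp
    have "(K + 1) * ((K + 2) * p) = 0" using h unfolding h_def q 3 y by (simp add: algebra_simps)
    then show ?thesis using K 3 y by simp
  qed
  then show "p = 0" "q = 0" "x = 0" "y = 0" using q by auto
qed

lemma spencer_injective:
  fixes \<alpha> :: "nat \<Rightarrow> real^2^2"
  assumes k: "k > 2" and z: "\<And>i a. i \<le> k \<Longrightarrow> ktrace k (kmult k (drho k a) (spencer k \<alpha> i)) = 0" and i: "i \<le> k"
  shows "\<alpha> i = 0"
proof -
  note e = spencer_equations[OF _ z]
  let ?K = "real k"
  have K: "?K > 2" using k by simp
  have block: "\<alpha> j $ 1 $ 1 = 0 \<and> \<alpha> j $ 2 $ 2 = 0 \<and> (j < k \<longrightarrow> \<alpha> (j + 1) $ 2 $ 1 = 0) \<and>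
      (0 < j \<longrightarrow> \<alpha> (j - 1) $ 1 $ 2 = 0)" if j: "j \<le> k" for j
  proof -
    define x where "x = (if j < k then \<alpha> (j + 1) $ 2 $ 1 else 0)"
    define y where "y = (if 0 < j then \<alpha> (j - 1) $ 1 $ 2 else 0)"
    have 3: "real j = 0 \<and> y = 0 \<or> ?K * (?K + 1) * (?K + 2) / 6 * y =
      (?K - real j + 1) * ((?K - real j + 1) * \<alpha> j $ 1 $ 1 + (real j - 1) * \<alpha> j $ 2 $ 2)
        + (real j - 1) * (?K - real j + 2) * y + (?K - real j + 1) * (?K - real j) * x"
    proof (cases j)
      case (Suc j')
      then have "j' \<le> k" using j by simp
      from e(3)[OF this] show ?thesis
        using Suc j by (cases "j = k") (auto simp: x_def y_def numeral_2_eq_2 algebra_simps)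
    qed (simp add: y_def)
    have 4: "real j = ?K \<and> x = 0 \<or> ?K * (?K + 1) * (?K + 2) / 6 * x =
      (real j + 1) * ((?K - real j - 1) * \<alpha> j $ 1 $ 1 + (real j + 1) * \<alpha> j $ 2 $ 2)
        + (real j + 1) * real j * y + (real j + 2) * (?K - real j - 1) * x"
    proof (cases "j = k")
      case False
      then have "j + 1 \<le> k" using j by simp
      from e(4)[OF this] show ?thesis
        using False j by (cases "j = 0") (auto simp: x_def y_def numeral_2_eq_2 algebra_simps)
    qed (simp add: x_def)
    have 1: "?K * (?K + 1) * (2 * ?K + 1) / 6 * \<alpha> j $ 1 $ 1 + (?K - 1) * ?K * (?K + 1) / 6 * \<alpha> j $ 2 $ 2 =
      (?K - real j) * ((?K - real j) * \<alpha> j $ 1 $ 1 + real j * \<alpha> j $ 2 $ 2)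
       + real j * (?K - real j + 1) * y + (?K - real j) * (?K - real j - 1) * x"
      using e(1)[OF j] j by (auto simp: x_def y_def)
    have 2: "(?K - 1) * ?K * (?K + 1) / 6 * \<alpha> j $ 1 $ 1 + ?K * (?K + 1) * (2 * ?K + 1) / 6 * \<alpha> j $ 2 $ 2 =
      real j * ((?K - real j) * \<alpha> j $ 1 $ 1 + real j * \<alpha> j $ 2 $ 2)
       + real j * (real j - 1) * y + (?K - real j) * (real j + 1) * x"
      using e(2)[OF j] j by (auto simp: x_def y_def)
    show ?thesis
      using weight_block_injective[OF K 1 2 3 4] by (auto simp: x_def y_def)
  qed
  \<comment> \<open>the weights outside the range \<open>j \<le> k\<close> occur in \<open>H\<^sub>k\<^sub>+\<^sub>2\<close> only and have a single unknown each\<close>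
  have x0: "\<alpha> 0 $ 2 $ 1 = 0" 
  proof -
    have "?K * ((?K - 1) * (?K + 4)) * \<alpha> 0 $ 2 $ 1 = 0"
      using e(4)[of 0] by (simp add: field_simps)
    then show ?thesis using K by simp
  qed
  have yk: "\<alpha> k $ 1 $ 2 = 0"
  proof -
    have "?K * ((?K - 1) * (?K + 4)) * \<alpha> k $ 1 $ 2 = 0"
      using e(3)[of k] by (simp add: field_simps)
    then show ?thesis using K by simp
  qed
  have "\<alpha> i $ 2 $ 1 = 0"
    using block[of "i - 1"] x0 i by (cases i) auto
  moreover have "\<alpha> i $ 1 $ 2 = 0"
    using block[of "i + 1"] yk i by (cases "i = k") auto
  ultimately show ?thesis
    using block[OF i] by (simp add: vec_eq_iff forall_2)
qed

section \<open>Charts and tangent vectors\<close>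

text \<open>The Jacobian of the coordinate change from \<open>c\<close> to \<open>d\<close>, as a map between coordinate vectors at \<open>p\<close>.\<close>

definition jac :: "('a, 'e::euclidean_space) chart \<Rightarrow> ('a, 'e) chart \<Rightarrow> 'a \<Rightarrow> 'e \<Rightarrow> 'e" where
  "jac c d p = frechet_derivative (snd d \<circ> chart_inv c) (at (snd c p))"

lemma charts_atD: "c \<in> charts_at A p \<Longrightarrow> c \<in> A \<and> p \<in> fst c"
  by (simp add: charts_at_def)

lemma chart_inv_chart:
  assumes "smooth_atlas S A" "c \<in> A" "p \<in> fst c"
  shows "chart_inv c (snd c p) = p"
  using assms by (auto simp: smooth_atlas_def chart_inv_def)

lemma chart_chart_inv:
  assumes "x \<in> snd c ` fst c"
  shows "snd c (chart_inv c x) = x" "chart_inv c x \<in> fst c"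
  using assms by (simp_all add: chart_inv_def f_inv_into_f inv_into_into)

lemma transition_has_derivative:
  assumes "smooth_atlas S A" "c \<in> charts_at A p" "d \<in> charts_at A p"
  shows "((\<lambda>x. snd d (chart_inv c x)) has_derivative jac c d p) (at (snd c p))"
proof -
  have "Cn_on (Suc 0) (snd c ` (fst c \<inter> fst d)) (snd d \<circ> chart_inv c)"
    using assms by (auto simp: smooth_atlas_def smooth_on_def charts_at_def simp del: Cn_on.simps)
  from Cn_on_has_derivative[OF this, of "snd c p"] show ?thesis
    using assms by (auto simp: jac_def charts_at_def o_def)
qed

text \<open>Maps into a manifold may be differentiated in any chart around the image point. The map \<open>\<gamma>\<close> is defined on a
normed space, so that this covers both local representatives of maps between manifolds and the orbit maps
behind fundamental vector fields.\<close>

lemma has_derivative_change_chart: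
  assumes S: "smooth_atlas S A" and d: "d \<in> charts_at A (\<gamma> x0)" "d' \<in> charts_at A (\<gamma> x0)"
    and ev: "\<forall>\<^sub>F x in nhds x0. \<gamma> x \<in> fst d"
    and der: "((\<lambda>x. snd d (\<gamma> x)) has_derivative R) (at x0)"
  shows "((\<lambda>x. snd d' (\<gamma> x)) has_derivative (\<lambda>v. jac d d' (\<gamma> x0) (R v))) (at x0)"
proof -
  have "((\<lambda>x. snd d' (chart_inv d (snd d (\<gamma> x)))) has_derivative (\<lambda>v. jac d d' (\<gamma> x0) (R v))) (at x0)"
    using diff_chain_at[OF der transition_has_derivative[OF S d]] by (simp add: o_def)
  moreover have "\<forall>\<^sub>F x in at x0. snd d' (chart_inv d (snd d (\<gamma> x))) = snd d' (\<gamma> x)"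
    using eventually_nhds_conv_at[THEN iffD1, OF ev]
    by (auto elim!: eventually_mono simp: chart_inv_chart[OF S] charts_atD[OF d(1)])
  ultimately show ?thesis
    using d by (auto intro: has_derivative_transform_eventually simp: chart_inv_chart[OF S] charts_at_def)
qed

lemma eventually_chart_inv:
  assumes "smooth_atlas S A" "c \<in> charts_at A p" "d \<in> charts_at A p"
  shows "\<forall>\<^sub>F x in nhds (snd c p). chart_inv c x \<in> fst c \<inter> fst d"
proof -
  have "open (snd c ` (fst c \<inter> fst d))" "snd c p \<in> snd c ` (fst c \<inter> fst d)"
    using assms by (auto simp: smooth_atlas_def charts_at_def)
  then have "\<forall>\<^sub>F x in nhds (snd c p). x \<in> snd c ` (fst c \<inter> fst d)"
    by (rule eventually_nhds_in_open)
  then show ?thesis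
    by eventually_elim (use assms in \<open>auto simp: chart_inv_chart charts_at_def\<close>)
qed

lemma jac_refl:
  assumes "smooth_atlas S A" "c \<in> charts_at A p"
  shows "jac c c p = (\<lambda>u. u)"
proof -
  have "open (snd c ` fst c)" "snd c p \<in> snd c ` fst c"
    using assms by (auto simp: smooth_atlas_def charts_at_def)
  from has_derivative_transform_within_open[OF has_derivative_ident this]
  have "((\<lambda>x. snd c (chart_inv c x)) has_derivative (\<lambda>u. u)) (at (snd c p))"
    by (simp add: chart_chart_inv)
  then show ?thesis
    using transition_has_derivative[OF assms(1,2,2)] has_derivative_unique by blast
qed

lemma jac_trans:
  assumes "smooth_atlas S A" "c \<in> charts_at A p" "d \<in> charts_at A p" "e \<in> charts_at A p"
  shows "jac d e p (jac c d p u) = jac c e p u"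
proof -
  have p: "chart_inv c (snd c p) = p"
    using assms by (auto simp: chart_inv_chart charts_at_def)
  have ev: "\<forall>\<^sub>F x in nhds (snd c p). chart_inv c x \<in> fst d"
    using eventually_chart_inv[OF assms(1-3)] by (rule eventually_mono) auto
  have "((\<lambda>x. snd e (chart_inv c x)) has_derivative (\<lambda>u. jac d e p (jac c d p u))) (at (snd c p))"
    using has_derivative_change_chart[OF assms(1), of d "chart_inv c" "snd c p" e, unfolded p,
      OF assms(3,4) ev transition_has_derivative[OF assms(1-3)]] .
  then show ?thesis
    using transition_has_derivative[OF assms(1,2,4)] has_derivative_unique by metis
qed

lemma linear_jac:
  assumes "smooth_atlas S A" "c \<in> charts_at A p" "d \<in> charts_at A p"
  shows "linear (jac c d p)"
  using transition_has_derivative[OF assms] has_derivative_linear by blast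

lemma coord_vec_eq: "coord_vec A c p u = (\<lambda>d. if d \<in> charts_at A p then jac c d p u else 0)"
  unfolding coord_vec_def jac_def ..

lemma tangent_space_iff:
  "v \<in> tangent_space A p \<longleftrightarrow> (\<forall>c. c \<notin> charts_at A p \<longrightarrow> v c = 0) \<and>
     (\<forall>c\<in>charts_at A p. \<forall>d\<in>charts_at A p. v d = jac c d p (v c))"
  by (simp add: tangent_space_def jac_def)

lemma tangent_jac:
  "v \<in> tangent_space A p \<Longrightarrow> c \<in> charts_at A p \<Longrightarrow> d \<in> charts_at A p \<Longrightarrow> jac c d p (v c) = v d"
  by (metis tangent_space_iff)

lemma tangent_zero: "v \<in> tangent_space A p \<Longrightarrow> c \<notin> charts_at A p \<Longrightarrow> v c = 0"
  by (metis tangent_space_iff)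

lemma coord_vec_in_tangent_space:
  assumes "smooth_atlas S A" "c \<in> charts_at A p"
  shows "coord_vec A c p u \<in> tangent_space A p"
  unfolding tangent_space_iff coord_vec_eq using assms by (simp add: jac_trans)

lemma coord_vec_self:
  assumes "smooth_atlas S A" "c \<in> charts_at A p"
  shows "coord_vec A c p u c = u"
  using assms by (simp add: coord_vec_eq jac_refl)

lemma coord_vec_tangent:
  assumes "c \<in> charts_at A p" "v \<in> tangent_space A p"
  shows "coord_vec A c p (v c) = v"
  using assms by (auto simp: coord_vec_eq fun_eq_iff tangent_jac tangent_zero)

lemma coord_vec_change:
  assumes "smooth_atlas S A" "c \<in> charts_at A p" "d \<in> charts_at A p"
  shows "coord_vec A c p u = coord_vec A d p (jac c d p u)"
  using assms by (auto simp: coord_vec_eq jac_trans)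

lemma coord_vec_linear:
  assumes "smooth_atlas S A" "c \<in> charts_at A p"
  shows "coord_vec A c p (u + v) = coord_vec A c p u + coord_vec A c p v"
    "coord_vec A c p (r *\<^sub>R u) = r *\<^sub>R coord_vec A c p u"
  using linear_jac[OF assms]
  by (auto simp: coord_vec_eq fun_eq_iff linear_add linear_scale scaleR_fun_def)

lemma subspace_tangent_space:
  assumes "smooth_atlas S A"
  shows "subspace (tangent_space A p)"
proof (rule subspaceI)
  show "0 \<in> tangent_space A p"
    using linear_jac[OF assms] by (simp add: tangent_space_iff linear_0)
  show "u + v \<in> tangent_space A p" if "u \<in> tangent_space A p" "v \<in> tangent_space A p" for u v
    unfolding tangent_space_iff
    using linear_jac[OF assms] that by (simp add: linear_add tangent_jac tangent_zero)
  show "r *\<^sub>R u \<in> tangent_space A p" if "u \<in> tangent_space A p" for r u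
    unfolding tangent_space_iff
    using linear_jac[OF assms] that by (simp add: scaleR_fun_def linear_scale tangent_jac tangent_zero)
qed

text \<open>The definition of \<open>tangent_map\<close> picks an arbitrary chart; here the differential is computed in charts of one's own
choice. As \<open>coord_vec\<close> always gives a tangent vector, this also shows where \<open>tangent_map\<close> takes its values.\<close>

lemma tangent_map_eq:
  assumes A: "smooth_atlas S A" and A': "smooth_atlas S' A'"
    and c: "c \<in> charts_at A p" and d: "d \<in> charts_at A' (F p)"
    and ev: "\<forall>\<^sub>F x in nhds (snd c p). F (chart_inv c x) \<in> fst d"
    and der: "((\<lambda>x. snd d (F (chart_inv c x))) has_derivative R) (at (snd c p))"
    and v: "v \<in> tangent_space A p"
  shows "tangent_map A A' F p v = coord_vec A' d (F p) (R (v c))"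
proof -
  define c0 where "c0 = (SOME c. c \<in> charts_at A p)"
  have c0: "c0 \<in> charts_at A p" unfolding c0_def using c by (rule someI)
  have p: "chart_inv c0 (snd c0 p) = p" "chart_inv c (snd c p) = p"
    using c c0 A by (auto simp: chart_inv_chart charts_at_def)
  have tr: "((\<lambda>x. snd c (chart_inv c0 x)) has_derivative jac c0 c p) (at (snd c0 p))"
    by (rule transition_has_derivative[OF A c0 c])
  have ev0: "\<forall>\<^sub>F x in nhds (snd c0 p). chart_inv c0 x \<in> fst c"
    using eventually_chart_inv[OF A c0 c] by (auto elim: eventually_mono)
  have eq: "chart_inv c (snd c (chart_inv c0 x)) = chart_inv c0 x" if "chart_inv c0 x \<in> fst c" for x
    using that c A by (simp add: chart_inv_chart charts_at_def)
  have "filterlim (\<lambda>x. snd c (chart_inv c0 x)) (nhds (snd c p)) (nhds (snd c0 p))"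
    using has_derivative_continuous[OF tr] p
      tendsto_at_iff_tendsto_nhds[of "\<lambda>x. snd c (chart_inv c0 x)" "snd c0 p"]
    by (simp add: isCont_def)
  from filterlim_iff[THEN iffD1, rule_format, OF this ev] ev0
  have ev1: "\<forall>\<^sub>F x in nhds (snd c0 p). F (chart_inv c0 x) \<in> fst d"
    by eventually_elim (simp add: eq)
  have "((\<lambda>x. snd d (F (chart_inv c (snd c (chart_inv c0 x))))) has_derivative (\<lambda>u. R (jac c0 c p u))) (at (snd c0 p))"
    using diff_chain_at[OF tr, of "\<lambda>x. snd d (F (chart_inv c x))" R] der p by (simp add: o_def)
  moreover have "\<forall>\<^sub>F x in at (snd c0 p). snd d (F (chart_inv c (snd c (chart_inv c0 x)))) = snd d (F (chart_inv c0 x))"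
    using eventually_nhds_conv_at[THEN iffD1, OF ev0] by (auto elim!: eventually_mono simp: eq)
  ultimately have "((\<lambda>x. snd d (F (chart_inv c0 x))) has_derivative (\<lambda>u. R (jac c0 c p u))) (at (snd c0 p))"
    using p by (auto intro: has_derivative_transform_eventually)
  from has_derivative_change_chart[OF A' _ _ ev1 this] d
  have "((\<lambda>x. snd d' (F (chart_inv c0 x))) has_derivative (\<lambda>u. jac d d' (F p) (R (jac c0 c p u)))) (at (snd c0 p))"
    if "d' \<in> charts_at A' (F p)" for d'
    using that by (simp add: p)
  from fun_cong[OF frechet_derivative_at[OF this], of _ "v c0"]
  have "frechet_derivative (snd d' \<circ> F \<circ> chart_inv c0) (at (snd c0 p)) (v c0) = jac d d' (F p) (R (v c))"
    if "d' \<in> charts_at A' (F p)" for d'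
    using that by (simp add: o_def tangent_jac[OF v c0 c])
  then show ?thesis
    by (auto simp: tangent_map_def coord_vec_eq Let_def fun_eq_iff simp flip: c0_def)
qed

text \<open>Independence of the exterior derivative from the chart. If \<open>T\<close> is the coordinate change, then the coefficients in
the two charts are related by \<open>a\<^sub>0(u)(y) = a(DT\<^sub>y u)(T y)\<close>. Differentiation produces, besides the wanted terms, only
the second derivatives of \<open>T\<close>, and these cancel by symmetry.\<close>

lemma ext_deriv_eq:
  fixes \<alpha> :: "('a, 'e::euclidean_space, 'b::real_normed_vector) form1"
  assumes A: "smooth_atlas S A"
    and lin: "\<And>p. p \<in> S \<Longrightarrow> linear_on_space (tangent_space A p) (\<alpha> p)"
    and smooth: "\<And>c u. c \<in> A \<Longrightarrow> Cn_on (Suc 0) (snd c ` fst c) (form_coeff A \<alpha> c u)"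
    and c: "c \<in> charts_at A p" and v: "v \<in> tangent_space A p" and w: "w \<in> tangent_space A p"
  shows "ext_deriv A \<alpha> p v w =
    frechet_derivative (form_coeff A \<alpha> c (w c)) (at (snd c p)) (v c) -
    frechet_derivative (form_coeff A \<alpha> c (v c)) (at (snd c p)) (w c)"
proof -
  define c0 where "c0 = (SOME c. c \<in> charts_at A p)"
  have c0: "c0 \<in> charts_at A p" unfolding c0_def using c by (rule someI)
  have cA: "c \<in> A" "c0 \<in> A" "p \<in> fst c" "p \<in> fst c0" using c c0 by (auto simp: charts_at_def)
  define O0 where "O0 = snd c0 ` (fst c0 \<inter> fst c)"
  define T where "T = (\<lambda>y. snd c (chart_inv c0 y))"
  define y0 where "y0 = snd c0 p"
  have O0: "open O0" "y0 \<in> O0" "Cn_on n O0 T" for n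
    using A cA by (auto simp: O0_def y0_def T_def smooth_atlas_def smooth_on_def o_def)
  have Ty0: "T y0 = snd c p"
    using A cA by (simp add: T_def y0_def chart_inv_chart)
  define a where "a u = form_coeff A \<alpha> c u" for u
  have form_lin: "form_coeff A \<alpha> c u x = (\<Sum>b\<in>Basis. (u \<bullet> b) *\<^sub>R form_coeff A \<alpha> c b x)"
    if "c \<in> A" "x \<in> snd c ` fst c" for c u x
  proof -
    let ?p = "chart_inv c x"
    have ch: "c \<in> charts_at A ?p" using that chart_chart_inv[OF that(2)] by (simp add: charts_at_def)
    have pS: "?p \<in> S" using that chart_chart_inv[OF that(2)] A by (auto simp: smooth_atlas_def)
    have l: "linear (\<lambda>u. \<alpha> ?p (coord_vec A c ?p u))"
      using lin[OF pS] coord_vec_in_tangent_space[OF A ch]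
      by (intro linearI) (auto simp: linear_on_space_def coord_vec_linear[OF A ch])
    have "\<alpha> ?p (coord_vec A c ?p (\<Sum>b\<in>Basis. (u \<bullet> b) *\<^sub>R b)) =
        (\<Sum>b\<in>Basis. (u \<bullet> b) *\<^sub>R \<alpha> ?p (coord_vec A c ?p b))"
      using linear_sum[OF l, of "\<lambda>b. (u \<bullet> b) *\<^sub>R b" Basis] linear_scale[OF l] by simp
    then show ?thesis by (simp add: form_coeff_def euclidean_representation)
  qed
  have rel: "form_coeff A \<alpha> c0 u y = (\<Sum>b\<in>Basis. (frechet_derivative T (at y) u \<bullet> b) *\<^sub>R a b (T y))"
    if "y \<in> O0" for u y
  proof -
    let ?p = "chart_inv c0 y"
    have ch: "c \<in> charts_at A ?p" "c0 \<in> charts_at A ?p" "snd c0 ?p = y" "chart_inv c (T y) = ?p"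
      using that A cA by (auto simp: charts_at_def O0_def T_def chart_inv_chart)
    have J: "jac c0 c ?p u = frechet_derivative T (at y) u"
      using ch by (simp add: jac_def T_def o_def)
    have "form_coeff A \<alpha> c0 u y = form_coeff A \<alpha> c (frechet_derivative T (at y) u) (T y)"
      unfolding form_coeff_def ch(4) coord_vec_change[OF A ch(2,1)] J ..
    also have "T y \<in> snd c ` fst c"
      using that cA A by (auto simp: O0_def T_def chart_inv_chart)
    note form_lin[OF cA(1) this, of "frechet_derivative T (at y) u"]
    finally show ?thesis by (simp add: a_def)
  qed
  have Tder: "(T has_derivative frechet_derivative T (at y0)) (at y0)"
    using Cn_on_has_derivative[OF O0(3) O0(2)] .
  have ader: "(a u has_derivative frechet_derivative (a u) (at (T y0))) (at (T y0))" for u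
    unfolding a_def Ty0 using cA by (intro Cn_on_has_derivative[OF smooth]) auto
  define D2 where "D2 u v = frechet_derivative (\<lambda>y. frechet_derivative T (at y) u) (at y0) v" for u v
  have D2: "((\<lambda>y. frechet_derivative T (at y) u) has_derivative D2 u) (at y0)" for u
    using O0(3)[of "Suc (Suc 0)"] O0(2) unfolding D2_def
    by (intro Cn_on_has_derivative[of 0 O0]) (auto simp del: Cn_on.simps(1))
  have sym: "D2 u v = D2 v u" for u v
    unfolding D2_def by (rule second_derivative_symmetric[OF O0])
  let ?J = "frechet_derivative T (at y0)"
  have der0: "frechet_derivative (form_coeff A \<alpha> c0 u) (at y0) v =
     (\<Sum>b\<in>Basis. (?J u \<bullet> b) *\<^sub>R frechet_derivative (a b) (at (T y0)) (?J v) + (D2 u v \<bullet> b) *\<^sub>R a b (T y0))" for u v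
  proof -
    have "((\<lambda>y. \<Sum>b\<in>Basis. (frechet_derivative T (at y) u \<bullet> b) *\<^sub>R a b (T y)) has_derivative
      (\<lambda>v. \<Sum>b\<in>Basis. (?J u \<bullet> b) *\<^sub>R frechet_derivative (a b) (at (T y0)) (?J v) + (D2 u v \<bullet> b) *\<^sub>R a b (T y0))) (at y0)"
      using diff_chain_at[OF Tder ader]
      by (intro has_derivative_sum has_derivative_scaleR has_derivative_inner_left D2) (simp_all add: o_def)
    then have "(form_coeff A \<alpha> c0 u has_derivative
      (\<lambda>v. \<Sum>b\<in>Basis. (?J u \<bullet> b) *\<^sub>R frechet_derivative (a b) (at (T y0)) (?J v) + (D2 u v \<bullet> b) *\<^sub>R a b (T y0))) (at y0)"
      by (rule has_derivative_transform_within_open[OF _ O0(1,2)]) (simp add: rel)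
    from fun_cong[OF frechet_derivative_at[OF this], of v] show ?thesis by simp
  qed
  have der1: "(\<Sum>b\<in>Basis. (u \<bullet> b) *\<^sub>R frechet_derivative (a b) (at (T y0)) v) = frechet_derivative (a u) (at (T y0)) v" for u v
  proof -
    have "((\<lambda>x. \<Sum>b\<in>Basis. (u \<bullet> b) *\<^sub>R a b x) has_derivative
       (\<lambda>v. \<Sum>b\<in>Basis. (u \<bullet> b) *\<^sub>R frechet_derivative (a b) (at (T y0)) v)) (at (T y0))"
      by (intro has_derivative_sum has_derivative_scaleR_right ader)
    then have "(a u has_derivative
       (\<lambda>v. \<Sum>b\<in>Basis. (u \<bullet> b) *\<^sub>R frechet_derivative (a b) (at (T y0)) v)) (at (T y0))"
    proof (rule has_derivative_transform_within_open)
      show "open (snd c ` fst c)" "T y0 \<in> snd c ` fst c"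
        using A cA Ty0 by (auto simp: smooth_atlas_def)
      show "(\<Sum>b\<in>Basis. (u \<bullet> b) *\<^sub>R a b x) = a u x" if "x \<in> snd c ` fst c" for x
        unfolding a_def by (rule form_lin[OF cA(1) that, symmetric])
    qed
    from fun_cong[OF frechet_derivative_at[OF this], of v] show ?thesis by simp
  qed
  have Jv: "?J (v c0) = v c" "?J (w c0) = w c"
    using tangent_jac[OF v c0 c] tangent_jac[OF w c0 c] by (simp_all add: jac_def T_def y0_def o_def)
  show ?thesis
    unfolding ext_deriv_def Let_def c0_def[symmetric] y0_def[symmetric] der0 sum.distrib Jv der1
    by (simp add: sym[of "v c0"] a_def Ty0)
qed

section \<open>Bases of a plane and their symmetric powers\<close>

text \<open>The corner entries of \<open>rho k h\<close> are the \<open>k\<close>-th powers of entries of \<open>h\<close>, so that \<open>h\<close> is diagonal with first entry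
\<open>\<plusminus>1\<close>; the entry in position \<open>(1, 1)\<close> then forces the second diagonal entry to be the same.\<close>

lemma rho_eq_kone:
  assumes "k \<ge> 1" "rho k h = kone k"
  shows "h = mat 1 \<or> h = - mat 1"
proof -
  have top: "coeff ([:a, b:] ^ n) n = b ^ n" for a b :: real and n
  proof (induction n)
    case (Suc n)
    have "coeff ([:a, b:] ^ n) (Suc n) = 0"
      using degree_linear_powers[of a b n 0 0 0] by (simp add: coeff_eq_0)
    with Suc show ?case by (simp add: coeff_pCons)
  qed simp
  have bot: "coeff ([:a, b:] ^ n) 0 = a ^ n" for a b :: real and n
    by (simp add: coeff_0_power)
  have bot': "coeff ([:a:] ^ n) 0 = a ^ n" for a :: real and n
    by (simp add: coeff_0_power)
  have "rho k h k 0 = 0" "rho k h 0 k = 0" "rho k h 0 0 = 1" "rho k h 1 1 = 1"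
    using assms by (auto simp: kone_def)
  then have h21: "h $ 2 $ 1 = 0" and h12: "h $ 1 $ 2 = 0" and h11: "h $ 1 $ 1 ^ k = 1"
    and 11: "coeff ([:h $ 1 $ 1, 0:] ^ (k - 1) * [:h $ 1 $ 2, h $ 2 $ 2:]) 1 = 1"
    using assms(1) by (auto simp: rho_def top bot bot')
  have "[:h $ 1 $ 1, 0:] ^ (k - 1) = [:h $ 1 $ 1 ^ (k - 1):]"
    by (simp add: poly_const_pow)
  with 11 have "h $ 1 $ 1 ^ (k - 1) * h $ 2 $ 2 = 1"
    by (simp add: coeff_pCons mult.commute)
  moreover have "h $ 1 $ 1 ^ (k - 1) * h $ 1 $ 1 = 1"
    using h11 assms(1) by (metis One_nat_def Suc_pred less_eq_Suc_le mult.commute power_Suc)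
  ultimately have h22: "h $ 2 $ 2 = h $ 1 $ 1"
    by (metis mult_cancel_left zero_neq_one mult_zero_left)
  have "\<bar>h $ 1 $ 1\<bar> = 1"
    using assms(1) power_eq_1_iff[OF h11] by simp
  then have "h $ 1 $ 1 = 1 \<or> h $ 1 $ 1 = - 1" by linarith
  then show ?thesis
    using h12 h21 h22 by (auto simp: vec_eq_iff forall_2 mat_def)
qed

text \<open>For even \<open>k\<close> the sign is a genuine ambiguity. The last conclusion records that a sign that occurs once acts trivially
everywhere.\<close>

lemma rho_eq_imp_sign:
  assumes "k \<ge> 1" "invertible g" "rho k g' = rho k g"
  obtains \<epsilon> :: real where "\<epsilon> = 1 \<or> \<epsilon> = - 1" "g' = \<epsilon> *\<^sub>R g" "\<And>h. rho k (\<epsilon> *\<^sub>R h) = rho k h"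
proof -
  have "rho k (matrix_inv g ** g') = kone k"
    by (simp add: rho_mult assms rho_matrix_inv)
  then have "matrix_inv g ** g' = mat 1 \<or> matrix_inv g ** g' = - mat 1"
    using rho_eq_kone assms(1) by blast
  then obtain \<epsilon> :: real where e: "\<epsilon> = 1 \<or> \<epsilon> = - 1" "matrix_inv g ** g' = \<epsilon> *\<^sub>R mat 1"
    by (metis scaleR_minus1_left scaleR_one)
  have s: "h ** (\<epsilon> *\<^sub>R mat 1) = \<epsilon> *\<^sub>R h" for h :: "real^2^2"
    using linear_scale[OF bounded_linear.linear[OF bounded_linear_matrix_mult_left], of h \<epsilon> "mat 1"] by simp
  have "g' = g ** (matrix_inv g ** g')"
    using matrix_inv_mult[OF assms(2)] by (simp add: matrix_mul_assoc)
  then have "g' = \<epsilon> *\<^sub>R g" using e(2) s by simp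
  moreover have "rho k (\<epsilon> *\<^sub>R h) = rho k h" for h
  proof -
    have "rho k (\<epsilon> *\<^sub>R mat 1) = kone k"
      using \<open>rho k (matrix_inv g ** g') = kone k\<close> e(2) by simp
    then show ?thesis
      using rho_mult[of k h "\<epsilon> *\<^sub>R mat 1"] by (simp add: s kmult_kone ksupp_rho)
  qed
  ultimately show thesis using that e(1) by blast
qed

lemma independent_pair_iff:
  fixes x y :: "'v::real_vector"
  shows "x \<noteq> y \<and> independent {x, y} \<longleftrightarrow> (\<forall>r t. r *\<^sub>R x + t *\<^sub>R y = 0 \<longrightarrow> r = 0 \<and> t = 0)"
proof
  assume xy: "x \<noteq> y \<and> independent {x, y}"
  then have x: "x \<notin> span {y}" and y: "y \<noteq> 0"
    by (auto simp: independent_insert)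
  show "\<forall>r t. r *\<^sub>R x + t *\<^sub>R y = 0 \<longrightarrow> r = 0 \<and> t = 0"
  proof (intro allI impI)
    fix r t assume z: "r *\<^sub>R x + t *\<^sub>R y = 0"
    have "r = 0"
    proof (rule ccontr)
      assume r: "r \<noteq> 0"
      have "x = inverse r *\<^sub>R (r *\<^sub>R x)" using r by simp
      also have "r *\<^sub>R x = (- t) *\<^sub>R y" using z by (simp add: eq_neg_iff_add_eq_0)
      finally have "x = (inverse r * (- t)) *\<^sub>R y" by simp
      then show False using x by (metis span_base span_scale singletonI)
    qed
    with z y show "r = 0 \<and> t = 0" by simp
  qed
next
  assume *: "\<forall>r t. r *\<^sub>R x + t *\<^sub>R y = 0 \<longrightarrow> r = 0 \<and> t = 0"
  have "x \<noteq> y" using *[rule_format, of 1 "-1"] by auto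
  moreover have "y \<noteq> 0" using *[rule_format, of 0 1] by auto
  moreover have "x \<notin> span {y}"
  proof
    assume "x \<in> span {y}"
    then obtain r where "x = r *\<^sub>R y" by (auto simp: span_singleton)
    then show False using *[rule_format, of 1 "- r"] by simp
  qed
  ultimately show "x \<noteq> y \<and> independent {x, y}"
    by (simp add: independent_insert)
qed

lemma span_pair: "v \<in> span {x, y} \<longleftrightarrow> (\<exists>r t. v = r *\<^sub>R x + t *\<^sub>R (y::'v::real_vector))"
proof -
  have "v \<in> span {x, y} \<longleftrightarrow> (\<exists>r t. v - r *\<^sub>R x = t *\<^sub>R y)"
    by (auto simp: span_insert span_singleton)
  then show ?thesis by (auto simp: diff_eq_eq add.commute)
qed

lemma frame_act_inject:
  assumes "basis_of V xy" "frame_act xy g = frame_act xy h"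
  shows "g = h"
proof -
  have *: "r = 0 \<and> t = 0" if "r *\<^sub>R fst xy + t *\<^sub>R snd xy = 0" for r t
    using assms(1) that independent_pair_iff[of "fst xy" "snd xy"] by (auto simp: basis_of_def)
  have "(g $ 1 $ 1 - h $ 1 $ 1) *\<^sub>R fst xy + (g $ 2 $ 1 - h $ 2 $ 1) *\<^sub>R snd xy = 0"
    "(g $ 1 $ 2 - h $ 1 $ 2) *\<^sub>R fst xy + (g $ 2 $ 2 - h $ 2 $ 2) *\<^sub>R snd xy = 0"
    using assms(2) by (auto simp: frame_act_def algebra_simps)
  from *[OF this(1)] *[OF this(2)] show ?thesis
    by (simp add: vec_eq_iff forall_2)
qed

lemma basis_of_change:
  assumes "basis_of V xy" "basis_of V xy'"
  obtains g where "invertible g" "xy' = frame_act xy g"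
proof -
  have ex: "\<exists>g. zw' = frame_act zw g" if "basis_of V zw" "basis_of V zw'" for zw zw'
  proof -
    have "fst zw' \<in> span {fst zw, snd zw}" "snd zw' \<in> span {fst zw, snd zw}"
      using that by (auto simp: basis_of_def intro: span_base)
    then obtain a b c d where "fst zw' = a *\<^sub>R fst zw + b *\<^sub>R snd zw" "snd zw' = c *\<^sub>R fst zw + d *\<^sub>R snd zw"
      by (auto simp: span_pair)
    then have "zw' = frame_act zw (vector [vector [a, c], vector [b, d]])"
      by (simp add: frame_act_def prod_eq_iff)
    then show ?thesis by blast
  qed
  obtain g h where gh: "xy' = frame_act xy g" "xy = frame_act xy' h"
    using ex assms by metis
  then have "frame_act xy (g ** h) = frame_act xy (mat 1)"
    by (simp add: frame_act_mat_1 flip: frame_act_frame_act)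
  then have "g ** h = mat 1" by (rule frame_act_inject[OF assms(1)])
  then have "invertible g" by (auto simp: invertible_right_inverse)
  then show thesis using that gh(1) by blast
qed

lemma basis_of_frame_act:
  assumes "basis_of V xy" "invertible g"
  shows "basis_of V (frame_act xy g)"
proof -
  let ?h = "matrix_inv g"
  have inv_act: "xy = frame_act (frame_act xy g) ?h"
    by (simp add: frame_act_frame_act matrix_inv_mult[OF assms(2)] frame_act_mat_1)
  have sub: "span {fst (frame_act zw m), snd (frame_act zw m)} \<subseteq> span {fst zw, snd zw}" for zw :: "'v::real_vector \<times> 'v" and m
    by (rule span_minimal) (auto simp: frame_act_def intro: span_add span_scale span_base)
  have "span {fst (frame_act xy g), snd (frame_act xy g)} = V"
    using sub[of xy g] sub[of "frame_act xy g" ?h] assms(1) inv_act by (auto simp: basis_of_def)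
  moreover have "r = 0 \<and> t = 0" if z: "r *\<^sub>R fst (frame_act xy g) + t *\<^sub>R snd (frame_act xy g) = 0" for r t
  proof -
    let ?m = "vector [vector [r, 0], vector [t, 0]] :: real^2^2"
    have "frame_act xy (g ** ?m) = frame_act xy 0"
      using z by (simp add: frame_act_def[of _ ?m] frame_act_def[of _ 0] flip: frame_act_frame_act)
    then have "g ** ?m = 0" by (rule frame_act_inject[OF assms(1)])
    then have "?h ** (g ** ?m) = 0" by (simp add: matrix_matrix_mult_def vec_eq_iff)
    then have "?m = 0" by (simp add: matrix_mul_assoc matrix_inv_mult[OF assms(2)])
    then show ?thesis by (simp add: vec_eq_iff forall_2)
  qed
  ultimately show ?thesis
    using independent_pair_iff[of "fst (frame_act xy g)" "snd (frame_act xy g)"] by (auto simp: basis_of_def)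
qed

text \<open>Linear functionals take arbitrary values on a basis, so a relation between the products is a polynomial
identity.\<close>

lemma sym_monom_independent:
  assumes "basis_of V xy" "(\<Sum>i\<le>k. w i *\<^sub>R sym_monom k (fst xy) (snd xy) i) = 0" "i \<le> k"
  shows "w i = 0"
proof (rule hmonom_independent[OF _ assms(3)])
  fix ab :: "real \<times> real"
  have "independent {fst xy, snd xy}" "fst xy \<noteq> snd xy" using assms(1) by (auto simp: basis_of_def)
  from linear_independent_extend[OF this(1), of "\<lambda>v. if v = fst xy then fst ab else snd ab"] this(2)
  obtain \<xi> where \<xi>: "linear \<xi>" "\<xi> (fst xy) = fst ab" "\<xi> (snd xy) = snd ab"
    by auto
  have "(\<Sum>i\<le>k. w i *\<^sub>R sym_monom k (fst xy) (snd xy) i) \<xi> = 0"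
    using assms(2) by (simp add: zero_fun_def)
  then show "(\<Sum>i\<le>k. w i * hmonom k i ab) = 0"
    using \<xi> by (simp add: sum_fun_apply scaleR_fun_def sym_monom_def sym_prod_def hmonom_def case_prod_beta)
qed

lemma rho_eq_of_sym_monom:
  assumes "basis_of V xy"
    and "\<And>l. l \<le> k \<Longrightarrow> sym_monom k (fst (frame_act xy g)) (snd (frame_act xy g)) l =
      sym_monom k (fst (frame_act xy h)) (snd (frame_act xy h)) l"
  shows "rho k g = rho k h"
proof (intro ext)
  fix i l
  show "rho k g i l = rho k h i l"
  proof (cases "i \<le> k \<and> l \<le> k")
    case True
    have "(\<Sum>i\<le>k. (rho k g i l - rho k h i l) *\<^sub>R sym_monom k (fst xy) (snd xy) i) = 0"
      using assms(2)[of l] True by (simp add: sym_monom_frame_act scaleR_diff_left sum_subtractf)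
    from sym_monom_independent[OF assms(1) this] True show ?thesis by simp
  qed (auto simp: rho_def)
qed

text \<open>An identification of \<open>H\<^sub>k\<close> with the model space of the manifold, which has the same dimension \<open>k + 1\<close>. It makes
families indexed by \<open>{..k}\<close> accessible to linear algebra and calculus in Euclidean spaces.\<close>

definition basis_enum :: "nat \<Rightarrow> nat \<Rightarrow> 'm::euclidean_space" where
  "basis_enum k = (SOME \<beta>. bij_betw \<beta> {..k} Basis)"

locale basis_enumeration =
  fixes k :: nat and \<beta> :: "nat \<Rightarrow> 'm::euclidean_space"
  assumes dim: "DIM('m) = k + 1" and basis_enum: "\<beta> = basis_enum k"
begin

lemma bij_basis_enum: "bij_betw \<beta> {..k} Basis"
proof -
  have "\<exists>\<beta>. bij_betw \<beta> {..k} (Basis :: 'm set)"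
    using dim by (intro finite_same_card_bij) auto
  then show ?thesis unfolding basis_enum basis_enum_def by (rule someI_ex)
qed

lemma basis_enum_in_Basis: "i \<le> k \<Longrightarrow> \<beta> i \<in> Basis"
  using bij_basis_enum by (auto simp: bij_betw_def)

lemma inner_basis_enum: "i \<le> k \<Longrightarrow> j \<le> k \<Longrightarrow> \<beta> i \<bullet> \<beta> j = (if i = j then 1 else 0)"
  using bij_basis_enum by (auto simp: inner_Basis basis_enum_in_Basis bij_betw_def inj_on_eq_iff)

lemma sum_basis_enum: "(\<Sum>b\<in>Basis. f b) = (\<Sum>i\<le>k. f (\<beta> i))"
  using sum.reindex_bij_betw[OF bij_basis_enum, of f] by simp

lemma basis_enum_representation: "(\<Sum>i\<le>k. (u \<bullet> \<beta> i) *\<^sub>R \<beta> i) = u"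
  using euclidean_representation[of u] sum_basis_enum[of "\<lambda>b. (u \<bullet> b) *\<^sub>R b"] by simp

lemma inner_sum_basis_enum:
  assumes "j \<le> k"
  shows "(\<Sum>i\<le>k. w i *\<^sub>R \<beta> i) \<bullet> \<beta> j = w j"
proof -
  have "(\<Sum>i\<le>k. w i *\<^sub>R \<beta> i) \<bullet> \<beta> j = (\<Sum>i\<le>k. if i = j then w j else 0)"
    unfolding inner_sum_left using assms by (intro sum.cong) (auto simp: inner_basis_enum)
  then show ?thesis using assms by simp
qed

end

section \<open>The bundle of frames as a manifold\<close>

locale gl2_structure =
  fixes k :: nat and X :: "'a topology" and A :: "('a, 'm::euclidean_space) chart set"
    and E :: "('a, nat, 'v::real_vector) vbundle"
    and s :: "'a \<Rightarrow> ('a, 'm) tangent \<Rightarrow> ('v \<Rightarrow> real) \<Rightarrow> real"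
  assumes struct: "GL2_structure k X A E s" and k: "k > 2"
begin

abbreviation "B \<equiv> BE k X A E s"
abbreviation "AB \<equiv> BE_atlas k A E s"
abbreviation "P \<equiv> BE_param k A s"
abbreviation "cdom c U \<equiv> snd c ` (fst c \<inter> U)"
abbreviation "smon xy \<equiv> sym_monom k (fst xy) (snd xy)"

lemma struct_parts:
  shows "smooth_manifold X A" "DIM('m) = k + 1" "vector_bundle X A E" "vb_index E = {0, 1}"
    "vbundle_iso X A (tangent_bundle A) (sym_power k E) s"
  using struct unfolding GL2_structure_def by blast+

lemma atlas: "smooth_atlas (topspace X) A"
  using struct_parts(1) unfolding smooth_manifold_def by blast

lemmas dim = struct_parts(2)

lemma chart_in_topspace: "c \<in> A \<Longrightarrow> p \<in> fst c \<Longrightarrow> p \<in> topspace X"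
  using atlas unfolding smooth_atlas_def by blast

lemma s_linear: "p \<in> topspace X \<Longrightarrow> linear_on_space (tangent_space A p) (s p)"
  and s_bij: "p \<in> topspace X \<Longrightarrow> bij_betw (s p) (tangent_space A p) (sym_space k (vb_fibre E p))"
proof -
  have "\<forall>p\<in>topspace X. linear_on_space (vb_fibre (tangent_bundle A) p) (s p) \<and>
      bij_betw (s p) (vb_fibre (tangent_bundle A) p) (vb_fibre (sym_power k E) p)"
    using struct_parts(5) unfolding vbundle_iso_def by (rule conjunct1)
  moreover have "vb_fibre (tangent_bundle A) p = tangent_space A p"
    "vb_fibre (sym_power k E) p = sym_space k (vb_fibre E p)" for p
    by (simp_all add: tangent_bundle_def sym_power_def)
  ultimately show "p \<in> topspace X \<Longrightarrow> linear_on_space (tangent_space A p) (s p)"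
    and "p \<in> topspace X \<Longrightarrow> bij_betw (s p) (tangent_space A p) (sym_space k (vb_fibre E p))"
    by simp_all
qed

lemma frame_props:
  assumes "(U, e) \<in> vb_frames E"
  shows "openin X U" "p \<in> U \<Longrightarrow> inj_on (\<lambda>i. e i p) {0, 1} \<and> independent ((\<lambda>i. e i p) ` {0, 1}) \<and>
    span ((\<lambda>i. e i p) ` {0, 1}) = vb_fibre E p"
proof -
  have "\<forall>(U, e)\<in>vb_frames E. openin X U \<and>
        (\<forall>p\<in>U. inj_on (\<lambda>i. e i p) {0, 1} \<and> independent ((\<lambda>i. e i p) ` {0, 1}) \<and>
           span ((\<lambda>i. e i p) ` {0, 1}) = vb_fibre E p)"
    using struct_parts(3) unfolding vector_bundle_def struct_parts(4) by (elim conjE)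
  from bspec[OF this assms] show "openin X U" "p \<in> U \<Longrightarrow> inj_on (\<lambda>i. e i p) {0, 1} \<and>
    independent ((\<lambda>i. e i p) ` {0, 1}) \<and> span ((\<lambda>i. e i p) ` {0, 1}) = vb_fibre E p"
    unfolding prod.case by blast+
qed

lemmas frame_open = frame_props(1)

lemma frame_cover:
  assumes "p \<in> topspace X"
  obtains U e where "(U, e) \<in> vb_frames E" "p \<in> U"
proof -
  have "(\<Union>(U, e)\<in>vb_frames E. U) = topspace X"
    using struct_parts(3) unfolding vector_bundle_def by (elim conjE)
  then have "p \<in> (\<Union>(U, e)\<in>vb_frames E. U)" using assms by simp
  then show thesis using that by auto
qed

lemma frame_basis:
  assumes "(U, e) \<in> vb_frames E" "p \<in> U"
  shows "basis_of (vb_fibre E p) (e 0 p, e 1 p)"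
  using frame_props(2)[OF assms] by (simp add: basis_of_def)

lemma open_cdom:
  assumes c: "c \<in> A" and U: "(U, e) \<in> vb_frames E"
  shows "open (cdom c U)"
proof -
  have h: "homeomorphic_map (subtopology X (fst c)) (top_of_set (snd c ` fst c)) (snd c)"
    and o: "open (snd c ` fst c)"
    using struct_parts(1) c unfolding smooth_manifold_def smooth_atlas_def by blast+
  have "openin (subtopology X (fst c)) (fst c \<inter> U)"
    using frame_open[OF U] by (metis inf_commute openin_subtopology_Int)
  then have "openin (top_of_set (snd c ` fst c)) (snd c ` (fst c \<inter> U))"
    using homeomorphic_imp_open_map[OF h] by (simp add: open_map_def)
  then show ?thesis
    using o by (simp add: openin_open_eq)
qed

lemma cdomD:
  assumes "c \<in> A" "x \<in> cdom c U"
  shows "chart_inv c x \<in> fst c" "chart_inv c x \<in> U" "snd c (chart_inv c x) = x"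
    "chart_inv c x \<in> topspace X" "c \<in> charts_at A (chart_inv c x)"
proof -
  obtain p where "p \<in> fst c \<inter> U" "x = snd c p" using assms(2) by auto
  then show "chart_inv c x \<in> fst c" "chart_inv c x \<in> U" "snd c (chart_inv c x) = x"
    "chart_inv c x \<in> topspace X" "c \<in> charts_at A (chart_inv c x)"
    using chart_inv_chart[OF atlas assms(1)] chart_in_topspace[OF assms(1)] assms(1) by (auto simp: charts_at_def)
qed

lemma s_sum:
  assumes p: "p \<in> topspace X" and v: "\<And>i. i \<in> I \<Longrightarrow> v i \<in> tangent_space A p"
  shows "s p (\<Sum>i\<in>I. w i *\<^sub>R v i) = (\<Sum>i\<in>I. w i *\<^sub>R s p (v i))"
proof -
  have lin: "\<And>u v. u \<in> tangent_space A p \<Longrightarrow> v \<in> tangent_space A p \<Longrightarrow> s p (u + v) = s p u + s p v"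
    "\<And>r u. u \<in> tangent_space A p \<Longrightarrow> s p (r *\<^sub>R u) = r *\<^sub>R s p u"
    using s_linear[OF p] by (auto simp: linear_on_space_def)
  have sub: "subspace (tangent_space A p)" by (rule subspace_tangent_space[OF atlas])
  have s0: "s p 0 = 0"
    using lin(2)[of 0 0] sub by (simp add: subspace_0)
  show ?thesis
    using v
  proof (induction I rule: infinite_finite_induct)
    case (insert i I)
    then have "(\<Sum>i\<in>I. w i *\<^sub>R v i) \<in> tangent_space A p"
      by (intro subspace_sum[OF sub] subspace_scale[OF sub]) auto
    moreover have "w i *\<^sub>R v i \<in> tangent_space A p"
      using insert by (intro subspace_scale[OF sub]) auto
    ultimately have "s p (w i *\<^sub>R v i + (\<Sum>i\<in>I. w i *\<^sub>R v i)) = s p (w i *\<^sub>R v i) + s p (\<Sum>i\<in>I. w i *\<^sub>R v i)"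
      by (rule lin(1)[rotated])
    also have "\<dots> = w i *\<^sub>R s p (v i) + (\<Sum>i\<in>I. w i *\<^sub>R s p (v i))"
      using insert lin(2) by simp
    finally show ?case
      unfolding sum.insert[OF insert.hyps(1,2)] .
  qed (simp_all add: s0)
qed

lemma smon_in_range:
  assumes "p \<in> topspace X" "basis_of (vb_fibre E p) xy" "l \<le> k"
  shows "smon xy l \<in> s p ` tangent_space A p"
proof -
  have "fst xy \<in> vb_fibre E p" "snd xy \<in> vb_fibre E p"
    using assms(2) by (auto simp: basis_of_def intro: span_base)
  then have "smon xy l \<in> sym_space k (vb_fibre E p)"
    unfolding sym_space_def sym_monom_def
    using assms(3) by (intro span_base) (auto intro!: exI[of _ "replicate (k - l) (fst xy) @ replicate l (snd xy)"])
  then show ?thesis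
    using s_bij[OF assms(1)] by (simp add: bij_betw_def)
qed

lemma frame_of_props:
  assumes "p \<in> topspace X" "basis_of (vb_fibre E p) xy" "l \<le> k"
  shows "snd (frame_of k A s p xy) l \<in> tangent_space A p" "s p (snd (frame_of k A s p xy) l) = smon xy l"
  using smon_in_range[OF assms] assms(3) by (simp_all add: frame_of_def inv_into_into f_inv_into_f)

text \<open>Applying \<open>s p\<close> to the vectors of the frame recovers the symmetric products, as these lie in its range.\<close>

lemma frame_of_eq_iff:
  assumes "p \<in> topspace X" "basis_of (vb_fibre E p) xy" "p' \<in> topspace X" "basis_of (vb_fibre E p') xy'"
  shows "frame_of k A s p xy = frame_of k A s p' xy' \<longleftrightarrow> p = p' \<and> (\<forall>l\<le>k. smon xy l = smon xy' l)"
proof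
  assume *: "frame_of k A s p xy = frame_of k A s p' xy'"
  then have p: "p = p'" by (simp add: frame_of_def)
  moreover have "smon xy l = smon xy' l" if "l \<le> k" for l
    using frame_of_props(2)[OF assms(1,2) that] frame_of_props(2)[OF assms(3,4) that] * p by simp
  ultimately show "p = p' \<and> (\<forall>l\<le>k. smon xy l = smon xy' l)" by blast
next
  assume "p = p' \<and> (\<forall>l\<le>k. smon xy l = smon xy' l)"
  then show "frame_of k A s p xy = frame_of k A s p' xy'"
    by (auto simp: frame_of_def intro!: ext)
qed

lemma BE_act_frame_of:
  assumes "p \<in> topspace X" "basis_of (vb_fibre E p) xy" "invertible g"
  shows "BE_act k g (frame_of k A s p xy) = frame_of k A s p (frame_act xy g)"
proof -
  have "(\<Sum>i\<le>k. rho k g i j *\<^sub>R snd (frame_of k A s p xy) i) =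
      inv_into (tangent_space A p) (s p) (smon (frame_act xy g) j)" if j: "j \<le> k" for j
  proof (rule inv_into_f_eq[symmetric])
    show "inj_on (s p) (tangent_space A p)" using s_bij[OF assms(1)] by (simp add: bij_betw_def)
    show "(\<Sum>i\<le>k. rho k g i j *\<^sub>R snd (frame_of k A s p xy) i) \<in> tangent_space A p"
      using frame_of_props(1)[OF assms(1,2)]
      by (intro subspace_sum subspace_scale subspace_tangent_space[OF atlas]) auto
    show "s p (\<Sum>i\<le>k. rho k g i j *\<^sub>R snd (frame_of k A s p xy) i) = smon (frame_act xy g) j"
    proof -
      have "s p (\<Sum>i\<le>k. rho k g i j *\<^sub>R snd (frame_of k A s p xy) i) =
          (\<Sum>i\<le>k. rho k g i j *\<^sub>R s p (snd (frame_of k A s p xy) i))"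
        by (rule s_sum[OF assms(1)]) (use frame_of_props(1)[OF assms(1,2)] in simp)
      also have "\<dots> = (\<Sum>i\<le>k. rho k g i j *\<^sub>R smon xy i)"
        by (intro sum.cong refl arg_cong2[where f = scaleR] frame_of_props(2)[OF assms(1,2)]) simp
      finally show ?thesis
        by (simp only: sym_monom_frame_act[OF j])
    qed
  qed
  then show ?thesis
    by (simp add: BE_act_def frame_of_def fun_eq_iff)
qed

lemma P_eq: "P c e (x, g) = frame_of k A s (chart_inv c x) (frame_act (e 0 (chart_inv c x), e 1 (chart_inv c x)) g)"
  by (simp add: BE_param_def Let_def)

lemma fst_P: "fst (P c e y) = chart_inv c (fst y)"
  by (simp add: BE_param_def Let_def frame_of_def case_prod_beta)

lemma P_basis:
  assumes "c \<in> A" "(U, e) \<in> vb_frames E" "x \<in> cdom c U" "invertible g"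
  shows "basis_of (vb_fibre E (chart_inv c x)) (frame_act (e 0 (chart_inv c x), e 1 (chart_inv c x)) g)"
  using basis_of_frame_act[OF frame_basis[OF assms(2) cdomD(2)[OF assms(1,3)]] assms(4)] .

lemma BE_act_P:
  assumes "c \<in> A" "(U, e) \<in> vb_frames E" "x \<in> cdom c U" "invertible h" "invertible g"
  shows "BE_act k g (P c e (x, h)) = P c e (x, h ** g)"
  unfolding P_eq using BE_act_frame_of[OF cdomD(4)[OF assms(1,3)] P_basis[OF assms(1-4)] assms(5)]
  by (simp add: frame_act_frame_act)

lemma P_in_BE:
  assumes "c \<in> A" "(U, e) \<in> vb_frames E" "x \<in> cdom c U" "invertible g"
  shows "P c e (x, g) \<in> B"
  unfolding BE_def P_eq using cdomD(4)[OF assms(1,3)] P_basis[OF assms] by blast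

lemma P_eq_imp:
  assumes "c \<in> A" "(U, e) \<in> vb_frames E" "x \<in> cdom c U" "invertible g" "x' \<in> cdom c U" "invertible g'"
    and eq: "P c e (x', g') = P c e (x, g)"
  obtains \<epsilon> :: real where "x' = x" "\<epsilon> = 1 \<or> \<epsilon> = - 1" "g' = \<epsilon> *\<^sub>R g" "\<And>h. rho k (\<epsilon> *\<^sub>R h) = rho k h"
proof -
  note * = eq[unfolded P_eq frame_of_eq_iff[OF cdomD(4)[OF assms(1,5)] P_basis[OF assms(1,2,5,6)]
        cdomD(4)[OF assms(1,3)] P_basis[OF assms(1-4)]]]
  have x: "x' = x" using * cdomD(3)[OF assms(1,3)] cdomD(3)[OF assms(1,5)] by metis
  have "rho k g' = rho k g"
    by (rule rho_eq_of_sym_monom[OF frame_basis[OF assms(2) cdomD(2)[OF assms(1,3)]]]) (use * x in auto)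
  with rho_eq_imp_sign[of k g g'] assms(4) k x that show thesis
    by (metis One_nat_def Suc_leI less_trans zero_less_numeral)
qed

lemma P_sign:
  assumes "c \<in> A" "(U, e) \<in> vb_frames E" "x \<in> cdom c U" "invertible g" "invertible g'" "rho k g' = rho k g"
  shows "P c e (x, g') = P c e (x, g)"
  unfolding P_eq frame_of_eq_iff[OF cdomD(4)[OF assms(1,3)] P_basis[OF assms(1-3,5)]
        cdomD(4)[OF assms(1,3)] P_basis[OF assms(1-4)]]
  using assms(6) by (simp add: sym_monom_frame_act)

lemma BE_atlasE:
  assumes "d \<in> AB"
  obtains c U e W where "d = (P c e ` W, inv_into W (P c e))" "c \<in> A" "(U, e) \<in> vb_frames E" "open W"
    "W \<subseteq> cdom c U \<times> {g. invertible g}" "inj_on (P c e) W"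
  using assms by (fastforce simp: BE_atlas_def)

lemma BE_chart:
  assumes d: "d = (P c e ` W, inv_into W (P c e))" and inj: "inj_on (P c e) W"
  shows "snd d ` fst d = W" "\<And>y. y \<in> W \<Longrightarrow> chart_inv d y = P c e y" "\<And>y. y \<in> W \<Longrightarrow> snd d (P c e y) = y"
proof -
  show s: "snd d (P c e y) = y" if "y \<in> W" for y
    using that inj by (simp add: d)
  then show "snd d ` fst d = W"
    by (auto simp: d image_image)
  show "chart_inv d y = P c e y" if "y \<in> W" for y
  proof -
    have "inj_on (snd d) (fst d)" unfolding d by (simp add: inj_on_inv_into)
    then show ?thesis
      unfolding chart_inv_def by (rule inv_into_f_eq) (use that s in \<open>auto simp: d\<close>)
  qed
qed

lemma (in -) open_invertible: "open {g :: real^2^2. invertible g}"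
proof -
  have "continuous_on UNIV (\<lambda>g :: real^2^2. det g)"
    unfolding det_2 by (intro continuous_intros)
  then have "open ((\<lambda>g :: real^2^2. det g) -` (- {0}))"
    by (intro open_vimage) auto
  then show ?thesis
    by (simp add: invertible_det_nz vimage_def)
qed

text \<open>By \<open>P_eq_imp\<close>, only the sign of the matrix can be ambiguous. Restricting to a half space of matrices removes this
ambiguity.\<close>

lemma BE_chart_exists:
  assumes c: "c \<in> A" and U: "(U, e) \<in> vb_frames E" and x: "x \<in> cdom c U" and g: "invertible g"
  obtains W where "(x, g) \<in> W" "open W" "W \<subseteq> cdom c U \<times> {g. invertible g}" "inj_on (P c e) W"
    "(P c e ` W, inv_into W (P c e)) \<in> AB"
proof
  let ?W = "cdom c U \<times> ({g. invertible g} \<inter> {g'. g' \<bullet> g > 0})"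
  have "g \<noteq> 0" using g by (auto simp: invertible_det_nz det_2)
  then show "(x, g) \<in> ?W" using x g by simp
  show o: "open ?W"
    using open_cdom[OF c U] open_invertible
    by (intro open_Times open_Int) (auto intro!: open_Collect_less continuous_intros)
  show sub: "?W \<subseteq> cdom c U \<times> {g. invertible g}" by auto
  show inj: "inj_on (P c e) ?W"
  proof (rule inj_onI, clarify)
    fix y h y' h' assume *: "P c e (snd c y, h) = P c e (snd c y', h')" "y \<in> fst c" "y \<in> U" "y' \<in> fst c" "y' \<in> U"
      "invertible h" "invertible h'" "0 < h \<bullet> g" "0 < h' \<bullet> g"
    from P_eq_imp[OF c U _ *(7) _ *(6) *(1)] *(2-5) obtain \<epsilon> where
      "snd c y = snd c y'" "\<epsilon> = 1 \<or> \<epsilon> = - 1" "h = \<epsilon> *\<^sub>R h'" by blast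
    with *(8,9) show "snd c y = snd c y' \<and> h = h'" by auto
  qed
  show "(P c e ` ?W, inv_into ?W (P c e)) \<in> AB"
    unfolding BE_atlas_def using c U o sub inj by blast
qed

lemma open_overlap:
  assumes c: "c \<in> A" and c': "c' \<in> A" and U: "(U, e) \<in> vb_frames E" and U': "(U', e') \<in> vb_frames E"
  shows "open (snd c ` (fst c \<inter> fst c' \<inter> U \<inter> U'))"
proof -
  have "snd c ` (fst c \<inter> fst c' \<inter> U \<inter> U') = cdom c U \<inter> cdom c U' \<inter> snd c ` (fst c \<inter> fst c')"
    using atlas c by (auto simp: smooth_atlas_def dest: inj_onD)
  then show ?thesis
    using open_cdom[OF c U] open_cdom[OF c U'] atlas c c' by (auto simp: smooth_atlas_def)
qed

text \<open>The matrix \<open>H x\<close> expresses one local frame of \<open>E\<close> in the other; the parametrisations are then related by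
\<open>(x, g) \<mapsto> (\<tau> x, H x g)\<close>, where \<open>\<tau>\<close> is the coordinate change of the base.\<close>

lemma frame_transition:
  assumes c: "c \<in> A" and c': "c' \<in> A" and U: "(U, e) \<in> vb_frames E" and U': "(U', e') \<in> vb_frames E"
  shows "\<exists>H :: 'm \<Rightarrow> real^2^2. (\<forall>n. Cn_on n (snd c ` (fst c \<inter> fst c' \<inter> U \<inter> U')) H) \<and>
    (\<forall>x\<in>snd c ` (fst c \<inter> fst c' \<inter> U \<inter> U'). invertible (H x) \<and>
       (\<forall>g. P c e (x, g) = P c' e' (snd c' (chart_inv c x), H x ** g)))"
proof -
  let ?O = "snd c ` (fst c \<inter> fst c' \<inter> U \<inter> U')"
  have "\<forall>(U, e)\<in>vb_frames E. \<forall>(V, f)\<in>vb_frames E. \<exists>G.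
        (\<forall>i\<in>{0, 1}. \<forall>j\<in>{0, 1}. smooth_fun A (U \<inter> V) (G i j)) \<and>
        (\<forall>p\<in>U \<inter> V. \<forall>j\<in>{0, 1}. f j p = (\<Sum>i\<in>{0, 1}. G i j p *\<^sub>R e i p))"
    using struct_parts(3) unfolding vector_bundle_def struct_parts(4) by (elim conjE)
  from bspec[OF bspec[OF this U', simplified] U, simplified]
  obtain G where G: "\<And>i j. i \<in> {0, 1::nat} \<Longrightarrow> j \<in> {0, 1::nat} \<Longrightarrow> smooth_fun A (U' \<inter> U) (G i j)"
    "\<And>p j. p \<in> U' \<inter> U \<Longrightarrow> j \<in> {0, 1} \<Longrightarrow> e j p = G 0 j p *\<^sub>R e' 0 p + G 1 j p *\<^sub>R e' 1 p"
    by fastforce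
  define H :: "'m \<Rightarrow> real^2^2" where
    "H x = (\<chi> r s. G (if r = 1 then 0 else 1) (if s = 1 then 0 else 1) (chart_inv c x))" for x
  note open_O = open_overlap[OF c c' U U']
  have Gs: "Cn_on n ?O (\<lambda>x. G i j (chart_inv c x))" if "i \<in> {0, 1}" "j \<in> {0, 1}" for i j n
  proof -
    have "Cn_on n (snd c ` (U' \<inter> U \<inter> fst c)) (G i j \<circ> chart_inv c)"
      using G(1)[OF that] c by (auto simp: smooth_fun_def smooth_on_def)
    then show ?thesis by (auto intro: Cn_on_subset simp: o_def)
  qed
  have xO: "chart_inv c x \<in> U' \<inter> U" "x \<in> cdom c U" "chart_inv c x \<in> fst c'" if "x \<in> ?O" for x
    using that c by (auto simp: chart_inv_chart[OF atlas])
  have fr: "(e 0 (chart_inv c x), e 1 (chart_inv c x)) =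
      frame_act (e' 0 (chart_inv c x), e' 1 (chart_inv c x)) (H x)" if "x \<in> ?O" for x
    using G(2)[OF xO(1)[OF that]] by (simp add: frame_act_def H_def)
  show ?thesis
  proof (intro exI[of _ H] conjI allI ballI)
    show "Cn_on n ?O H" for n
    proof (rule Cn_on_componentwise[OF open_O])
      fix b :: "real^2^2" assume "b \<in> Basis"
      then obtain r s where "b = axis r (axis s 1)" by (auto simp: Basis_vec_def)
      then show "Cn_on n ?O (\<lambda>x. H x \<bullet> b)"
        by (auto simp: inner_axis H_def intro!: Gs)
    qed
    show "invertible (H x)" if "x \<in> ?O" for x
    proof -
      let ?p = "chart_inv c x"
      have b: "basis_of (vb_fibre E ?p) (e 0 ?p, e 1 ?p)" "basis_of (vb_fibre E ?p) (e' 0 ?p, e' 1 ?p)"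
        using frame_basis[OF U] frame_basis[OF U'] xO(1)[OF that] by auto
      from basis_of_change[OF b(2,1)] obtain g where
        "invertible g" "(e 0 ?p, e 1 ?p) = frame_act (e' 0 ?p, e' 1 ?p) g" by blast
      then show ?thesis using fr[OF that] frame_act_inject[OF b(2)] by metis
    qed
    show "P c e (x, g) = P c' e' (snd c' (chart_inv c x), H x ** g)" if "x \<in> ?O" for x g
      using chart_inv_chart[OF atlas c' xO(3)[OF that]] fr[OF that]
      by (simp add: P_eq frame_act_frame_act)
  qed
qed

text \<open>The coordinates of a point in the second chart are given by \<open>frame_transition\<close> up to a sign. The sign is fixed at the
point \<open>y0\<close>; the same sign then works on a neighbourhood, because \<open>W'\<close> is open and the parametrisation is injective
on it.\<close>

lemma BE_transition:
  assumes c: "c \<in> A" and U: "(U, e) \<in> vb_frames E" and W: "open W" "W \<subseteq> cdom c U \<times> {g. invertible g}"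
    and c': "c' \<in> A" and U': "(U', e') \<in> vb_frames E" and W': "open W'" "W' \<subseteq> cdom c' U' \<times> {g. invertible g}"
    and inj': "inj_on (P c' e') W'" and y0: "y0 \<in> W" "P c e y0 \<in> P c' e' ` W'"
  shows "\<exists>N T. open N \<and> y0 \<in> N \<and> N \<subseteq> W \<and> (\<forall>y\<in>N. T y \<in> W' \<and> P c e y = P c' e' (T y)) \<and>
    (\<forall>n. Cn_on n N T)"
proof -
  let ?O = "snd c ` (fst c \<inter> fst c' \<inter> U \<inter> U')"
  obtain x0 g0 where y0e: "y0 = (x0, g0)" by force
  obtain x1 g1 where y1: "(x1, g1) \<in> W'" "P c e (x0, g0) = P c' e' (x1, g1)" using y0 y0e by auto
  have x0: "x0 \<in> cdom c U" "invertible g0" and x1: "x1 \<in> cdom c' U'" "invertible g1"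
    using W(2) W'(2) y0 y0e y1 by auto
  have "chart_inv c x0 = chart_inv c' x1"
    using y1(2) fst_P[of c e "(x0, g0)"] fst_P[of c' e' "(x1, g1)"] by simp
  then have x0O: "x0 \<in> ?O" "x1 = snd c' (chart_inv c x0)"
    using cdomD[OF c x0(1)] cdomD[OF c' x1(1)] by (auto intro!: image_eqI[of _ _ "chart_inv c x0"])
  obtain H :: "'m \<Rightarrow> real^2^2" where H: "\<And>n. Cn_on n ?O H" "\<And>x. x \<in> ?O \<Longrightarrow> invertible (H x)"
    "\<And>x g. x \<in> ?O \<Longrightarrow> P c e (x, g) = P c' e' (snd c' (chart_inv c x), H x ** g)"
  proof -
    obtain H :: "'m \<Rightarrow> real^2^2" where "(\<forall>n. Cn_on n ?O H) \<and> (\<forall>x\<in>?O. invertible (H x) \<and>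
       (\<forall>g. P c e (x, g) = P c' e' (snd c' (chart_inv c x), H x ** g)))"
      using frame_transition[OF c c' U U'] by (elim exE)
    then show thesis by (intro that[of H]) blast+
  qed
  note open_O = open_overlap[OF c c' U U']
  have inO: "snd c' (chart_inv c x) \<in> cdom c' U'" if "x \<in> ?O" for x
    using that c by (auto simp: chart_inv_chart[OF atlas])
  have inv: "invertible (H x ** g)" if "x \<in> ?O" "invertible g" for x g
    using H(2)[OF that(1)] that(2) by (rule invertible_mult)
  obtain \<epsilon> :: real where eps: "\<epsilon> = 1 \<or> \<epsilon> = - 1" "g1 = \<epsilon> *\<^sub>R (H x0 ** g0)" "\<And>h. rho k (\<epsilon> *\<^sub>R h) = rho k h"
    using P_eq_imp[OF c' U' inO[OF x0O(1)] inv[OF x0O(1) x0(2)] x1] y1(2) H(3)[OF x0O(1)] by metis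
  define T :: "'m \<times> (real^2^2) \<Rightarrow> 'm \<times> (real^2^2)" where "T = (\<lambda>y. (snd c' (chart_inv c (fst y)), \<epsilon> *\<^sub>R (H (fst y) ** snd y)))"
  have T: "Cn_on n (?O \<times> UNIV) T" for n
  proof -
    have oOU: "open (?O \<times> (UNIV :: (real^2^2) set))" using open_O by (simp add: open_Times)
    have "Cn_on n (snd c ` (fst c \<inter> fst c')) (snd c' \<circ> chart_inv c)"
      using atlas c c' by (auto simp: smooth_atlas_def smooth_on_def)
    then have "Cn_on n ?O (\<lambda>x. snd c' (chart_inv c x))"
      by (auto intro: Cn_on_subset simp: o_def)
    from Cn_on_compose_linear[OF bounded_linear_fst open_O oOU _ this]
      Cn_on_compose_linear[OF bounded_linear_fst open_O oOU _ H(1)]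
    have 1: "Cn_on n (?O \<times> (UNIV :: (real^2^2) set)) (\<lambda>y. snd c' (chart_inv c (fst y)))"
      "Cn_on n (?O \<times> (UNIV :: (real^2^2) set)) (\<lambda>y. H (fst y))" by auto
    show ?thesis
      unfolding T_def using oOU
      by (intro Cn_on_Pair 1 Cn_on_bounded_linear[OF bounded_linear_scaleR_right] Cn_on_matrix_mult
          Cn_on_linear[OF bounded_linear_snd])
  qed
  define N where "N = W \<inter> {y \<in> ?O \<times> UNIV. T y \<in> W'}"
  have oN: "open N"
  proof -
    have "open ((?O \<times> UNIV) \<inter> T -` W')"
      using continuous_open_preimage[OF Cn_on_imp_continuous_on[OF T] _ W'(1)] open_O by (simp add: open_Times)
    moreover have "N = W \<inter> ((?O \<times> UNIV) \<inter> T -` W')" by (auto simp: N_def)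
    ultimately show ?thesis using W(1) by auto
  qed
  show ?thesis
  proof (intro exI[of _ N] exI[of _ T] conjI ballI allI)
    show "open N" by (rule oN)
    show "y0 \<in> N" using y0 x0O y1 eps(2) by (auto simp: N_def T_def y0e)
    show "N \<subseteq> W" by (auto simp: N_def)
    show "T y \<in> W'" if "y \<in> N" for y using that by (auto simp: N_def)
    show "Cn_on n N T" for n by (rule Cn_on_subset[OF T]) (auto simp: N_def)
    show "P c e y = P c' e' (T y)" if "y \<in> N" for y
    proof -
      obtain x g where y: "y = (x, g)" by force
      have x: "x \<in> ?O" "invertible g" using that W(2) by (auto simp: N_def y)
      have "invertible (\<epsilon> *\<^sub>R (H x ** g))"
        using that W'(2) by (auto simp: N_def T_def y)
      from P_sign[OF c' U' inO[OF x(1)] inv[OF x] this] eps(3) H(3)[OF x(1)]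
      show ?thesis by (simp add: T_def y)
    qed
  qed
qed

lemma BE_smooth_atlas: "smooth_atlas B AB"
  unfolding smooth_atlas_def
proof (intro conjI ballI)
  show "(\<Union>c\<in>AB. fst c) = B"
  proof (intro equalityI subsetI)
    fix q assume "q \<in> (\<Union>c\<in>AB. fst c)"
    then obtain d where d: "d \<in> AB" "q \<in> fst d" by blast
    obtain c U e W where *: "d = (P c e ` W, inv_into W (P c e))" "c \<in> A" "(U, e) \<in> vb_frames E" "open W"
      "W \<subseteq> cdom c U \<times> {g. invertible g}" "inj_on (P c e) W"
      by (rule BE_atlasE[OF d(1)])
    then show "q \<in> B" using d(2) P_in_BE[OF *(2,3)] by fastforce
  next
    fix q assume "q \<in> B"
    then obtain p xy where q: "q = frame_of k A s p xy" "p \<in> topspace X" "basis_of (vb_fibre E p) xy"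
      by (auto simp: BE_def)
    obtain c where c: "c \<in> A" "p \<in> fst c" using atlas q(2) unfolding smooth_atlas_def by blast
    obtain U e where U: "(U, e) \<in> vb_frames E" "p \<in> U" by (rule frame_cover[OF q(2)])
    obtain g where g: "invertible g" "xy = frame_act (e 0 p, e 1 p) g"
      using basis_of_change[OF frame_basis[OF U] q(3)] by blast
    have x: "snd c p \<in> cdom c U" using c U by auto
    have "q = P c e (snd c p, g)"
      using q(1) g(2) by (simp add: P_eq chart_inv_chart[OF atlas c])
    obtain W where "(snd c p, g) \<in> W" "(P c e ` W, inv_into W (P c e)) \<in> AB"
      by (rule BE_chart_exists[OF c(1) U(1) x g(1)])
    then show "q \<in> (\<Union>c\<in>AB. fst c)"
      using \<open>q = P c e (snd c p, g)\<close> by (intro UN_I) auto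
  qed
next
  fix d assume "d \<in> AB"
  obtain c U e W where *: "d = (P c e ` W, inv_into W (P c e))" "c \<in> A" "(U, e) \<in> vb_frames E" "open W"
    "W \<subseteq> cdom c U \<times> {g. invertible g}" "inj_on (P c e) W"
    by (rule BE_atlasE[OF \<open>d \<in> AB\<close>])
  show "inj_on (snd d) (fst d)" unfolding *(1) by (simp add: inj_on_inv_into)
  show "open (snd d ` fst d)" using BE_chart(1)[OF *(1,6)] *(4) by simp
next
  fix d d' assume "d \<in> AB" "d' \<in> AB"
  obtain c U e W where d: "d = (P c e ` W, inv_into W (P c e))" "c \<in> A" "(U, e) \<in> vb_frames E" "open W"
    "W \<subseteq> cdom c U \<times> {g. invertible g}" "inj_on (P c e) W"
    by (rule BE_atlasE[OF \<open>d \<in> AB\<close>])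
  obtain c' U' e' W' where d': "d' = (P c' e' ` W', inv_into W' (P c' e'))" "c' \<in> A" "(U', e') \<in> vb_frames E" "open W'"
    "W' \<subseteq> cdom c' U' \<times> {g. invertible g}" "inj_on (P c' e') W'"
    by (rule BE_atlasE[OF \<open>d' \<in> AB\<close>])
  have im: "snd d ` (fst d \<inter> fst d') = {y \<in> W. P c e y \<in> P c' e' ` W'}"
  proof (intro equalityI subsetI)
    fix y assume "y \<in> snd d ` (fst d \<inter> fst d')"
    then obtain q where q: "y = snd d q" "q \<in> fst d" "q \<in> fst d'" by blast
    have f: "fst d = P c e ` W" "fst d' = P c' e' ` W'" by (simp_all add: d(1) d'(1))
    from q(2) obtain z where z: "z \<in> W" "q = P c e z" unfolding f by blast
    then have "y = z" using q(1) BE_chart(3)[OF d(1,6)] by simp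
    then show "y \<in> {y \<in> W. P c e y \<in> P c' e' ` W'}" using z q(3) unfolding f by simp
  next
    fix y assume "y \<in> {y \<in> W. P c e y \<in> P c' e' ` W'}"
    then have "y = snd d (P c e y)" "P c e y \<in> fst d \<inter> fst d'"
      using BE_chart(3)[OF d(1,6)] by (simp_all add: d(1) d'(1))
    then show "y \<in> snd d ` (fst d \<inter> fst d')" by blast
  qed
  have local_conn: "\<exists>N. open N \<and> y \<in> N \<and> N \<subseteq> snd d ` (fst d \<inter> fst d') \<and> (\<forall>n. Cn_on n N (snd d' \<circ> chart_inv d))"
    if y: "y \<in> snd d ` (fst d \<inter> fst d')" for y
  proof -
    have y': "y \<in> W" "P c e y \<in> P c' e' ` W'" using y im by auto
    obtain N T where N: "open N" "y \<in> N" "N \<subseteq> W" "\<forall>y\<in>N. T y \<in> W' \<and> P c e y = P c' e' (T y)"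
      "\<forall>n. Cn_on n N T"
      using BE_transition[OF d(2,3,4,5) d'(2,3,4,5,6) y'] by (elim exE conjE)
    have eq: "T z = (snd d' \<circ> chart_inv d) z" if z: "z \<in> N" for z
    proof -
      have "z \<in> W" "T z \<in> W'" "P c e z = P c' e' (T z)" using z N(3,4) by auto
      then show ?thesis using BE_chart(2)[OF d(1,6)] BE_chart(3)[OF d'(1,6)] by simp
    qed
    have "Cn_on n N (snd d' \<circ> chart_inv d)" for n
      by (rule Cn_on_cong_open[OF N(1) eq]) (use N(5) in simp_all)
    moreover have "N \<subseteq> snd d ` (fst d \<inter> fst d')"
      unfolding im
    proof
      fix z assume "z \<in> N"
      then have "z \<in> W" "T z \<in> W'" "P c e z = P c' e' (T z)" using N(3,4) by auto
      then show "z \<in> {y \<in> W. P c e y \<in> P c' e' ` W'}" by simp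
    qed
    ultimately show ?thesis using N(1,2) by blast
  qed
  show "open (snd d ` (fst d \<inter> fst d'))"
    unfolding open_subopen[of "snd d ` (fst d \<inter> fst d')"] using local_conn by meson
  show "smooth_on (snd d ` (fst d \<inter> fst d')) (snd d' \<circ> chart_inv d)"
    unfolding smooth_on_def
  proof
    show "Cn_on n (snd d ` (fst d \<inter> fst d')) (snd d' \<circ> chart_inv d)" for n
    proof (rule Cn_on_local)
      show "\<exists>T. open T \<and> y \<in> T \<and> Cn_on n T (snd d' \<circ> chart_inv d)" if "y \<in> snd d ` (fst d \<inter> fst d')" for y
        using local_conn[OF that] by (elim exE conjE) (intro exI conjI, assumption+, erule spec)
    qed
  qed
qed

end

section \<open>The soldering form in coordinates\<close>

definition kapp :: "nat \<Rightarrow> kmatrix \<Rightarrow> (nat \<Rightarrow> real) \<Rightarrow> nat \<Rightarrow> real" where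
  "kapp k M w = (\<lambda>i. \<Sum>j\<le>k. M i j * w j)"

lemma kapp_kmult: "kapp k (kmult k M N) w = kapp k M (kapp k N w)"
proof -
  have "(\<Sum>j\<le>k. (\<Sum>l\<le>k. M i l * N l j) * w j) = (\<Sum>l\<le>k. M i l * (\<Sum>j\<le>k. N l j * w j))" for i
    unfolding sum_distrib_left sum_distrib_right by (subst sum.swap) (simp add: mult.assoc)
  then show ?thesis by (simp add: kapp_def kmult_def fun_eq_iff)
qed

lemma kapp_kone: "i \<le> k \<Longrightarrow> kapp k (kone k) w i = w i"
proof -
  assume "i \<le> k"
  then have "kapp k (kone k) w i = (\<Sum>j\<le>k. if j = i then w i else 0)"
    unfolding kapp_def by (intro sum.cong) (auto simp: kone_def)
  with \<open>i \<le> k\<close> show ?thesis by simp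
qed

lemma kapp_cong: "(\<And>j. j \<le> k \<Longrightarrow> w j = w' j) \<Longrightarrow> kapp k M w = kapp k M w'"
  by (simp add: kapp_def)

lemma kapp_add: "kapp k M (\<lambda>j. w j + w' j) i = kapp k M w i + kapp k M w' i"
  and kapp_diff: "kapp k M (\<lambda>j. w j - w' j) i = kapp k M w i - kapp k M w' i"
  by (simp_all add: kapp_def algebra_simps sum.distrib sum_subtractf)

lemma kapp_rho_inv:
  assumes "invertible g" "i \<le> k"
  shows "kapp k (rho k (matrix_inv g)) (kapp k (rho k g) w) i = w i"
    "kapp k (rho k g) (kapp k (rho k (matrix_inv g)) w) i = w i"
  using assms by (simp_all add: rho_matrix_inv kapp_kone flip: kapp_kmult)

lemma linear_kapp:
  assumes "\<And>j. linear (\<lambda>u. f u j)"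
  shows "linear (\<lambda>u. kapp k M (f u) i)"
  unfolding kapp_def
  by (rule linearI)
     (simp_all add: linear_add[OF assms] linear_scale[OF assms] algebra_simps sum.distrib sum_distrib_left)

lemma Cn_on_matrix_inv: "Cn_on n {g :: real^2^2. invertible g} matrix_inv"
proof (rule Cn_on_linear_solution[OF open_invertible, where F = "\<lambda>(g :: real^2^2) (h :: real^2^2). g ** h" and b = "\<lambda>_. mat 1"])
  show "linear (\<lambda>h :: real^2^2. g ** h)" for g :: "real^2^2"
    by (rule bounded_linear.linear[OF bounded_linear_matrix_mult_left])
  show "inj (\<lambda>h :: real^2^2. g ** h)" if "g \<in> {g. invertible g}" for g :: "real^2^2"
    using that by (intro inj_on_inverseI[of _ "\<lambda>h. matrix_inv g ** h"]) (simp add: matrix_mul_assoc matrix_inv_mult)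
  show "Cn_on n {g. invertible g} (\<lambda>g :: real^2^2. g ** u)" for u :: "real^2^2"
    by (rule Cn_on_linear[OF bounded_linear_matrix_mult_right])
  show "g ** matrix_inv g = mat 1" if "g \<in> {g. invertible g}" for g :: "real^2^2"
    using that by (simp add: matrix_inv_mult)
qed simp

lemma linear_coord_vec:
  "smooth_atlas S A \<Longrightarrow> c \<in> charts_at A p \<Longrightarrow> linear (coord_vec A c p)"
  by (intro linearI coord_vec_linear)

lemma linear_sum_scale: "linear f \<Longrightarrow> f (\<Sum>i\<in>I. w i *\<^sub>R v i) = (\<Sum>i\<in>I. w i *\<^sub>R f (v i))"
  by (simp only: linear_sum linear_scale)

sublocale gl2_structure \<subseteq> basis_enumeration k "basis_enum k :: nat \<Rightarrow> 'm"
  by unfold_locales (simp_all add: dim)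

context gl2_structure
begin

lemma theta_exists:
  assumes c: "c \<in> A" and U: "(U, e) \<in> vb_frames E"
  shows "\<exists>\<theta> :: 'm \<Rightarrow> 'm \<Rightarrow> nat \<Rightarrow> real. (\<forall>x j. linear (\<lambda>u. \<theta> x u j)) \<and>
    (\<forall>n u. \<forall>j\<le>k. Cn_on n (cdom c U) (\<lambda>x. \<theta> x u j)) \<and>
    (\<forall>x\<in>cdom c U. \<forall>u. s (chart_inv c x) (coord_vec A c (chart_inv c x) u) =
       (\<Sum>j\<le>k. \<theta> x u j *\<^sub>R sym_monom k (e 0 (chart_inv c x)) (e 1 (chart_inv c x)) j))"
proof -
  have iso: "\<forall>(U, e)\<in>vb_frames (tangent_bundle A). \<forall>(V, f)\<in>vb_frames (sym_power k E). \<exists>G.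
        (\<forall>i\<in>vb_index (sym_power k E). \<forall>j\<in>vb_index (tangent_bundle A). smooth_fun A (U \<inter> V) (G i j)) \<and>
        (\<forall>p\<in>U \<inter> V. \<forall>j\<in>vb_index (tangent_bundle A). s p (e j p) = (\<Sum>i\<in>vb_index (sym_power k E). G i j p *\<^sub>R f i p))"
    using struct_parts(5) unfolding vbundle_iso_def by (rule conjunct2)
  have m1: "(fst c, \<lambda>b p. coord_vec A c p b) \<in> vb_frames (tangent_bundle A)"
    using c by (simp add: tangent_bundle_def)
  have m2: "(U, \<lambda>i p. sym_monom k (e 0 p) (e 1 p) i) \<in> vb_frames (sym_power k E)"
    using U by (force simp: sym_power_def)
  have ix: "vb_index (sym_power k E) = {..k}" "vb_index (tangent_bundle A) = Basis"
    by (simp_all add: sym_power_def tangent_bundle_def)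
  obtain G where G: "\<forall>i\<in>{..k}. \<forall>j\<in>Basis. smooth_fun A (fst c \<inter> U) (G i j)"
    "\<forall>p\<in>fst c \<inter> U. \<forall>j\<in>Basis. s p (coord_vec A c p j) = (\<Sum>i\<le>k. G i j p *\<^sub>R sym_monom k (e 0 p) (e 1 p) i)"
    using iso[THEN bspec, OF m1, unfolded prod.case, THEN bspec, OF m2, unfolded prod.case ix] by (elim exE conjE)
  define \<theta> :: "'m \<Rightarrow> 'm \<Rightarrow> nat \<Rightarrow> real" where "\<theta> x u j = (\<Sum>b\<in>Basis. (u \<bullet> b) * G j b (chart_inv c x))" for x u j
  have 1: "linear (\<lambda>u. \<theta> x u j)" for x j
    unfolding \<theta>_def by (rule linearI) (simp_all add: inner_simps algebra_simps sum.distrib sum_distrib_left)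
  have 2: "Cn_on n (cdom c U) (\<lambda>x. \<theta> x u j)" if "j \<le> k" for n u j
  proof -
    have "Cn_on n (cdom c U) (\<lambda>x. G j b (chart_inv c x))" if "b \<in> Basis" for b
    proof -
      have "Cn_on n (snd c ` (fst c \<inter> U \<inter> fst c)) (G j b \<circ> chart_inv c)"
        using G(1) \<open>j \<le> k\<close> that c by (auto simp: smooth_fun_def smooth_on_def)
      moreover have "fst c \<inter> U \<inter> fst c = fst c \<inter> U" by auto
      ultimately show ?thesis by (simp add: o_def)
    qed
    then show ?thesis
      unfolding \<theta>_def by (intro Cn_on_sum Cn_on_mult Cn_on_const open_cdom[OF c U])
  qed
  have 3: "s (chart_inv c x) (coord_vec A c (chart_inv c x) u) =
       (\<Sum>j\<le>k. \<theta> x u j *\<^sub>R sym_monom k (e 0 (chart_inv c x)) (e 1 (chart_inv c x)) j)" if x: "x \<in> cdom c U" for x u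
  proof -
    let ?p = "chart_inv c x"
    note p = cdomD[OF c x]
    have "coord_vec A c ?p u = coord_vec A c ?p (\<Sum>b\<in>Basis. (u \<bullet> b) *\<^sub>R b)"
      by (simp add: euclidean_representation)
    also have "\<dots> = (\<Sum>b\<in>Basis. (u \<bullet> b) *\<^sub>R coord_vec A c ?p b)"
      by (rule linear_sum_scale[OF linear_coord_vec[OF atlas p(5)]])
    finally have "s ?p (coord_vec A c ?p u) = s ?p (\<Sum>b\<in>Basis. (u \<bullet> b) *\<^sub>R coord_vec A c ?p b)"
      by (rule arg_cong)
    also have "\<dots> = (\<Sum>b\<in>Basis. (u \<bullet> b) *\<^sub>R s ?p (coord_vec A c ?p b))"
      by (rule s_sum[OF p(4)]) (rule coord_vec_in_tangent_space[OF atlas p(5)])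
    also have "\<dots> = (\<Sum>b\<in>Basis. (u \<bullet> b) *\<^sub>R (\<Sum>i\<le>k. G i b ?p *\<^sub>R sym_monom k (e 0 ?p) (e 1 ?p) i))"
      using G(2) p(1,2) by (intro sum.cong) auto
    also have "\<dots> = (\<Sum>j\<le>k. \<theta> x u j *\<^sub>R sym_monom k (e 0 ?p) (e 1 ?p) j)"
      unfolding scaleR_sum_right \<theta>_def scaleR_sum_left scaleR_scaleR by (rule sum.swap)
    finally show ?thesis .
  qed
  show ?thesis using 1 2 3 by blast
qed

end

text \<open>A chart \<open>c\<close> of the base and a local frame \<open>e\<close> of \<open>E\<close> turn the isomorphism between the tangent bundle and the symmetric power
into a family of linear isomorphisms \<open>\<theta> x\<close> from the model space to \<open>H\<^sub>k\<close>, that is, into a coframe.\<close>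

locale gl2_chart = gl2_structure k X A E s
  for k and X :: "'a topology" and A :: "('a, 'm::euclidean_space) chart set"
    and E :: "('a, nat, 'v::real_vector) vbundle" and s +
  fixes c :: "('a, 'm) chart" and U :: "'a set" and e :: "nat \<Rightarrow> 'a \<Rightarrow> 'v"
    and \<theta> :: "'m \<Rightarrow> 'm \<Rightarrow> nat \<Rightarrow> real"
  assumes c: "c \<in> A" and U: "(U, e) \<in> vb_frames E"
    and linear_theta: "linear (\<lambda>u. \<theta> x u j)"
    and Cn_on_theta: "j \<le> k \<Longrightarrow> Cn_on n (snd c ` (fst c \<inter> U)) (\<lambda>x. \<theta> x u j)"
    and s_coord_vec: "x \<in> snd c ` (fst c \<inter> U) \<Longrightarrow> s (chart_inv c x) (coord_vec A c (chart_inv c x) u) =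
       (\<Sum>j\<le>k. \<theta> x u j *\<^sub>R sym_monom k (e 0 (chart_inv c x)) (e 1 (chart_inv c x)) j)"
begin

abbreviation "D \<equiv> cdom c U"
abbreviation "\<beta> \<equiv> basis_enum k :: nat \<Rightarrow> 'm"

lemma open_D: "open D" by (rule open_cdom[OF c U])

definition "Theta x u = (\<Sum>j\<le>k. \<theta> x u j *\<^sub>R \<beta> j)"

lemma linear_Theta: "linear (Theta x)"
  unfolding Theta_def
  by (intro linearI)
     (simp_all add: linear_add[OF linear_theta] linear_scale[OF linear_theta] scaleR_add_left sum.distrib
        scaleR_sum_right)

lemma inner_Theta: "j \<le> k \<Longrightarrow> Theta x u \<bullet> \<beta> j = \<theta> x u j"
  unfolding Theta_def by (rule inner_sum_basis_enum)

lemma theta_injective: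
  assumes "x \<in> D" "\<And>j. j \<le> k \<Longrightarrow> \<theta> x u j = \<theta> x v j"
  shows "u = v"
proof -
  let ?p = "chart_inv c x"
  note p = cdomD[OF c assms(1)]
  have "s ?p (coord_vec A c ?p u) = s ?p (coord_vec A c ?p v)"
    unfolding s_coord_vec[OF assms(1)] using assms(2) by (intro sum.cong) auto
  then have "coord_vec A c ?p u = coord_vec A c ?p v"
    using s_bij[OF p(4)] coord_vec_in_tangent_space[OF atlas p(5)] by (auto simp: bij_betw_def dest: inj_onD)
  then show ?thesis
    using coord_vec_self[OF atlas p(5)] by metis
qed

lemma inj_Theta: "x \<in> D \<Longrightarrow> inj (Theta x)"
  by (intro injI theta_injective) (auto simp flip: inner_Theta)

definition "dual x l = inv (Theta x) (\<beta> l)"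

lemma Theta_dual: "x \<in> D \<Longrightarrow> Theta x (dual x l) = \<beta> l"
  unfolding dual_def using linear_injective_imp_surjective[OF linear_Theta inj_Theta] by (simp add: surj_f_inv_f)

lemma theta_dual: "x \<in> D \<Longrightarrow> l \<le> k \<Longrightarrow> j \<le> k \<Longrightarrow> \<theta> x (dual x l) j = (if l = j then 1 else 0)"
  using inner_Theta[of j x "dual x l"] by (simp add: Theta_dual inner_basis_enum)

lemma theta_sum_dual:
  assumes "x \<in> D" "j \<le> k"
  shows "\<theta> x (\<Sum>l\<le>k. w l *\<^sub>R dual x l) j = w j"
proof -
  have "\<theta> x (\<Sum>l\<le>k. w l *\<^sub>R dual x l) j = (\<Sum>l\<le>k. w l *\<^sub>R \<theta> x (dual x l) j)"
    by (rule linear_sum_scale[OF linear_theta])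
  also have "\<dots> = (\<Sum>l\<le>k. if l = j then w j else 0)"
    using assms by (intro sum.cong) (auto simp: theta_dual)
  finally show ?thesis using assms by simp
qed

lemma dual_representation: "x \<in> D \<Longrightarrow> (\<Sum>l\<le>k. \<theta> x u l *\<^sub>R dual x l) = u"
  by (rule theta_injective, assumption) (rule theta_sum_dual)

lemma Cn_on_dual: "Cn_on n D (\<lambda>x. dual x l)"
proof (rule Cn_on_linear_solution[OF open_D, where F = Theta and b = "\<lambda>_. \<beta> l"])
  show "Cn_on n D (\<lambda>x. Theta x u)" for u
    unfolding Theta_def by (intro Cn_on_sum open_D Cn_on_scaleR_left Cn_on_theta) auto
qed (simp_all add: linear_Theta inj_Theta Theta_dual)

lemma frame_vector:
  assumes x: "x \<in> D" and g: "invertible g" and l: "l \<le> k"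
  shows "snd (P c e (x, g)) l = coord_vec A c (chart_inv c x) (\<Sum>i\<le>k. rho k g i l *\<^sub>R dual x i)"
proof -
  let ?p = "chart_inv c x"
  note p = cdomD[OF c x]
  have "s ?p (coord_vec A c ?p (\<Sum>i\<le>k. rho k g i l *\<^sub>R dual x i)) =
      (\<Sum>j\<le>k. rho k g j l *\<^sub>R sym_monom k (e 0 ?p) (e 1 ?p) j)"
    unfolding s_coord_vec[OF x] using theta_sum_dual[OF x] by (intro sum.cong) auto
  also have "\<dots> = smon (frame_act (e 0 ?p, e 1 ?p) g) l"
    by (simp only: sym_monom_frame_act[OF l] fst_conv snd_conv)
  finally have "inv_into (tangent_space A ?p) (s ?p) (smon (frame_act (e 0 ?p, e 1 ?p) g) l) =
      coord_vec A c ?p (\<Sum>i\<le>k. rho k g i l *\<^sub>R dual x i)"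
    using s_bij[OF p(4)] coord_vec_in_tangent_space[OF atlas p(5)]
    by (intro inv_into_f_eq) (auto simp: bij_betw_def)
  then show ?thesis
    using l by (simp add: P_eq frame_of_def)
qed

text \<open>The component \<open>\<omega>\<^sup>i\<close> of the soldering form at the point with coordinates \<open>y = (x, g)\<close>, as a function of the horizontal part
\<open>u\<close> of a tangent vector: \<open>\<omega> = \<rho>\<^sub>k(g)\<^sup>-\<^sup>1 \<theta>\<^sub>x(dx)\<close>, see \<open>soldering_eq\<close>.\<close>

definition "omega i y u = kapp k (rho k (matrix_inv (snd y))) (\<theta> (fst y) u) i"

lemma linear_omega: "linear (\<lambda>u. omega i y u)"
  unfolding omega_def by (rule linear_kapp[OF linear_theta])

definition "dtheta x u v j = frechet_derivative (\<lambda>x. \<theta> x u j) (at x) v"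

lemma rho_omega:
  assumes "invertible (snd y)" "i \<le> k"
  shows "kapp k (rho k (snd y)) (\<lambda>j. omega j y u) i = \<theta> (fst y) u i"
  using kapp_rho_inv(2)[OF assms, of "\<theta> (fst y) u"] by (simp add: omega_def)

end

locale gl2_BE_chart = gl2_chart k X A E s c U e \<theta>
  for k and X :: "'a topology" and A :: "('a, 'm::euclidean_space) chart set"
    and E :: "('a, nat, 'v::real_vector) vbundle" and s c U e \<theta> +
  fixes W :: "('m \<times> (real^2^2)) set"
  assumes open_W: "open W" and W: "W \<subseteq> snd c ` (fst c \<inter> U) \<times> {g. invertible g}"
    and inj_P: "inj_on (BE_param k A s c e) W"
begin

abbreviation "d \<equiv> (P c e ` W, inv_into W (P c e))"

lemma d_AB: "d \<in> AB"
  unfolding BE_atlas_def using c U open_W W inj_P by blast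

lemmas d_props = BE_chart[OF refl inj_P]

lemma WD: "y \<in> W \<Longrightarrow> fst y \<in> D" "y \<in> W \<Longrightarrow> invertible (snd y)"
  using W by auto

lemma d_at: "y \<in> W \<Longrightarrow> d \<in> charts_at AB (P c e y)"
  using d_AB by (simp add: charts_at_def)

lemma P_B: "y \<in> W \<Longrightarrow> P c e y \<in> B"
  using P_in_BE[OF c U, of "fst y" "snd y"] WD by simp

lemma coord_d: "y \<in> W \<Longrightarrow> coord_vec AB d (P c e y) z \<in> tangent_space AB (P c e y)"
  "y \<in> W \<Longrightarrow> coord_vec AB d (P c e y) z d = z"
  "y \<in> W \<Longrightarrow> v \<in> tangent_space AB (P c e y) \<Longrightarrow> coord_vec AB d (P c e y) (v d) = v"
  using coord_vec_in_tangent_space[OF BE_smooth_atlas d_at] coord_vec_self[OF BE_smooth_atlas d_at]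
    coord_vec_tangent[OF d_at] by auto

lemma tangent_map_fst:
  assumes y: "y \<in> W" and v: "v \<in> tangent_space AB (P c e y)"
  shows "tangent_map AB A fst (P c e y) v = coord_vec A c (chart_inv c (fst y)) (fst (v d))"
proof -
  have ev: "\<forall>\<^sub>F z in nhds y. z \<in> W" using open_W y by (rule eventually_nhds_in_open)
  have "tangent_map AB A fst (P c e y) v = coord_vec A c (fst (P c e y)) (fst (v d))"
  proof (rule tangent_map_eq[OF BE_smooth_atlas atlas d_at[OF y] _ _ _ v])
    show "c \<in> charts_at A (fst (P c e y))"
      using cdomD(5)[OF c WD(1)[OF y]] by (simp add: fst_P)
    show "\<forall>\<^sub>F z in nhds (snd d (P c e y)). fst (chart_inv d z) \<in> fst c"
      unfolding d_props(3)[OF y] using ev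
    proof eventually_elim
      case (elim z)
      show ?case
        unfolding d_props(2)[OF elim] fst_P by (rule cdomD(1)[OF c WD(1)[OF elim]])
    qed
    have "(fst has_derivative fst) (at y)"
      by (rule bounded_linear_imp_has_derivative[OF bounded_linear_fst])
    then show "((\<lambda>z. snd c (fst (chart_inv d z))) has_derivative fst) (at (snd d (P c e y)))"
      unfolding d_props(3)[OF y]
    proof (rule has_derivative_transform_within_open[OF _ open_W y])
      show "fst z = snd c (fst (chart_inv d z))" if "z \<in> W" for z
        unfolding d_props(2)[OF that] fst_P by (rule cdomD(3)[OF c WD(1)[OF that], symmetric])
    qed
  qed
  then show ?thesis by (simp only: fst_P)
qed

lemma soldering_eq:
  assumes y: "y \<in> W" and v: "v \<in> tangent_space AB (P c e y)" and i: "i \<le> k"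
  shows "soldering k A E s i (P c e y) v = omega i y (fst (v d))"
proof -
  let ?x = "fst y" and ?g = "snd y" and ?u = "fst (v d)" and ?p = "chart_inv c (fst y)"
  have x: "?x \<in> D" and g: "invertible ?g" using WD[OF y] by auto
  note ch = cdomD(5)[OF c x]
  have sum: "(\<Sum>l\<le>k. w l *\<^sub>R snd (P c e y) l) =
      coord_vec A c ?p (\<Sum>i\<le>k. kapp k (rho k ?g) w i *\<^sub>R dual ?x i)" for w
  proof -
    have "(\<Sum>l\<le>k. w l *\<^sub>R snd (P c e y) l) =
        (\<Sum>l\<le>k. w l *\<^sub>R coord_vec A c ?p (\<Sum>i\<le>k. rho k ?g i l *\<^sub>R dual ?x i))"
      using frame_vector[OF x g] unfolding prod.collapse
      by (intro sum.cong refl) (simp only: atMost_iff)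
    also have "\<dots> = coord_vec A c ?p (\<Sum>l\<le>k. w l *\<^sub>R (\<Sum>i\<le>k. rho k ?g i l *\<^sub>R dual ?x i))"
      by (rule linear_sum_scale[OF linear_coord_vec[OF atlas ch], symmetric])
    also have "(\<Sum>l\<le>k. w l *\<^sub>R (\<Sum>i\<le>k. rho k ?g i l *\<^sub>R dual ?x i)) = (\<Sum>i\<le>k. kapp k (rho k ?g) w i *\<^sub>R dual ?x i)"
      unfolding scaleR_sum_right kapp_def scaleR_sum_left scaleR_scaleR
      by (subst sum.swap) (simp only: mult.commute)
    finally show ?thesis .
  qed
  have "(THE w. (\<forall>l>k. w l = 0) \<and> tangent_map AB A fst (P c e y) v = (\<Sum>l\<le>k. w l *\<^sub>R snd (P c e y) l)) =
      (\<lambda>l. if l \<le> k then omega l y ?u else 0)" (is "_ = ?w")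
    unfolding tangent_map_fst[OF y v] sum
  proof (rule the_equality)
    have eq: "kapp k (rho k ?g) ?w i = \<theta> ?x ?u i" if "i \<le> k" for i
    proof -
      have "kapp k (rho k ?g) ?w = kapp k (rho k ?g) (\<lambda>j. omega j y ?u)"
        by (rule kapp_cong) (simp only: if_True)
      then show ?thesis by (simp only: rho_omega[OF g that])
    qed
    have "(\<Sum>i\<le>k. kapp k (rho k ?g) ?w i *\<^sub>R dual ?x i) = (\<Sum>i\<le>k. \<theta> ?x ?u i *\<^sub>R dual ?x i)"
      by (intro sum.cong refl) (simp only: atMost_iff eq)
    then have sum_u: "(\<Sum>i\<le>k. kapp k (rho k ?g) ?w i *\<^sub>R dual ?x i) = ?u"
      by (simp only: dual_representation[OF x])
    show "(\<forall>l>k. ?w l = 0) \<and> coord_vec A c ?p ?u = coord_vec A c ?p (\<Sum>i\<le>k. kapp k (rho k ?g) ?w i *\<^sub>R dual ?x i)"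
      unfolding sum_u by (intro conjI refl allI impI) (simp only: not_le[symmetric] if_False)
  next
    fix w assume w: "(\<forall>l>k. w l = 0) \<and> coord_vec A c ?p ?u = coord_vec A c ?p (\<Sum>i\<le>k. kapp k (rho k ?g) w i *\<^sub>R dual ?x i)"
    then have u: "?u = (\<Sum>i\<le>k. kapp k (rho k ?g) w i *\<^sub>R dual ?x i)"
    proof -
      have "coord_vec A c ?p ?u c = coord_vec A c ?p (\<Sum>i\<le>k. kapp k (rho k ?g) w i *\<^sub>R dual ?x i) c"
        by (rule fun_cong[OF conjunct2[OF w]])
      then show ?thesis by (simp only: coord_vec_self[OF atlas ch])
    qed
    have "w l = omega l y ?u" if l: "l \<le> k" for l
    proof -
      have "omega l y ?u = kapp k (rho k (matrix_inv ?g)) (kapp k (rho k ?g) w) l"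
        unfolding omega_def u by (rule fun_cong[OF kapp_cong]) (rule theta_sum_dual[OF x])
      then show ?thesis by (simp only: kapp_rho_inv(1)[OF g l])
    qed
    moreover have "w l = 0" if "\<not> l \<le> k" for l
      using w[THEN conjunct1] that by simp
    ultimately show "w = ?w" by (intro ext) (simp only: split: if_split, blast)
  qed
  from fun_cong[OF this, of i] show ?thesis
    unfolding soldering_def using i by (simp only: if_True)
qed

lemma form_coeff_soldering:
  assumes "y \<in> W" "i \<le> k"
  shows "form_coeff AB (soldering k A E s i) d z y = omega i y (fst z)"
  unfolding form_coeff_def d_props(2)[OF assms(1)]
  using soldering_eq[OF assms(1) coord_d(1)[OF assms(1), of z] assms(2)]
  unfolding coord_d(2)[OF assms(1)] .

lemma Cn_on_fst_W: "Cn_on n D f \<Longrightarrow> Cn_on n W (\<lambda>y. f (fst y))"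
  by (rule Cn_on_compose_linear[OF bounded_linear_fst open_D open_W]) (use W in auto)

lemma Cn_on_inv_W: "Cn_on n W (\<lambda>y. matrix_inv (snd y))"
  by (rule Cn_on_compose_linear[OF bounded_linear_snd open_invertible open_W _ Cn_on_matrix_inv]) (use W in auto)

lemma Cn_on_omega: "i \<le> k \<Longrightarrow> Cn_on n W (\<lambda>y. omega i y u)"
  unfolding omega_def kapp_def
  by (intro Cn_on_sum Cn_on_mult open_W Cn_on_rho Cn_on_inv_W Cn_on_fst_W Cn_on_theta) auto

text \<open>Obtained by differentiating \<open>\<theta>\<^sub>x(u) = \<rho>\<^sub>k(g) \<omega>(u)\<close>. The second term is the contribution of the flat connection
\<open>g\<^sup>-\<^sup>1 dg\<close>, which cancels in the torsion.\<close>

lemma frechet_omega: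
  assumes y: "y \<in> W" and i: "i \<le> k"
  shows "frechet_derivative (\<lambda>y. omega i y u) (at y) z =
    kapp k (rho k (matrix_inv (snd y))) (dtheta (fst y) u (fst z)) i
    - kapp k (drho k (matrix_inv (snd y) ** snd z)) (\<lambda>j. omega j y u) i"
proof -
  let ?g = "snd y" and ?x = "fst y"
  have x: "?x \<in> D" and g: "invertible ?g" using WD[OF y] by auto
  define O' where "O' j = frechet_derivative (\<lambda>y. omega j y u) (at y)" for j
  have O': "((\<lambda>y. omega j y u) has_derivative O' j) (at y)" if "j \<le> k" for j
    unfolding O'_def using Cn_on_omega[OF that, of "Suc 0" u] y by (rule Cn_on_has_derivative)
  have rel: "dtheta ?x u (fst z) l = kapp k (rho k ?g) (\<lambda>j. O' j z + kapp k (drho k (matrix_inv ?g ** snd z)) (\<lambda>j. omega j y u) j) l"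
    if l: "l \<le> k" for l
  proof -
    have "((\<lambda>y. \<Sum>j\<le>k. rho k (snd y) l j * omega j y u) has_derivative
       (\<lambda>z. \<Sum>j\<le>k. rho k ?g l j * O' j z + kmult k (rho k ?g) (drho k (matrix_inv ?g ** snd z)) l j * omega j y u)) (at y)"
      using diff_chain_at[OF bounded_linear_imp_has_derivative[OF bounded_linear_snd] has_derivative_rho[OF g]]
      by (intro has_derivative_sum has_derivative_mult O') (simp_all add: o_def)
    then have 1: "((\<lambda>y. \<theta> (fst y) u l) has_derivative
       (\<lambda>z. \<Sum>j\<le>k. rho k ?g l j * O' j z + kmult k (rho k ?g) (drho k (matrix_inv ?g ** snd z)) l j * omega j y u)) (at y)"
      by (rule has_derivative_transform_within_open[OF _ open_W y])
         (use rho_omega[OF WD(2) l] in \<open>simp add: kapp_def\<close>)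
    have 2: "((\<lambda>y. \<theta> (fst y) u l) has_derivative (\<lambda>z. dtheta ?x u (fst z) l)) (at y)"
      using diff_chain_at[OF bounded_linear_imp_has_derivative[OF bounded_linear_fst]
          Cn_on_has_derivative[OF Cn_on_theta[OF l, of "Suc 0" u] x]]
      by (simp add: o_def dtheta_def)
    have "dtheta ?x u (fst z) l = (\<Sum>j\<le>k. rho k ?g l j * O' j z + kmult k (rho k ?g) (drho k (matrix_inv ?g ** snd z)) l j * omega j y u)"
      using fun_cong[OF has_derivative_unique[OF 2 1], of z] .
    also have "\<dots> = kapp k (rho k ?g) (\<lambda>j. O' j z) l + kapp k (kmult k (rho k ?g) (drho k (matrix_inv ?g ** snd z))) (\<lambda>j. omega j y u) l"
      by (simp add: kapp_def sum.distrib)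
    finally show ?thesis
      by (simp add: kapp_kmult kapp_add)
  qed
  have "kapp k (rho k (matrix_inv ?g)) (dtheta ?x u (fst z)) i = kapp k (rho k (matrix_inv ?g))
      (kapp k (rho k ?g) (\<lambda>j. O' j z + kapp k (drho k (matrix_inv ?g ** snd z)) (\<lambda>j. omega j y u) j)) i"
    by (rule fun_cong[OF kapp_cong[OF rel]])
  also have "\<dots> = O' i z + kapp k (drho k (matrix_inv ?g ** snd z)) (\<lambda>j. omega j y u) i"
    by (rule kapp_rho_inv(1)[OF g i])
  finally show ?thesis by (simp add: O'_def)
qed

end

section \<open>Solving the torsion condition in a chart\<close>

lemma linear_ktrace_kmult_drho: "linear (\<lambda>a. ktrace k (kmult k (drho k a) N))"
  unfolding ktrace_def kmult_def
  by (rule linearI) (simp_all add: drho_add drho_scaleR algebra_simps sum.distrib sum_distrib_left)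

lemma ktrace_kmult_add: "ktrace k (kmult k M (\<lambda>i j. N i j + N' i j)) = ktrace k (kmult k M N) + ktrace k (kmult k M N')"
  and ktrace_kmult_diff: "ktrace k (kmult k M (\<lambda>i j. N i j - N' i j)) = ktrace k (kmult k M N) - ktrace k (kmult k M N')"
  and ktrace_kmult_scale: "ktrace k (kmult k M (\<lambda>i j. r * N i j)) = r * ktrace k (kmult k M N)"
  and ktrace_kmult_sum: "ktrace k (kmult k M (\<lambda>i j. \<Sum>l\<le>k. w l * F l i j)) = (\<Sum>l\<le>k. w l * ktrace k (kmult k M (F l)))"
proof -
  show "ktrace k (kmult k M (\<lambda>i j. \<Sum>l\<le>k. w l * F l i j)) = (\<Sum>l\<le>k. w l * ktrace k (kmult k M (F l)))"
  proof -
    have "ktrace k (kmult k M (\<lambda>i j. \<Sum>l\<le>k. w l * F l i j)) = (\<Sum>i\<le>k. \<Sum>m\<le>k. \<Sum>l\<le>k. w l * (M i m * F l m i))"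
      by (simp add: ktrace_def kmult_def sum_distrib_left mult_ac)
    also have "\<dots> = (\<Sum>i\<le>k. \<Sum>l\<le>k. \<Sum>m\<le>k. w l * (M i m * F l m i))"
      by (intro sum.cong refl sum.swap)
    also have "\<dots> = (\<Sum>l\<le>k. \<Sum>i\<le>k. \<Sum>m\<le>k. w l * (M i m * F l m i))"
      by (rule sum.swap)
    finally show ?thesis by (simp add: ktrace_def kmult_def sum_distrib_left)
  qed
qed (simp_all add: ktrace_def kmult_def algebra_simps sum.distrib sum_subtractf sum_distrib_left)

lemma kapp_drho_add: "kapp k (drho k (a + b)) w i = kapp k (drho k a) w i + kapp k (drho k b) w i"
  by (simp add: kapp_def drho_add algebra_simps sum.distrib)

lemma gk_perpD: "\<psi> \<in> gk_perp k \<Longrightarrow> ktrace k (kmult k (drho k a) \<psi>) = 0" "\<psi> \<in> gk_perp k \<Longrightarrow> ksupp k \<psi>"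
  by (auto simp: gk_perp_def gk_def ksupp_def)

lemma gk_perpI: "ksupp k \<psi> \<Longrightarrow> (\<And>a. ktrace k (kmult k (drho k a) \<psi>) = 0) \<Longrightarrow> \<psi> \<in> gk_perp k"
  by (auto simp: gk_perp_def gk_def ksupp_def)

context basis_enumeration
begin

text \<open>Linear maps \<open>H\<^sub>k \<rightarrow> gl(2)\<close> are encoded as \<open>2 \<times> 2\<close> matrices of vectors, so that they form a Euclidean space; this is the
value of such a map at the \<open>i\<close>-th basis vector.\<close>

definition at_basis :: "'m^2^2 \<Rightarrow> nat \<Rightarrow> real^2^2" where
  "at_basis \<alpha> i = (\<chi> r t. \<alpha> $ r $ t \<bullet> \<beta> i)"

lemma at_basis_eq_0:
  assumes "\<And>i. i \<le> k \<Longrightarrow> at_basis \<alpha> i = 0"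
  shows "\<alpha> = 0"
proof -
  have "\<alpha> $ r $ t \<bullet> \<beta> i = 0" if "i \<le> k" for r t i
    using assms[OF that] by (simp add: at_basis_def vec_eq_iff)
  then have "\<alpha> $ r $ t = 0" for r t
    using basis_enum_representation[of "\<alpha> $ r $ t"] by simp
  then show ?thesis by (simp add: vec_eq_iff)
qed

text \<open>Injectivity gives surjectivity, by equality of dimensions. The point is that the solution depends on the right-hand side
through a fixed linear map \<open>L\<close>, so that it inherits the smoothness of the data.\<close>

lemma spencer_surjective:
  assumes k: "k > 2"
  shows "\<exists>L :: 'm^2^2 \<Rightarrow> 'm^2^2. linear L \<and> (\<forall>R i a. i \<le> k \<longrightarrow>
    ktrace k (kmult k (drho k a) (spencer k (at_basis (L R)) i)) = (\<Sum>r\<in>UNIV. \<Sum>t\<in>UNIV. a $ r $ t * (R $ r $ t \<bullet> \<beta> i)))"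
proof -
  define \<tau> where "\<tau> a \<alpha> i = ktrace k (kmult k (drho k a) (spencer k (at_basis \<alpha>) i))" for a \<alpha> i
  define Em :: "2 \<Rightarrow> 2 \<Rightarrow> real^2^2" where "Em r t = axis r (axis t 1)" for r t
  define M :: "'m^2^2 \<Rightarrow> 'm^2^2" where "M \<alpha> = (\<chi> r t. \<Sum>i\<le>k. \<tau> (Em r t) \<alpha> i *\<^sub>R \<beta> i)" for \<alpha>
  have ab: "at_basis (\<alpha> + \<alpha>') i = at_basis \<alpha> i + at_basis \<alpha>' i" "at_basis (z *\<^sub>R \<alpha>) i = z *\<^sub>R at_basis \<alpha> i" for \<alpha> \<alpha>' i z
    by (simp_all add: at_basis_def vec_eq_iff inner_simps)
  have sp: "spencer k (at_basis (\<alpha> + \<alpha>')) i = (\<lambda>r c. spencer k (at_basis \<alpha>) i r c + spencer k (at_basis \<alpha>') i r c)"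
    "spencer k (at_basis (z *\<^sub>R \<alpha>)) i = (\<lambda>r c. z * spencer k (at_basis \<alpha>) i r c)" for \<alpha> \<alpha>' i z
    by (auto simp: spencer_def ab drho_add drho_scaleR fun_eq_iff algebra_simps)
  have \<tau>_lin: "\<tau> a (\<alpha> + \<alpha>') i = \<tau> a \<alpha> i + \<tau> a \<alpha>' i" "\<tau> a (z *\<^sub>R \<alpha>) i = z * \<tau> a \<alpha> i" for a \<alpha> \<alpha>' i z
    by (simp_all add: \<tau>_def sp ktrace_kmult_add ktrace_kmult_scale)
  have \<tau>_a: "\<tau> a \<alpha> i = (\<Sum>r\<in>UNIV. \<Sum>t\<in>UNIV. a $ r $ t * \<tau> (Em r t) \<alpha> i)" for a \<alpha> i
  proof -
    have "a = (\<Sum>r\<in>UNIV. \<Sum>t\<in>UNIV. a $ r $ t *\<^sub>R Em r t)"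
      by (simp add: vec_eq_iff Em_def axis_def forall_2 sum_2)
    then have "\<tau> a \<alpha> i = \<tau> (\<Sum>r\<in>UNIV. \<Sum>t\<in>UNIV. a $ r $ t *\<^sub>R Em r t) \<alpha> i" by metis
    also have "\<dots> = (\<Sum>r\<in>UNIV. \<Sum>t\<in>UNIV. a $ r $ t * \<tau> (Em r t) \<alpha> i)"
      unfolding \<tau>_def linear_sum[OF linear_ktrace_kmult_drho] linear_scale[OF linear_ktrace_kmult_drho] by simp
    finally show ?thesis .
  qed
  have M_inner: "M \<alpha> $ r $ t \<bullet> \<beta> i = \<tau> (Em r t) \<alpha> i" if "i \<le> k" for \<alpha> r t i
    unfolding M_def using inner_sum_basis_enum[OF that] by simp
  have "linear M"
    by (rule linearI) (simp_all add: M_def vec_eq_iff \<tau>_lin scaleR_add_left sum.distrib scaleR_sum_right)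
  moreover have "inj M"
  proof (subst linear_injective_0[OF \<open>linear M\<close>], intro allI impI)
    fix \<alpha> assume "M \<alpha> = 0"
    then have "\<tau> (Em r t) \<alpha> i = 0" if "i \<le> k" for r t i
      using M_inner[OF that, of \<alpha> r t] by simp
    then have "\<tau> a \<alpha> i = 0" if "i \<le> k" for a i
      using that by (simp add: \<tau>_a[of a])
    then have "at_basis \<alpha> i = 0" if "i \<le> k" for i
      using spencer_injective[OF k _ that, of "at_basis \<alpha>"] by (simp add: \<tau>_def)
    then show "\<alpha> = 0" by (rule at_basis_eq_0)
  qed
  ultimately obtain L where L: "linear L" "\<And>R. M (L R) = R"
    using linear_injective_isomorphism by blast
  have "\<tau> a (L R) i = (\<Sum>r\<in>UNIV. \<Sum>t\<in>UNIV. a $ r $ t * (R $ r $ t \<bullet> \<beta> i))" if "i \<le> k" for R i a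
    using M_inner[OF that, of "L R"] by (simp add: \<tau>_a[of a] L(2))
  then show ?thesis using L(1) unfolding \<tau>_def by blast
qed

end

context gl2_chart
begin

lemma theta_has_derivative: "x \<in> D \<Longrightarrow> j \<le> k \<Longrightarrow> ((\<lambda>x. \<theta> x u j) has_derivative (\<lambda>v. dtheta x u v j)) (at x)"
  using Cn_on_has_derivative[OF Cn_on_theta[of j "Suc 0" u]] by (simp add: dtheta_def)

lemma linear_dtheta_right: "x \<in> D \<Longrightarrow> j \<le> k \<Longrightarrow> linear (\<lambda>v. dtheta x u v j)"
  using has_derivative_linear[OF theta_has_derivative] .

lemma linear_dtheta_left:
  assumes "x \<in> D" "j \<le> k"
  shows "linear (\<lambda>u. dtheta x u v j)"
proof (rule linearI)
  fix u u' r
  have "((\<lambda>x. \<theta> x u j + \<theta> x u' j) has_derivative (\<lambda>v. dtheta x u v j + dtheta x u' v j)) (at x)"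
    by (intro has_derivative_add theta_has_derivative assms)
  then have "((\<lambda>x. \<theta> x (u + u') j) has_derivative (\<lambda>v. dtheta x u v j + dtheta x u' v j)) (at x)"
    by (simp add: linear_add[OF linear_theta])
  from fun_cong[OF has_derivative_unique[OF theta_has_derivative[OF assms] this]]
  show "dtheta x (u + u') v j = dtheta x u v j + dtheta x u' v j" .
  have "((\<lambda>x. r *\<^sub>R \<theta> x u j) has_derivative (\<lambda>v. r *\<^sub>R dtheta x u v j)) (at x)"
    by (intro has_derivative_scaleR_right theta_has_derivative assms)
  then have "((\<lambda>x. \<theta> x (r *\<^sub>R u) j) has_derivative (\<lambda>v. r *\<^sub>R dtheta x u v j)) (at x)"
    by (simp add: linear_scale[OF linear_theta])
  from fun_cong[OF has_derivative_unique[OF theta_has_derivative[OF assms] this]]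
  show "dtheta x (r *\<^sub>R u) v j = r *\<^sub>R dtheta x u v j" .
qed

lemma dtheta_expand:
  assumes "x \<in> D" "j \<le> k"
  shows "dtheta x (\<Sum>a\<in>I. w a *\<^sub>R p a) (\<Sum>b\<in>J. z b *\<^sub>R q b) j = (\<Sum>a\<in>I. \<Sum>b\<in>J. w a * z b * dtheta x (p a) (q b) j)"
  using linear_sum_scale[OF linear_dtheta_left[OF assms], of w p I] linear_sum_scale[OF linear_dtheta_right[OF assms], of _ z q J]
  by (simp add: sum_distrib_left mult_ac) (rule sum.swap)

lemma Cn_on_dtheta:
  assumes j: "j \<le> k" and p: "Cn_on n D p" and q: "Cn_on n D q"
  shows "Cn_on n D (\<lambda>x. dtheta x (p x) (q x) j)"
proof -
  have b: "Cn_on n D (\<lambda>x. dtheta x a b j)" for a b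
    using Cn_on_theta[OF j, of "Suc n" a] unfolding dtheta_def by simp
  have "Cn_on n D (\<lambda>x. \<Sum>a\<in>Basis. \<Sum>b\<in>Basis. (p x \<bullet> a) * (q x \<bullet> b) * dtheta x a b j)"
    by (intro Cn_on_sum Cn_on_mult Cn_on_inner_left open_D p q b)
  moreover have "(\<Sum>a\<in>Basis. \<Sum>b\<in>Basis. (p x \<bullet> a) * (q x \<bullet> b) * dtheta x a b j) = dtheta x (p x) (q x) j"
    if "x \<in> D" for x
    using dtheta_expand[OF that j, of "\<lambda>a. p x \<bullet> a" "\<lambda>a. a" Basis "\<lambda>b. q x \<bullet> b" "\<lambda>b. b" Basis]
    by (simp only: euclidean_representation)
  ultimately show ?thesis
    by (rule Cn_on_cong_open[OF open_D, rotated])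
qed

text \<open>The connection coefficients. In the frame dual to \<open>\<theta>\<close> the torsion of the flat connection has the
matrices \<open>tt\<close> below; by \<open>spencer_surjective\<close> there is \<open>\<alpha>\<close> whose Spencer differential corrects them to elements of
\<open>gk_perp\<close>. Both the torsion and \<open>gk_perp\<close> are linear, so that it suffices to treat the vectors of the
frame.\<close>

lemma gamma_exists:
  "\<exists>\<Gamma> :: 'm \<Rightarrow> 'm \<Rightarrow> real^2^2. (\<forall>x. linear (\<Gamma> x)) \<and> (\<forall>n u. Cn_on n D (\<lambda>x. \<Gamma> x u)) \<and>
    (\<forall>x\<in>D. \<forall>u. \<exists>\<psi>\<in>gk_perp k. \<forall>u'. \<forall>i\<le>k.
       dtheta x u' u i - dtheta x u u' i + kapp k (drho k (\<Gamma> x u)) (\<theta> x u') i - kapp k (drho k (\<Gamma> x u')) (\<theta> x u) i =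
       kapp k \<psi> (\<theta> x u') i)"
proof -
  obtain L :: "'m^2^2 \<Rightarrow> 'm^2^2" where L: "linear L" "\<And>R i a. i \<le> k \<Longrightarrow>
    ktrace k (kmult k (drho k a) (spencer k (at_basis (L R)) i)) = (\<Sum>r\<in>UNIV. \<Sum>t\<in>UNIV. a $ r $ t * (R $ r $ t \<bullet> \<beta> i))"
    using spencer_surjective[OF k] by blast
  define tt where "tt x i r c = (if r \<le> k \<and> c \<le> k then dtheta x (dual x c) (dual x i) r - dtheta x (dual x i) (dual x c) r else 0)"
    for x i r c
  define R :: "'m \<Rightarrow> 'm^2^2" where
    "R x = (\<chi> r t. \<Sum>i\<le>k. (- ktrace k (kmult k (drho k (axis r (axis t 1))) (tt x i))) *\<^sub>R \<beta> i)" for x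
  define \<alpha> where "\<alpha> x = at_basis (L (R x))" for x
  define \<Gamma> where "\<Gamma> x u = (\<Sum>i\<le>k. \<theta> x u i *\<^sub>R \<alpha> x i)" for x u
  have 1: "linear (\<Gamma> x)" for x
    unfolding \<Gamma>_def by (rule linearI)
      (simp_all add: linear_add[OF linear_theta] linear_scale[OF linear_theta] scaleR_add_left sum.distrib scaleR_sum_right)
  have tt: "Cn_on n D (\<lambda>x. tt x i r c)" for n i r c
    by (cases "r \<le> k \<and> c \<le> k") (auto simp: tt_def intro!: Cn_on_diff open_D Cn_on_dtheta Cn_on_dual)
  have "Cn_on n D R" for n
  proof (rule Cn_on_componentwise[OF open_D])
    fix b :: "'m^2^2" assume "b \<in> Basis"
    then obtain r t b' where b: "b = axis r (axis t b')" by (auto simp: Basis_vec_def)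
    show "Cn_on n D (\<lambda>x. R x \<bullet> b)"
      unfolding b R_def inner_axis vec_lambda_beta ktrace_def kmult_def
      by (intro Cn_on_inner_left Cn_on_sum Cn_on_scaleR_left Cn_on_minus Cn_on_mult Cn_on_const open_D tt)
  qed
  from Cn_on_bounded_linear[OF _ open_D this] L(1) have LR: "Cn_on n D (\<lambda>x. L (R x))" for n
    by (simp add: linear_conv_bounded_linear)
  have "Cn_on n D (\<lambda>x. \<alpha> x i)" for n i
  proof (rule Cn_on_componentwise[OF open_D])
    fix b :: "real^2^2" assume "b \<in> Basis"
    then obtain r t where b: "b = axis r (axis t 1)" by (auto simp: Basis_vec_def)
    have bl: "bounded_linear (\<lambda>m :: 'm^2^2. m $ r $ t)"
      by (rule bounded_linear_compose[OF bounded_linear_vec_nth bounded_linear_vec_nth])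
    have "\<alpha> x i \<bullet> b = L (R x) $ r $ t \<bullet> \<beta> i" for x
      by (simp add: b inner_axis \<alpha>_def at_basis_def)
    then show "Cn_on n D (\<lambda>x. \<alpha> x i \<bullet> b)"
      using Cn_on_inner_left[OF open_D Cn_on_bounded_linear[OF bl open_D LR]] by presburger
  qed
  then have 2: "Cn_on n D (\<lambda>x. \<Gamma> x u)" for n u
    unfolding \<Gamma>_def by (intro Cn_on_sum Cn_on_scaleR open_D Cn_on_theta) auto
  have perp: "(\<lambda>r c. tt x i r c + spencer k (\<alpha> x) i r c) \<in> gk_perp k" if i: "i \<le> k" for x i
  proof (rule gk_perpI)
    show "ksupp k (\<lambda>r c. tt x i r c + spencer k (\<alpha> x) i r c)"
      by (auto simp: ksupp_def tt_def spencer_def)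
    fix a :: "real^2^2"
    have "ktrace k (kmult k (drho k a) (spencer k (\<alpha> x) i)) =
        - (\<Sum>r\<in>UNIV. \<Sum>t\<in>UNIV. a $ r $ t * ktrace k (kmult k (drho k (axis r (axis t 1))) (tt x i)))"
      unfolding \<alpha>_def L(2)[OF i] R_def vec_lambda_beta inner_sum_basis_enum[OF i] by (simp add: sum_negf)
    also have "(\<Sum>r\<in>UNIV. \<Sum>t\<in>UNIV. a $ r $ t * ktrace k (kmult k (drho k (axis r (axis t 1))) (tt x i))) =
        ktrace k (kmult k (drho k (\<Sum>r\<in>UNIV. \<Sum>t\<in>UNIV. a $ r $ t *\<^sub>R axis r (axis t 1))) (tt x i))"
      unfolding linear_sum[OF linear_ktrace_kmult_drho] linear_scale[OF linear_ktrace_kmult_drho] by simp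
    also have "(\<Sum>r\<in>UNIV. \<Sum>t\<in>UNIV. a $ r $ t *\<^sub>R axis r (axis t 1)) = a"
      by (simp add: vec_eq_iff axis_def forall_2 sum_2)
    finally show "ktrace k (kmult k (drho k a) (\<lambda>r c. tt x i r c + spencer k (\<alpha> x) i r c)) = 0"
      by (simp add: ktrace_kmult_add)
  qed
  have 3: "\<exists>\<psi>\<in>gk_perp k. \<forall>u'. \<forall>i\<le>k.
       dtheta x u' u i - dtheta x u u' i + kapp k (drho k (\<Gamma> x u)) (\<theta> x u') i - kapp k (drho k (\<Gamma> x u')) (\<theta> x u) i =
       kapp k \<psi> (\<theta> x u') i" if x: "x \<in> D" for x u
  proof (intro bexI allI impI)
    let ?\<psi> = "\<lambda>r c. \<Sum>i\<le>k. \<theta> x u i * (tt x i r c + spencer k (\<alpha> x) i r c)"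
    show "?\<psi> \<in> gk_perp k"
    proof (rule gk_perpI)
      show "ksupp k ?\<psi>" by (auto simp: ksupp_def tt_def spencer_def)
      show "ktrace k (kmult k (drho k a) ?\<psi>) = 0" for a
        unfolding ktrace_kmult_sum using gk_perpD(1)[OF perp] by simp
    qed
    fix u' r assume r: "r \<le> k"
    have t: "dtheta x u' u r - dtheta x u u' r = (\<Sum>c\<le>k. \<Sum>i\<le>k. \<theta> x u i * tt x i r c * \<theta> x u' c)"
    proof -
      have "dtheta x u' u r = (\<Sum>c\<le>k. \<Sum>i\<le>k. \<theta> x u' c * \<theta> x u i * dtheta x (dual x c) (dual x i) r)"
        using dtheta_expand[OF x r, of "\<theta> x u'" "dual x" "{..k}" "\<theta> x u" "dual x" "{..k}"]
        by (simp only: dual_representation[OF x])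
      moreover have "dtheta x u u' r = (\<Sum>i\<le>k. \<Sum>c\<le>k. \<theta> x u i * \<theta> x u' c * dtheta x (dual x i) (dual x c) r)"
        using dtheta_expand[OF x r, of "\<theta> x u" "dual x" "{..k}" "\<theta> x u'" "dual x" "{..k}"]
        by (simp only: dual_representation[OF x])
      moreover have "\<dots> = (\<Sum>c\<le>k. \<Sum>i\<le>k. \<theta> x u i * \<theta> x u' c * dtheta x (dual x i) (dual x c) r)"
        by (rule sum.swap)
      ultimately have "dtheta x u' u r - dtheta x u u' r = (\<Sum>c\<le>k. \<Sum>i\<le>k.
          \<theta> x u' c * \<theta> x u i * dtheta x (dual x c) (dual x i) r - \<theta> x u i * \<theta> x u' c * dtheta x (dual x i) (dual x c) r)"
        by (simp only: sum_subtractf)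
      also have "\<dots> = (\<Sum>c\<le>k. \<Sum>i\<le>k. \<theta> x u i * tt x i r c * \<theta> x u' c)"
        using r by (intro sum.cong refl) (simp add: tt_def algebra_simps)
      finally show ?thesis .
    qed
    have d: "drho k (\<Gamma> x v) r c = (\<Sum>i\<le>k. \<theta> x v i * drho k (\<alpha> x i) r c)" for v c
      unfolding \<Gamma>_def using linear_sum_scale[OF linear_drho] by simp
    have "kapp k (drho k (\<Gamma> x u)) (\<theta> x u') r - kapp k (drho k (\<Gamma> x u')) (\<theta> x u) r =
        (\<Sum>c\<le>k. \<Sum>i\<le>k. \<theta> x u i * drho k (\<alpha> x i) r c * \<theta> x u' c) -
        (\<Sum>i\<le>k. \<Sum>c\<le>k. \<theta> x u i * drho k (\<alpha> x c) r i * \<theta> x u' c)"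
      by (simp add: kapp_def d sum_distrib_left sum_distrib_right mult_ac)
    also have "(\<Sum>i\<le>k. \<Sum>c\<le>k. \<theta> x u i * drho k (\<alpha> x c) r i * \<theta> x u' c) =
        (\<Sum>c\<le>k. \<Sum>i\<le>k. \<theta> x u i * drho k (\<alpha> x c) r i * \<theta> x u' c)"
      by (rule sum.swap)
    also have "(\<Sum>c\<le>k. \<Sum>i\<le>k. \<theta> x u i * drho k (\<alpha> x i) r c * \<theta> x u' c) - \<dots> =
        (\<Sum>c\<le>k. \<Sum>i\<le>k. \<theta> x u i * spencer k (\<alpha> x) i r c * \<theta> x u' c)"
      unfolding sum_subtractf[symmetric] using r by (intro sum.cong refl) (simp add: spencer_def algebra_simps)
    finally have "dtheta x u' u r - dtheta x u u' r + (kapp k (drho k (\<Gamma> x u)) (\<theta> x u') r - kapp k (drho k (\<Gamma> x u')) (\<theta> x u) r) =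
        (\<Sum>c\<le>k. \<Sum>i\<le>k. \<theta> x u i * tt x i r c * \<theta> x u' c) + (\<Sum>c\<le>k. \<Sum>i\<le>k. \<theta> x u i * spencer k (\<alpha> x) i r c * \<theta> x u' c)"
      unfolding t by simp
    also have "\<dots> = kapp k ?\<psi> (\<theta> x u') r"
      unfolding sum.distrib[symmetric] kapp_def sum_distrib_right by (intro sum.cong refl) (simp add: algebra_simps)
    finally show "dtheta x u' u r - dtheta x u u' r + kapp k (drho k (\<Gamma> x u)) (\<theta> x u') r - kapp k (drho k (\<Gamma> x u')) (\<theta> x u) r =
       kapp k ?\<psi> (\<theta> x u') r" by (simp add: algebra_simps)
  qed
  show ?thesis using 1 2 3 by blast
qed

end

section \<open>The pointwise characterisation of the connection\<close>

lemma matrix_inv_eqI: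
  fixes g h :: "real^2^2"
  assumes "g ** h = mat 1"
  shows "matrix_inv g = h"
proof -
  have g: "invertible g" using assms by (auto simp: invertible_right_inverse)
  have "matrix_inv g = matrix_inv g ** (g ** h)" by (simp add: assms)
  also have "\<dots> = h" by (simp add: matrix_mul_assoc matrix_inv_mult[OF g])
  finally show ?thesis .
qed

lemma matrix_inv_matrix_mult:
  fixes g h :: "real^2^2"
  assumes "invertible g" "invertible h"
  shows "matrix_inv (h ** g) = matrix_inv g ** matrix_inv h"
proof (rule matrix_inv_eqI)
  have "h ** g ** (matrix_inv g ** matrix_inv h) = h ** (g ** matrix_inv g) ** matrix_inv h"
    by (simp only: matrix_mul_assoc)
  then show "h ** g ** (matrix_inv g ** matrix_inv h) = mat 1"
    using matrix_inv_mult assms by simp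
qed

lemma linear_on_space_sum:
  assumes f: "linear_on_space V f" and V: "subspace V" and v: "\<And>i. i \<in> I \<Longrightarrow> v i \<in> V"
  shows "f (\<Sum>i\<in>I. w i *\<^sub>R v i) = (\<Sum>i\<in>I. w i *\<^sub>R f (v i))"
  using v
proof (induction I rule: infinite_finite_induct)
  case (insert i I)
  have 1: "w i *\<^sub>R v i \<in> V" "(\<Sum>i\<in>I. w i *\<^sub>R v i) \<in> V"
    using insert by (auto intro!: subspace_scale[OF V] subspace_sum[OF V])
  then have "f (w i *\<^sub>R v i + (\<Sum>i\<in>I. w i *\<^sub>R v i)) = w i *\<^sub>R f (v i) + f (\<Sum>i\<in>I. w i *\<^sub>R v i)"
    using f insert.prems unfolding linear_on_space_def by simp
  moreover have "f (\<Sum>i\<in>I. w i *\<^sub>R v i) = (\<Sum>i\<in>I. w i *\<^sub>R f (v i))"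
    using insert by blast
  ultimately show ?case unfolding sum.insert[OF insert.hyps] by (simp only:)
next
  case (infinite I)
  have "f (0 *\<^sub>R 0) = 0 *\<^sub>R f 0" using f V unfolding linear_on_space_def by (metis subspace_0)
  with infinite show ?case by simp
next
  case empty
  have "f (0 *\<^sub>R 0) = 0 *\<^sub>R f 0" using f V unfolding linear_on_space_def by (metis subspace_0)
  then show ?case by simp
qed

lemma linear_on_space_diff:
  "linear_on_space V f \<Longrightarrow> subspace V \<Longrightarrow> u \<in> V \<Longrightarrow> v \<in> V \<Longrightarrow> f (u - v) = f u - (f v :: 'b::real_vector)"
  using subspace_scale[of V v "-1"]
  by (simp only: linear_on_space_def diff_conv_add_uminus[of u v] scaleR_minus1_left[symmetric, of v])
     (metis (no_types, lifting) diff_conv_add_uminus scaleR_minus1_left)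

context gl2_structure
begin

abbreviation "T \<equiv> tangent_space AB"

lemma subspace_T: "subspace (T q)"
  by (rule subspace_tangent_space[OF BE_smooth_atlas])

lemma gl2_chart_exists:
  assumes "c \<in> A" "(U, e) \<in> vb_frames E"
  obtains \<theta> where "gl2_chart k X A E s c U e \<theta>"
proof -
  obtain \<theta> :: "'m \<Rightarrow> 'm \<Rightarrow> nat \<Rightarrow> real" where t: "\<forall>x j. linear (\<lambda>u. \<theta> x u j)"
    "\<forall>n u. \<forall>j\<le>k. Cn_on n (cdom c U) (\<lambda>x. \<theta> x u j)"
    "\<forall>x\<in>cdom c U. \<forall>u. s (chart_inv c x) (coord_vec A c (chart_inv c x) u) =
       (\<Sum>j\<le>k. \<theta> x u j *\<^sub>R sym_monom k (e 0 (chart_inv c x)) (e 1 (chart_inv c x)) j)"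
    using theta_exists[OF assms] by (elim exE conjE)
  have "gl2_chart k X A E s c U e \<theta>"
    by (intro gl2_chart.intro gl2_chart_axioms.intro gl2_structure_axioms) (use assms t in \<open>simp_all only:\<close>)
  then show thesis by (rule that)
qed

lemma BE_chart_cases:
  assumes "d \<in> AB"
  obtains c U e \<theta> W where "gl2_BE_chart k X A E s c U e \<theta> W" "d = (P c e ` W, inv_into W (P c e))"
proof -
  obtain c U e W where d: "d = (P c e ` W, inv_into W (P c e))" "c \<in> A" "(U, e) \<in> vb_frames E" "open W"
    "W \<subseteq> cdom c U \<times> {g. invertible g}" "inj_on (P c e) W"
    by (rule BE_atlasE[OF assms])
  obtain \<theta> where "gl2_chart k X A E s c U e \<theta>"
    by (rule gl2_chart_exists[OF d(2,3)])
  then have "gl2_BE_chart k X A E s c U e \<theta> W"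
    using d(4-6) by (simp add: gl2_BE_chart_def gl2_BE_chart_axioms_def)
  then show thesis using d(1) by (rule that)
qed

lemma BE_point_cases:
  assumes "q \<in> B"
  obtains c U e \<theta> W y where "gl2_BE_chart k X A E s c U e \<theta> W" "y \<in> W" "q = P c e y"
proof -
  have "(\<Union>d\<in>AB. fst d) = B" using BE_smooth_atlas unfolding smooth_atlas_def by (rule conjunct1)
  with assms obtain d where d: "d \<in> AB" "q \<in> fst d" by blast
  obtain c U e \<theta> W where l: "gl2_BE_chart k X A E s c U e \<theta> W" and de: "d = (P c e ` W, inv_into W (P c e))"
    by (rule BE_chart_cases[OF d(1)])
  from d(2) obtain y where "y \<in> W" "q = P c e y" unfolding de fst_conv by blast
  with l show thesis by (rule that)
qed

text \<open>The conditions of the theorem at a single point \<open>q\<close>, for the value \<open>f\<close> of the connection form there. They make sense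
because the torsion at \<open>q\<close> depends on the connection form through its value at \<open>q\<close> only.\<close>

definition "adapted q f \<longleftrightarrow> linear_on_space (T q) f \<and> (\<forall>a. f (fundamental_vec k AB a q) = a) \<and>
  (\<forall>v\<in>T q. \<exists>\<psi>\<in>gk_perp k. torsion_endo k A E s (\<lambda>_. f) q v \<psi>)"

end

text \<open>The form \<open>g\<^sup>-\<^sup>1 dg + g\<^sup>-\<^sup>1 \<Gamma>\<^sub>x(dx) g\<close> in the coordinates \<open>y = (x, g)\<close>, evaluated on the coordinate vector \<open>z\<close>.\<close>

definition local_conn :: "('m \<Rightarrow> 'm::euclidean_space \<Rightarrow> real^2^2) \<Rightarrow> 'm \<times> (real^2^2) \<Rightarrow> 'm \<times> (real^2^2) \<Rightarrow> real^2^2" where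
  "local_conn \<Gamma> y z = matrix_inv (snd y) ** snd z + matrix_inv (snd y) ** (\<Gamma> (fst y) (fst z) ** snd y)"

context gl2_chart
begin

text \<open>The third condition is the torsion condition at the points \<open>(x, 1)\<close>.\<close>

definition "coefficients \<Gamma> \<longleftrightarrow> (\<forall>x. linear (\<Gamma> x)) \<and> (\<forall>n u. Cn_on n D (\<lambda>x. \<Gamma> x u)) \<and>
    (\<forall>x\<in>D. \<forall>u. \<exists>\<psi>\<in>gk_perp k. \<forall>u'. \<forall>i\<le>k.
       dtheta x u' u i - dtheta x u u' i + kapp k (drho k (\<Gamma> x u)) (\<theta> x u') i - kapp k (drho k (\<Gamma> x u')) (\<theta> x u) i =
       kapp k \<psi> (\<theta> x u') i)"

lemma coefficients_exist: "\<exists>\<Gamma>. coefficients \<Gamma>"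
  unfolding coefficients_def by (rule gamma_exists)

end

context gl2_BE_chart
begin

lemma soldering_linear:
  assumes y: "y \<in> W" and i: "i \<le> k"
  shows "linear_on_space (T (P c e y)) (soldering k A E s i (P c e y))"
  unfolding linear_on_space_def
proof (intro conjI ballI allI)
  fix u v r assume u: "u \<in> T (P c e y)"
  have "soldering k A E s i (P c e y) (r *\<^sub>R u) = omega i y (fst ((r *\<^sub>R u) d))"
    by (rule soldering_eq[OF y subspace_scale[OF subspace_T u] i])
  also have "(r *\<^sub>R u) d = r *\<^sub>R u d" by (simp only: scaleR_fun_def)
  finally show "soldering k A E s i (P c e y) (r *\<^sub>R u) = r *\<^sub>R soldering k A E s i (P c e y) u"
    by (simp only: soldering_eq[OF y u i] fst_scaleR linear_scale[OF linear_omega])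
  assume v: "v \<in> T (P c e y)"
  have "soldering k A E s i (P c e y) (u + v) = omega i y (fst ((u + v) d))"
    by (rule soldering_eq[OF y subspace_add[OF subspace_T u v] i])
  then show "soldering k A E s i (P c e y) (u + v) = soldering k A E s i (P c e y) u + soldering k A E s i (P c e y) v"
    by (simp only: plus_fun_apply soldering_eq[OF y u i] soldering_eq[OF y v i] fst_add linear_add[OF linear_omega])
qed

lemma Cn_on_form_coeff_soldering:
  assumes "i \<le> k"
  shows "Cn_on n (snd d ` fst d) (form_coeff AB (soldering k A E s i) d z)"
  unfolding d_props(1)
  by (rule Cn_on_cong_open[OF open_W _ Cn_on_omega[OF assms, of n "fst z"]])
     (rule form_coeff_soldering[OF _ assms, symmetric])

end

context gl2_structure
begin

lemma ext_deriv_soldering: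
  assumes i: "i \<le> k" and d: "d \<in> charts_at AB q" and v: "v \<in> T q" and w: "w \<in> T q"
  shows "ext_deriv AB (soldering k A E s i) q v w =
    frechet_derivative (form_coeff AB (soldering k A E s i) d (w d)) (at (snd d q)) (v d) -
    frechet_derivative (form_coeff AB (soldering k A E s i) d (v d)) (at (snd d q)) (w d)"
proof (rule ext_deriv_eq[OF BE_smooth_atlas _ _ d v w])
  fix q assume "q \<in> B"
  then obtain c U e \<theta> W y where l: "gl2_BE_chart k X A E s c U e \<theta> W" and "y \<in> W" "q = P c e y"
    by (rule BE_point_cases)
  then show "linear_on_space (T q) (soldering k A E s i q)"
    using gl2_BE_chart.soldering_linear[OF l _ i] by simp
next
  fix d u assume "d \<in> AB"
  then obtain c U e \<theta> W where l: "gl2_BE_chart k X A E s c U e \<theta> W" and d: "d = (P c e ` W, inv_into W (P c e))"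
    by (rule BE_chart_cases)
  show "Cn_on (Suc 0) (snd d ` fst d) (form_coeff AB (soldering k A E s i) d u)"
    unfolding d by (rule gl2_BE_chart.Cn_on_form_coeff_soldering[OF l i])
qed

end

context gl2_BE_chart
begin

lemma frechet_form_coeff_soldering:
  assumes y: "y \<in> W" and i: "i \<le> k"
  shows "frechet_derivative (form_coeff AB (soldering k A E s i) d z) (at y) =
    frechet_derivative (\<lambda>y. omega i y (fst z)) (at y)"
proof (rule frechet_derivative_transform_within_open[symmetric, OF _ open_W y])
  show "(\<lambda>y. omega i y (fst z)) differentiable at y"
    using Cn_on_has_derivative[OF Cn_on_omega[OF i, of "Suc 0"] y] by (rule differentiableI)
  show "omega i x (fst z) = form_coeff AB (soldering k A E s i) d z x" if "x \<in> W" for x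
    by (rule form_coeff_soldering[OF that i, symmetric])
qed

lemma ext_deriv_soldering_eq:
  assumes y: "y \<in> W" and i: "i \<le> k" and v: "v \<in> T (P c e y)" and w: "w \<in> T (P c e y)"
  shows "ext_deriv AB (soldering k A E s i) (P c e y) v w =
    kapp k (rho k (matrix_inv (snd y))) (dtheta (fst y) (fst (w d)) (fst (v d))) i
    - kapp k (drho k (matrix_inv (snd y) ** snd (v d))) (\<lambda>j. omega j y (fst (w d))) i
    - (kapp k (rho k (matrix_inv (snd y))) (dtheta (fst y) (fst (v d)) (fst (w d))) i
    - kapp k (drho k (matrix_inv (snd y) ** snd (w d))) (\<lambda>j. omega j y (fst (v d))) i)"
  unfolding ext_deriv_soldering[OF i d_at[OF y] v w] d_props(3)[OF y]
    frechet_form_coeff_soldering[OF y i] frechet_omega[OF y i] ..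

lemma torsion_eq:
  assumes y: "y \<in> W" and i: "i \<le> k" and v: "v \<in> T (P c e y)" and w: "w \<in> T (P c e y)"
  shows "torsion k A E s \<phi> i (P c e y) v w = ext_deriv AB (soldering k A E s i) (P c e y) v w +
    kapp k (drho k (\<phi> (P c e y) v)) (\<lambda>j. omega j y (fst (w d))) i
    - kapp k (drho k (\<phi> (P c e y) w)) (\<lambda>j. omega j y (fst (v d))) i"
proof -
  have "(\<Sum>j\<le>k. drho k (\<phi> (P c e y) v) i j * soldering k A E s j (P c e y) w -
             drho k (\<phi> (P c e y) w) i j * soldering k A E s j (P c e y) v) =
     (\<Sum>j\<le>k. drho k (\<phi> (P c e y) v) i j * omega j y (fst (w d)) - drho k (\<phi> (P c e y) w) i j * omega j y (fst (v d)))"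
    by (intro sum.cong refl) (simp only: atMost_iff soldering_eq[OF y v] soldering_eq[OF y w])
  then show ?thesis
    unfolding torsion_def kapp_def by (simp only: sum_subtractf add_diff_eq)
qed

text \<open>In the coordinates \<open>(x, g)\<close> the group acts by right multiplication on \<open>g\<close>.\<close>

lemma fundamental_vec_eq:
  assumes y: "y \<in> W"
  shows "fundamental_vec k AB a (P c e y) = coord_vec AB d (P c e y) (0, snd y ** a)"
proof -
  obtain x g where ye: "y = (x, g)" by force
  have xg: "x \<in> D" "invertible g" using WD[OF y] by (simp_all add: ye)
  have m1: "invertible (mat 1 :: real^2^2)" by (simp add: invertible_det_nz)
  have q: "BE_act k (mat 1) (P c e y) = P c e y"
    unfolding ye using BE_act_P[OF c U xg m1] by (simp only: matrix_mul_rid)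
  have "open {h. (x, g ** h) \<in> W}"
    using open_W bounded_linear.continuous_on[OF bounded_linear_matrix_mult_left continuous_on_id, of UNIV g]
    by (auto intro!: open_vimage[of W "\<lambda>h. (x, g ** h)", unfolded vimage_def] continuous_intros)
  then have o: "open ({h. invertible h} \<inter> {h. (x, g ** h) \<in> W})"
    using open_invertible by blast
  have in1: "mat 1 \<in> {h. invertible h} \<inter> {h. (x, g ** h) \<in> W}"
    using y m1 by (simp add: ye)
  have act: "BE_act k h (P c e y) = P c e (x, g ** h)" "(x, g ** h) \<in> W"
    if "h \<in> {h. invertible h} \<inter> {h. (x, g ** h) \<in> W}" for h
    using BE_act_P[OF c U xg, of h] that by (simp_all add: ye)
  have ev: "\<forall>\<^sub>F h in nhds (mat 1). BE_act k h (P c e y) \<in> fst d"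
    using eventually_nhds_in_open[OF o in1]
    by (rule eventually_mono) (use act in \<open>simp only: fst_conv, blast\<close>)
  have "((\<lambda>h. (x, g ** h)) has_derivative (\<lambda>a. (0, g ** a))) (at (mat 1))"
    by (intro has_derivative_Pair has_derivative_const bounded_linear_imp_has_derivative[OF bounded_linear_matrix_mult_left])
  then have der: "((\<lambda>h. snd d (BE_act k h (P c e y))) has_derivative (\<lambda>a. (0, g ** a))) (at (mat 1))"
    by (rule has_derivative_transform_within_open[OF _ o in1]) (simp only: act d_props(3))
  have "((\<lambda>h. snd d' (BE_act k h (P c e y))) has_derivative (\<lambda>a. jac d d' (P c e y) (0, g ** a))) (at (mat 1))"
    if "d' \<in> charts_at AB (P c e y)" for d'
    using has_derivative_change_chart[OF BE_smooth_atlas, of d "\<lambda>h. BE_act k h (P c e y)" "mat 1" d', unfolded q,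
        OF d_at[OF y] that ev der] .
  from fun_cong[OF frechet_derivative_at[OF this], of _ a]
  have "frechet_derivative (\<lambda>h. snd d' (BE_act k h (P c e y))) (at (mat 1)) a = jac d d' (P c e y) (0, snd y ** a)"
    if "d' \<in> charts_at AB (P c e y)" for d'
    using that by (simp only: ye snd_conv)
  then show ?thesis
    unfolding fundamental_vec_def coord_vec_eq by (intro ext) (simp only: split: if_split, blast)
qed

text \<open>The difference of two adapted forms vanishes on vertical vectors, as both reproduce the generators of fundamental vector fields.
On vectors that the soldering form maps to the monomial basis, its Spencer differential is the difference of two elements of \<open>gk_perp\<close>, because
the exterior derivative of the soldering form cancels. Then \<open>spencer_injective\<close> applies.\<close>

lemma adapted_unique:
  assumes y: "y \<in> W" and f: "adapted (P c e y) f" and f': "adapted (P c e y) f'" and v: "v \<in> T (P c e y)"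
  shows "f v = f' v"
proof -
  let ?q = "P c e y" and ?x = "fst y" and ?g = "snd y"
  have x: "?x \<in> D" and g: "invertible ?g" using WD[OF y] by auto
  have lin: "linear_on_space (T ?q) f" "linear_on_space (T ?q) f'"
    using f f' unfolding adapted_def by blast+
  define dl where "dl v = f v - f' v" for v
  have dl_lin: "linear_on_space (T ?q) dl"
    using lin unfolding linear_on_space_def dl_def by (simp add: scaleR_diff_right)
  have vert: "dl v = 0" if v: "v \<in> T ?q" "fst (v d) = 0" for v
  proof -
    have "v d = (0, ?g ** (matrix_inv ?g ** snd (v d)))"
      using v(2) by (simp add: prod_eq_iff matrix_mul_assoc matrix_inv_mult[OF g])
    then have "v = fundamental_vec k AB (matrix_inv ?g ** snd (v d)) ?q"
      using coord_d(3)[OF y v(1)] fundamental_vec_eq[OF y] by metis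
    moreover have "f (fundamental_vec k AB a ?q) = a" "f' (fundamental_vec k AB a ?q) = a" for a
      using f f' unfolding adapted_def by blast+
    ultimately show ?thesis unfolding dl_def by (metis diff_self)
  qed
  \<comment> \<open>vectors that the soldering form maps to the monomial basis of \<open>H\<^sub>k\<close>\<close>
  define w where "w i = coord_vec AB d ?q (\<Sum>l\<le>k. rho k ?g l i *\<^sub>R dual ?x l, 0)" for i
  have wT: "w i \<in> T ?q" for i unfolding w_def by (rule coord_d(1)[OF y])
  have wd: "fst (w i d) = (\<Sum>l\<le>k. rho k ?g l i *\<^sub>R dual ?x l)" for i
    unfolding w_def coord_d(2)[OF y] by (rule fst_conv)
  have omega_w: "omega j y (fst (w i d)) = kone k j i" for i j
  proof -
    have "omega j y (fst (w i d)) = kapp k (rho k (matrix_inv ?g)) (\<lambda>l. rho k ?g l i) j"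
      unfolding omega_def wd by (rule fun_cong[OF kapp_cong]) (rule theta_sum_dual[OF x])
    also have "\<dots> = kmult k (rho k (matrix_inv ?g)) (rho k ?g) j i"
      by (simp only: kapp_def kmult_def)
    finally show ?thesis by (simp only: rho_matrix_inv[OF g])
  qed
  have kap: "kapp k M (\<lambda>j. omega j y (fst (w i d))) r = M r i" if "i \<le> k" for M i r
  proof -
    have "kapp k M (\<lambda>j. omega j y (fst (w i d))) r = (\<Sum>j\<le>k. if j = i then M r i else 0)"
      unfolding omega_w kapp_def by (intro sum.cong) (auto simp: kone_def)
    then show ?thesis using that by simp
  qed
  have alg: "ktrace k (kmult k (drho k a) (spencer k (\<lambda>i. dl (w i)) i)) = 0" if i: "i \<le> k" for i a
  proof -
    obtain \<psi> \<psi>' where \<psi>: "\<psi> \<in> gk_perp k" "torsion_endo k A E s (\<lambda>_. f) ?q (w i) \<psi>"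
      "\<psi>' \<in> gk_perp k" "torsion_endo k A E s (\<lambda>_. f') ?q (w i) \<psi>'"
      using f f' wT unfolding adapted_def by metis
    have ent: "\<psi> r cc = ext_deriv AB (soldering k A E s r) ?q (w i) (w cc) + drho k (h (w i)) r cc - drho k (h (w cc)) r i"
      if t: "torsion_endo k A E s (\<lambda>_. h) ?q (w i) \<psi>" and r: "r \<le> k" and cc: "cc \<le> k" for h \<psi> r cc
    proof -
      have "torsion k A E s (\<lambda>_. h) r ?q (w i) (w cc) = (\<Sum>j\<le>k. \<psi> r j * soldering k A E s j ?q (w cc))"
        using t r wT unfolding torsion_endo_def by blast
      also have "\<dots> = kapp k \<psi> (\<lambda>j. omega j y (fst (w cc d))) r"
        unfolding kapp_def by (intro sum.cong refl) (simp only: atMost_iff soldering_eq[OF y wT])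
      also have "\<dots> = \<psi> r cc" by (rule kap[OF cc])
      finally show ?thesis
        unfolding torsion_eq[OF y r wT wT] kap[OF i] kap[OF cc] by simp
    qed
    have "spencer k (\<lambda>i. dl (w i)) i = (\<lambda>r cc. \<psi> r cc - \<psi>' r cc)"
    proof (intro ext)
      fix r cc
      show "spencer k (\<lambda>i. dl (w i)) i r cc = \<psi> r cc - \<psi>' r cc"
      proof (cases "r \<le> k \<and> cc \<le> k")
        case True
        then show ?thesis
          using ent[OF \<psi>(2), of r cc] ent[OF \<psi>(4), of r cc]
          by (simp add: spencer_def dl_def linear_diff[OF linear_drho])
      next
        case False
        then show ?thesis
          using gk_perpD(2)[OF \<psi>(1)] gk_perpD(2)[OF \<psi>(3)] by (auto simp: spencer_def ksupp_def)
      qed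
    qed
    then show ?thesis
      using gk_perpD(1)[OF \<psi>(1)] gk_perpD(1)[OF \<psi>(3)] by (simp add: ktrace_kmult_diff)
  qed
  have dlw: "dl (w i) = 0" if "i \<le> k" for i
    by (rule spencer_injective[OF k alg that])
  define z where "z = (\<Sum>i\<le>k. omega i y (fst (v d)) *\<^sub>R w i)"
  have zT: "z \<in> T ?q" unfolding z_def by (intro subspace_sum subspace_scale subspace_T wT)
  have "fst ((v - z) d) = 0"
  proof -
    have "fst (z d) = (\<Sum>i\<le>k. omega i y (fst (v d)) *\<^sub>R fst (w i d))"
      unfolding z_def by (simp only: sum_fun_apply scaleR_fun_def fst_sum fst_scaleR)
    also have "\<dots> = (\<Sum>l\<le>k. kapp k (rho k ?g) (\<lambda>i. omega i y (fst (v d))) l *\<^sub>R dual ?x l)"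
      unfolding wd scaleR_sum_right kapp_def scaleR_sum_left scaleR_scaleR
      by (subst sum.swap) (simp only: mult.commute)
    also have "\<dots> = (\<Sum>l\<le>k. \<theta> ?x (fst (v d)) l *\<^sub>R dual ?x l)"
      by (intro sum.cong refl) (simp only: atMost_iff rho_omega[OF g])
    also have "\<dots> = fst (v d)" by (rule dual_representation[OF x])
    finally show ?thesis by (simp only: minus_apply fst_diff diff_self)
  qed
  then have "dl (v - z) = 0"
    by (rule vert[OF subspace_diff[OF subspace_T v zT]])
  then have "dl v = dl z"
    using linear_on_space_diff[OF dl_lin subspace_T v zT] by simp
  also have "\<dots> = (\<Sum>i\<le>k. omega i y (fst (v d)) *\<^sub>R dl (w i))"
    unfolding z_def by (rule linear_on_space_sum[OF dl_lin subspace_T wT])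
  also have "\<dots> = 0" using dlw by (intro sum.neutral) simp
  finally show ?thesis by (simp add: dl_def)
qed

text \<open>The torsion at \<open>(x, g)\<close> is obtained from the one at \<open>(x, 1)\<close> by the action of \<open>\<rho>\<^sub>k(g)\<^sup>-\<^sup>1\<close>, and so the matrix
\<open>\<psi>\<close> for \<open>(x, 1)\<close> is replaced with its conjugate.\<close>

lemma adapted_local_conn:
  assumes y: "y \<in> W" and G: "coefficients \<Gamma>"
  shows "adapted (P c e y) (\<lambda>v. local_conn \<Gamma> y (v d))"
  unfolding adapted_def
proof (intro conjI allI ballI)
  let ?q = "P c e y" and ?x = "fst y" and ?g = "snd y"
  have x: "?x \<in> D" and g: "invertible ?g" using WD[OF y] by auto
  have Gl: "linear (\<Gamma> ?x)" using G unfolding coefficients_def by blast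
  have ll: "linear (local_conn \<Gamma> y)"
    unfolding local_conn_def using linear_add[OF Gl] linear_scale[OF Gl]
      linear_add[OF bounded_linear.linear[OF bounded_linear_matrix_mult_left]]
      linear_scale[OF bounded_linear.linear[OF bounded_linear_matrix_mult_left]]
      linear_add[OF bounded_linear.linear[OF bounded_linear_matrix_mult_right]]
      linear_scale[OF bounded_linear.linear[OF bounded_linear_matrix_mult_right]]
    by (intro linearI) (simp_all add: scaleR_add_right)
  show "linear_on_space (T ?q) (\<lambda>v. local_conn \<Gamma> y (v d))"
    unfolding linear_on_space_def
    by (simp only: plus_fun_apply scaleR_fun_def linear_add[OF ll] linear_scale[OF ll]) simp
  show "local_conn \<Gamma> y (fundamental_vec k AB a ?q d) = a" for a
    unfolding fundamental_vec_eq[OF y] coord_d(2)[OF y]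
    by (simp add: local_conn_def linear_0[OF Gl] linear_0[OF bounded_linear.linear[OF bounded_linear_matrix_mult_left]]
        linear_0[OF bounded_linear.linear[OF bounded_linear_matrix_mult_right]] matrix_mul_assoc matrix_inv_mult[OF g])
  fix v assume v: "v \<in> T ?q"
  let ?u = "fst (v d)"
  obtain \<psi> where \<psi>: "\<psi> \<in> gk_perp k" "\<And>u' i. i \<le> k \<Longrightarrow>
      dtheta ?x u' ?u i - dtheta ?x ?u u' i + kapp k (drho k (\<Gamma> ?x ?u)) (\<theta> ?x u') i - kapp k (drho k (\<Gamma> ?x u')) (\<theta> ?x ?u) i =
      kapp k \<psi> (\<theta> ?x u') i"
    using G x unfolding coefficients_def by meson
  let ?R = "rho k (matrix_inv ?g)"
  have rho_omega_cong: "kapp k M (kapp k (rho k ?g) (\<lambda>j. omega j y u)) = kapp k M (\<theta> ?x u)" for M u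
    by (rule kapp_cong) (rule rho_omega[OF g])
  have omega\<theta>: "kapp k (drho k (matrix_inv ?g ** (a ** ?g))) (\<lambda>j. omega j y u) i = kapp k ?R (kapp k (drho k a) (\<theta> ?x u)) i" for a u i
    unfolding drho_conj[OF g] kapp_kmult rho_omega_cong ..
  have "torsion_endo k A E s (\<lambda>_ v. local_conn \<Gamma> y (v d)) ?q v (kmult k ?R (kmult k \<psi> (rho k ?g)))"
    unfolding torsion_endo_def
  proof (intro conjI ballI allI impI)
    have "ksupp k (kmult k ?R (kmult k \<psi> (rho k ?g)))"
      by (intro ksupp_kmult ksupp_rho gk_perpD(2)[OF \<psi>(1)])
    then show "k < i \<or> k < j \<Longrightarrow> kmult k ?R (kmult k \<psi> (rho k ?g)) i j = 0" for i j
      unfolding ksupp_def by blast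
    fix w i assume w: "w \<in> T ?q" and i: "i \<le> k"
    let ?u' = "fst (w d)"
    have "torsion k A E s (\<lambda>_ v. local_conn \<Gamma> y (v d)) i ?q v w =
      kapp k ?R (dtheta ?x ?u' ?u) i - kapp k ?R (dtheta ?x ?u ?u') i
      + kapp k ?R (kapp k (drho k (\<Gamma> ?x ?u)) (\<theta> ?x ?u')) i - kapp k ?R (kapp k (drho k (\<Gamma> ?x ?u')) (\<theta> ?x ?u)) i"
      unfolding torsion_eq[OF y i v w] ext_deriv_soldering_eq[OF y i v w] local_conn_def kapp_drho_add omega\<theta>
      by linarith
    also have "\<dots> = kapp k ?R (\<lambda>j. dtheta ?x ?u' ?u j - dtheta ?x ?u ?u' j
        + kapp k (drho k (\<Gamma> ?x ?u)) (\<theta> ?x ?u') j - kapp k (drho k (\<Gamma> ?x ?u')) (\<theta> ?x ?u) j) i"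
      by (simp only: kapp_add kapp_diff)
    also have "\<dots> = kapp k ?R (kapp k \<psi> (\<theta> ?x ?u')) i"
      by (rule fun_cong[OF kapp_cong]) (rule \<psi>(2))
    also have "\<dots> = kapp k ?R (kapp k \<psi> (kapp k (rho k ?g) (\<lambda>j. omega j y ?u'))) i"
      unfolding rho_omega_cong ..
    also have "\<dots> = kapp k (kmult k ?R (kmult k \<psi> (rho k ?g))) (\<lambda>j. omega j y ?u') i"
      by (simp only: kapp_kmult)
    also have "\<dots> = (\<Sum>j\<le>k. kmult k ?R (kmult k \<psi> (rho k ?g)) i j * soldering k A E s j ?q w)"
      unfolding kapp_def[of k "kmult k ?R (kmult k \<psi> (rho k ?g))"]
      by (intro sum.cong refl) (simp only: atMost_iff soldering_eq[OF y w])
    finally show "torsion k A E s (\<lambda>_ v. local_conn \<Gamma> y (v d)) i ?q v w =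
      (\<Sum>j\<le>k. kmult k ?R (kmult k \<psi> (rho k ?g)) i j * soldering k A E s j ?q w)" .
  qed
  moreover have "kmult k ?R (kmult k \<psi> (rho k ?g)) \<in> gk_perp k"
    by (rule gk_perp_conj[OF g \<psi>(1)])
  ultimately show "\<exists>\<psi>\<in>gk_perp k. torsion_endo k A E s (\<lambda>_ v. local_conn \<Gamma> y (v d)) ?q v \<psi>" by blast
qed

lemma Cn_on_local_conn:
  assumes G: "coefficients \<Gamma>"
  shows "Cn_on n W (\<lambda>y. local_conn \<Gamma> y z)"
proof -
  have "Cn_on n D (\<lambda>x. \<Gamma> x (fst z))" using G unfolding coefficients_def by blast
  then show ?thesis
    unfolding local_conn_def
    by (intro Cn_on_add Cn_on_matrix_mult open_W Cn_on_inv_W Cn_on_const Cn_on_fst_W Cn_on_linear[OF bounded_linear_snd])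
qed

end

section \<open>The connection\<close>

context gl2_structure
begin

text \<open>By \<open>adapted_unique\<close> the choice is unique on tangent vectors, and so it agrees with the local solutions in
all charts, see \<open>conn_eq\<close>.\<close>

definition conn where
  "conn q v = (if q \<in> B \<and> v \<in> T q then (SOME f. adapted q f) v else 0)"

lemma torsion_endo_cong:
  assumes eq: "\<And>w. w \<in> T q \<Longrightarrow> \<phi> q w = \<phi>' q w" and v: "v \<in> T q"
  shows "torsion_endo k A E s \<phi> q v \<psi> \<longleftrightarrow> torsion_endo k A E s \<phi>' q v \<psi>"
proof -
  have "torsion k A E s \<phi> i q v w = torsion k A E s \<phi>' i q v w" if "w \<in> T q" for i w
    unfolding torsion_def eq[OF v] eq[OF that] ..
  then show ?thesis
    unfolding torsion_endo_def by (simp cong: ball_cong)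
qed

end

context gl2_BE_chart
begin

lemma conn_eq:
  assumes y: "y \<in> W" and G: "coefficients \<Gamma>" and v: "v \<in> T (P c e y)"
  shows "conn (P c e y) v = local_conn \<Gamma> y (v d)"
proof -
  have "adapted (P c e y) (SOME f. adapted (P c e y) f)"
    by (rule someI[of "adapted (P c e y)"]) (rule adapted_local_conn[OF y G])
  from adapted_unique[OF y this adapted_local_conn[OF y G] v] show ?thesis
    unfolding conn_def using P_B[OF y] v by (simp only: if_True simp_thms)
qed

lemma fundamental_vec_in_T: "y \<in> W \<Longrightarrow> fundamental_vec k AB a (P c e y) \<in> T (P c e y)"
  unfolding fundamental_vec_eq by (rule coord_d(1))

lemma conn_adapted:
  assumes y: "y \<in> W"
  shows "linear_on_space (T (P c e y)) (conn (P c e y))"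
    "conn (P c e y) (fundamental_vec k AB a (P c e y)) = a"
    "v \<in> T (P c e y) \<Longrightarrow> \<exists>\<psi>\<in>gk_perp k. torsion_endo k A E s conn (P c e y) v \<psi>"
proof -
  obtain \<Gamma> where G: "coefficients \<Gamma>" using coefficients_exist ..
  note ad = adapted_local_conn[OF y G, unfolded adapted_def]
  note eq = conn_eq[OF y G]
  show "linear_on_space (T (P c e y)) (conn (P c e y))"
    unfolding linear_on_space_def
  proof (intro conjI ballI allI)
    fix u v r assume u: "u \<in> T (P c e y)"
    show "conn (P c e y) (r *\<^sub>R u) = r *\<^sub>R conn (P c e y) u"
      using ad[THEN conjunct1] u unfolding linear_on_space_def eq[OF u] eq[OF subspace_scale[OF subspace_T u]] by blast
    assume v: "v \<in> T (P c e y)"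
    show "conn (P c e y) (u + v) = conn (P c e y) u + conn (P c e y) v"
      using ad[THEN conjunct1] u v
      unfolding linear_on_space_def eq[OF u] eq[OF v] eq[OF subspace_add[OF subspace_T u v]] by blast
  qed
  show "conn (P c e y) (fundamental_vec k AB a (P c e y)) = a"
    unfolding eq[OF fundamental_vec_in_T[OF y]] using ad by blast
  show "\<exists>\<psi>\<in>gk_perp k. torsion_endo k A E s conn (P c e y) v \<psi>" if v: "v \<in> T (P c e y)"
    using ad v torsion_endo_cong[of "P c e y" conn "\<lambda>_ v. local_conn \<Gamma> y (v d)" v] eq by blast
qed

lemma Cn_on_form_coeff_conn: "Cn_on n (snd d ` fst d) (form_coeff AB conn d z)"
proof -
  obtain \<Gamma> where G: "coefficients \<Gamma>" using coefficients_exist ..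
  have "local_conn \<Gamma> y z = form_coeff AB conn d z y" if y: "y \<in> W" for y
    unfolding form_coeff_def d_props(2)[OF y] conn_eq[OF y G coord_d(1)[OF y]] coord_d(2)[OF y] ..
  from Cn_on_cong_open[OF open_W this Cn_on_local_conn[OF G]] show ?thesis
    unfolding d_props(1) .
qed

text \<open>Both points can be described over the same chart of the base and the same local frame, hence with the same
coefficients \<open>\<Gamma>\<close>; the assertion is then visible from the formula for \<open>local_conn\<close>.\<close>

lemma conn_equivariant:
  assumes y: "y \<in> W" and g: "invertible g" and v: "v \<in> T (P c e y)"
  shows "conn (BE_act k g (P c e y)) (tangent_map AB AB (BE_act k g) (P c e y) v) =
    matrix_inv g ** (conn (P c e y) v ** g)"
proof -
  obtain \<Gamma> where G: "coefficients \<Gamma>" using coefficients_exist ..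
  obtain x h where ye: "y = (x, h)" by force
  have xh: "x \<in> D" "invertible h" using WD[OF y] by (simp_all add: ye)
  have hg: "invertible (h ** g)" by (rule invertible_mult[OF xh(2) g])
  obtain W' where W': "(x, h ** g) \<in> W'" "open W'" "W' \<subseteq> cdom c U \<times> {g. invertible g}" "inj_on (P c e) W'"
    by (rule BE_chart_exists[OF c U xh(1) hg])
  interpret l': gl2_BE_chart k X A E s c U e \<theta> W'
    by unfold_locales (use W' in auto)
  let ?y' = "(x, h ** g)"
  have act: "BE_act k g (P c e z) = P c e (fst z, snd z ** g)" if "z \<in> W" for z
    using BE_act_P[OF c U WD(1)[OF that] WD(2)[OF that] g] by simp
  have q': "BE_act k g (P c e y) = P c e ?y'" using act[OF y] by (simp add: ye)
  let ?R = "\<lambda>z :: 'm \<times> (real^2^2). (fst z, snd z ** g)"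
  have R: "bounded_linear ?R"
    by (intro bounded_linear_Pair bounded_linear_fst bounded_linear_compose[OF bounded_linear_matrix_mult_right] bounded_linear_snd)
  have "open (?R -` W')"
    using W'(2) linear_continuous_on[OF R, of UNIV] by (rule open_vimage)
  then have o: "open (W \<inter> ?R -` W')" using open_W by blast
  have yo: "y \<in> W \<inter> ?R -` W'" using y W'(1) by (simp add: ye)
  have "tangent_map AB AB (BE_act k g) (P c e y) v = coord_vec AB l'.d (BE_act k g (P c e y)) (?R (v d))"
  proof (rule tangent_map_eq[OF BE_smooth_atlas BE_smooth_atlas d_at[OF y] _ _ _ v])
    show "l'.d \<in> charts_at AB (BE_act k g (P c e y))"
      unfolding q' by (rule l'.d_at[OF W'(1)])
    show "\<forall>\<^sub>F z in nhds (snd d (P c e y)). BE_act k g (chart_inv d z) \<in> fst l'.d"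
      unfolding d_props(3)[OF y] using eventually_nhds_in_open[OF o yo]
    proof eventually_elim
      case (elim z)
      then have z: "z \<in> W" "?R z \<in> W'" by auto
      show ?case unfolding d_props(2)[OF z(1)] act[OF z(1)] fst_conv using z(2) by (rule imageI)
    qed
    show "((\<lambda>z. snd l'.d (BE_act k g (chart_inv d z))) has_derivative ?R) (at (snd d (P c e y)))"
      unfolding d_props(3)[OF y]
    proof (rule has_derivative_transform_within_open[OF bounded_linear_imp_has_derivative[OF R] o yo])
      fix z assume "z \<in> W \<inter> ?R -` W'"
      then have z: "z \<in> W" "?R z \<in> W'" by auto
      show "?R z = snd l'.d (BE_act k g (chart_inv d z))"
        unfolding d_props(2)[OF z(1)] act[OF z(1)] by (rule l'.d_props(3)[OF z(2), symmetric])
    qed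
  qed
  then have tm: "tangent_map AB AB (BE_act k g) (P c e y) v = coord_vec AB l'.d (P c e ?y') (?R (v d))"
    unfolding q' .
  have "conn (BE_act k g (P c e y)) (tangent_map AB AB (BE_act k g) (P c e y) v) = local_conn \<Gamma> ?y' (?R (v d))"
    unfolding q' tm l'.conn_eq[OF W'(1) G l'.coord_d(1)[OF W'(1)]] l'.coord_d(2)[OF W'(1)] ..
  also have "\<dots> = matrix_inv g ** (local_conn \<Gamma> y (v d) ** g)"
    unfolding local_conn_def ye fst_conv snd_conv matrix_inv_matrix_mult[OF g xh(2)]
    by (simp add: matrix_mul_assoc matrix_add_ldistrib
        linear_add[OF bounded_linear.linear[OF bounded_linear_matrix_mult_right]])
  also have "\<dots> = matrix_inv g ** (conn (P c e y) v ** g)"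
    unfolding conn_eq[OF y G v] ..
  finally show ?thesis .
qed

end

context gl2_structure
begin

lemma conn_GL2_connection: "GL2_connection k X A E s conn"
  unfolding GL2_connection_def Let_def smooth_form1_def
proof (intro conjI ballI allI impI)
  fix q assume "q \<in> B"
  then obtain c U e \<theta> W y where l: "gl2_BE_chart k X A E s c U e \<theta> W" and y: "y \<in> W" and q: "q = P c e y"
    by (rule BE_point_cases)
  interpret gl2_BE_chart k X A E s c U e \<theta> W by (rule l)
  show "linear_on_space (T q) (conn q)" unfolding q by (rule conn_adapted(1)[OF y])
  show "drho k (conn q (fundamental_vec k AB a q)) = drho k a" for a
    unfolding q conn_adapted(2)[OF y] ..
  fix g :: "real^2^2" and v assume g: "invertible g" and v: "v \<in> T q"
  show "drho k (conn (BE_act k g q) (tangent_map AB AB (BE_act k g) q v)) =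
    kmult k (rho k (matrix_inv g)) (kmult k (drho k (conn q v)) (rho k g))"
    using conn_equivariant[OF y g] v unfolding q by (simp only: drho_conj[OF g])
next
  fix q v assume "q \<notin> B \<or> v \<notin> T q"
  then show "conn q v = 0" by (auto simp: conn_def)
next
  fix d z assume "d \<in> AB"
  then obtain c U e \<theta> W where l: "gl2_BE_chart k X A E s c U e \<theta> W" and d: "d = (P c e ` W, inv_into W (P c e))"
    by (rule BE_chart_cases)
  show "smooth_on (snd d ` fst d) (form_coeff AB conn d z)"
    unfolding smooth_on_def d using gl2_BE_chart.Cn_on_form_coeff_conn[OF l] by blast
qed

lemma conn_torsion:
  assumes "q \<in> B" "v \<in> T q"
  shows "\<exists>\<psi>\<in>gk_perp k. torsion_endo k A E s conn q v \<psi>"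
proof -
  obtain c U e \<theta> W y where l: "gl2_BE_chart k X A E s c U e \<theta> W" and y: "y \<in> W" and q: "q = P c e y"
    using assms(1) by (rule BE_point_cases)
  show ?thesis
    using gl2_BE_chart.conn_adapted(3)[OF l y] assms(2) unfolding q by blast
qed

lemma conn_unique:
  assumes \<phi>: "GL2_connection k X A E s \<phi>"
    and tor: "\<And>q v. q \<in> B \<Longrightarrow> v \<in> T q \<Longrightarrow> \<exists>\<psi>\<in>gk_perp k. torsion_endo k A E s \<phi> q v \<psi>"
  shows "\<phi> = conn"
proof (intro ext)
  fix q v
  have sf: "smooth_form1 B AB \<phi>" and vert: "\<And>a q. q \<in> B \<Longrightarrow> drho k (\<phi> q (fundamental_vec k AB a q)) = drho k a"
    using \<phi> unfolding GL2_connection_def Let_def by blast+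
  show "\<phi> q v = conn q v"
  proof (cases "q \<in> B \<and> v \<in> T q")
    case True
    then have qB: "q \<in> B" and v: "v \<in> T q" by auto
    obtain c U e \<theta> W y where l: "gl2_BE_chart k X A E s c U e \<theta> W" and y: "y \<in> W" and q: "q = P c e y"
      using qB by (rule BE_point_cases)
    interpret gl2_BE_chart k X A E s c U e \<theta> W by (rule l)
    have "adapted q (\<phi> q)"
      unfolding adapted_def
    proof (intro conjI allI ballI)
      show "linear_on_space (T q) (\<phi> q)" using sf qB unfolding smooth_form1_def by blast
      show "\<phi> q (fundamental_vec k AB a q) = a" for a
        using drho_inject[OF _ vert[OF qB]] k by simp
      show "\<exists>\<psi>\<in>gk_perp k. torsion_endo k A E s (\<lambda>_. \<phi> q) q w \<psi>" if "w \<in> T q" for w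
        using tor[OF qB that] torsion_endo_cong[of q \<phi> "\<lambda>_. \<phi> q" w, OF refl that] by blast
    qed
    moreover have "adapted q (SOME f. adapted q f)"
      by (rule someI[of "adapted q"]) fact
    ultimately have "\<phi> q v = (SOME f. adapted q f) v"
      using adapted_unique[OF y] v unfolding q by blast
    then show ?thesis unfolding conn_def using True by (simp only: if_True simp_thms)
  next
    case False
    then have "\<phi> q v = 0" using sf unfolding smooth_form1_def by blast
    then show ?thesis unfolding conn_def using False by (simp only: if_False)
  qed
qed

end

theorem theorem5p1:
  fixes X :: "'a topology"
    and A :: "('a, 'm::euclidean_space) chart set"
    and E :: "('a, nat, 'v::real_vector) vbundle"
    and s :: "'a \<Rightarrow> ('a, 'm) tangent \<Rightarrow> ('v \<Rightarrow> real) \<Rightarrow> real"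
    and k :: nat
  assumes "GL2_structure k X A E s"
    and "k + 1 > 3"
  shows "\<exists>!\<phi>. GL2_connection k X A E s \<phi> \<and>
    (\<forall>q\<in>BE k X A E s. \<forall>v\<in>tangent_space (BE_atlas k A E s) q.
       \<exists>\<psi>\<in>gk_perp k. torsion_endo k A E s \<phi> q v \<psi>)"
proof -
  interpret gl2_structure k X A E s
    by unfold_locales (use assms in auto)
  show ?thesis
  proof (rule ex1I[of _ conn])
    show "GL2_connection k X A E s conn \<and>
      (\<forall>q\<in>BE k X A E s. \<forall>v\<in>tangent_space (BE_atlas k A E s) q.
         \<exists>\<psi>\<in>gk_perp k. torsion_endo k A E s conn q v \<psi>)"
      using conn_GL2_connection conn_torsion by blast
  next
    fix \<phi> assume "GL2_connection k X A E s \<phi> \<and>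
      (\<forall>q\<in>BE k X A E s. \<forall>v\<in>tangent_space (BE_atlas k A E s) q.
         \<exists>\<psi>\<in>gk_perp k. torsion_endo k A E s \<phi> q v \<psi>)"
    then show "\<phi> = conn" by (intro conn_unique) blast+
  qed
qed

end
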